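(* There exists a deterministic, combinatorial, polynomial-time algorithm that achieves an approximation ratio of $4m$ for the coflow-level coflow scheduling problem in identical parallel networks without release times (all coflows released at time $0$), where $m$ is the number of network cores.
   Context: Identical parallel network: $m$ identical network cores, each an $N\times N$ non-blocking switch; the $i$-th input port of every core is connected to source server $i\in\mathcal{I}=\{1,\dots,N\}$ and the $j$-th output port of every core to destination server $j\in\mathcal{J}=\{1,\dots,N\}$. All links have unit capacity, so on each core, at any time, each input port and each output port transmits data of at most one flow, at rate at most 1; transmission may be preempted. A set $\mathcal{K}$ of $n$ coflows is given; coflow $k$ has a demand matrix $D^{(k)}=(d_{i,j,k})_{i,j=1}^N$ of nonnegative integers, where $d_{i,j,k}$ is the size (equivalently, transmission time) of flow $(i,j,k)$ from source $i$ to destination $j$, and a positive weight $w_k$; here all coflows are available at time $0$. The completion time $C_k$ of coflow $k$ is the time at which the last of its flows finishes. In the coflow-level scheduling problem, all flows of a given coflow must be transmitted on one and the same core (chosen by the scheduler). The objective is to minimize $\sum_{k\in\mathcal{K}} w_k C_k$. An algorithm has approximation ratio $\rho$ if on every instance its schedule has objective at most $\rho$ times the optimum. *)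

theory Defs
  imports
    "HOL-Analysis.Analysis"
    "HOL-Library.Log_Nat"
    "HOL-Computational_Algebra.Polynomial"
begin

section \<open>Coflow scheduling in identical parallel networks\<close>

text \<open>
  Servers, cores and coflows are numbered from 0.  Only the values \<open>demand I i j k\<close> and
  \<open>weight I k\<close> with \<open>i, j < num_ports I\<close> and \<open>k < num_coflows I\<close> are meaningful.  Weights are
  rational because an algorithm has to receive them as finite data.
\<close>

record coflow_instance =
  num_ports :: nat
  num_cores :: nat
  num_coflows :: nat
  demand :: "nat \<Rightarrow> nat \<Rightarrow> nat \<Rightarrow> nat"
  weight :: "nat \<Rightarrow> rat"

definition wf_instance :: "coflow_instance \<Rightarrow> bool" where
  "wf_instance I \<longleftrightarrow>
     num_ports I \<ge> 1 \<and> num_cores I \<ge> 1 \<and> (\<forall>k<num_coflows I. weight I k > 0)"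

text \<open>
  Coflow-level schedules: each coflow \<open>k\<close> has a single core \<open>core_of S k\<close>, and
  \<open>rate S i j k t\<close> is the rate at which flow \<open>(i, j, k)\<close> is transmitted on that core at time \<open>t\<close>.
\<close>

record schedule =
  core_of :: "nat \<Rightarrow> nat"
  rate :: "nat \<Rightarrow> nat \<Rightarrow> nat \<Rightarrow> real \<Rightarrow> real"

definition transmitted :: "schedule \<Rightarrow> nat \<Rightarrow> nat \<Rightarrow> nat \<Rightarrow> real \<Rightarrow> real" where
  "transmitted S i j k T = (LINT t:{0..T}|lborel. rate S i j k t)"

definition feasible :: "coflow_instance \<Rightarrow> schedule \<Rightarrow> bool" where
  "feasible I S \<longleftrightarrow>
     (\<forall>k<num_coflows I. core_of S k < num_cores I) \<and>
     (\<forall>i<num_ports I. \<forall>j<num_ports I. \<forall>k<num_coflows I.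
        rate S i j k \<in> borel_measurable borel \<and>
        (\<forall>t\<ge>0. 0 \<le> rate S i j k t \<and> rate S i j k t \<le> 1)) \<and>
     (\<forall>h<num_cores I. \<forall>i<num_ports I. \<forall>t\<ge>0.
        card {(j, k). j < num_ports I \<and> k < num_coflows I \<and> core_of S k = h \<and>
                      rate S i j k t > 0} \<le> 1) \<and>
     (\<forall>h<num_cores I. \<forall>j<num_ports I. \<forall>t\<ge>0.
        card {(i, k). i < num_ports I \<and> k < num_coflows I \<and> core_of S k = h \<and>
                      rate S i j k t > 0} \<le> 1) \<and>
     (\<forall>i<num_ports I. \<forall>j<num_ports I. \<forall>k<num_coflows I.
        (\<forall>T\<ge>0. transmitted S i j k T \<le> real (demand I i j k)) \<and>
        (\<exists>T\<ge>0. transmitted S i j k T = real (demand I i j k)))"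

definition flow_completion :: "coflow_instance \<Rightarrow> schedule \<Rightarrow> nat \<Rightarrow> nat \<Rightarrow> nat \<Rightarrow> real" where
  "flow_completion I S i j k = Inf {T. T \<ge> 0 \<and> transmitted S i j k T = real (demand I i j k)}"

definition coflow_completion :: "coflow_instance \<Rightarrow> schedule \<Rightarrow> nat \<Rightarrow> real" where
  "coflow_completion I S k =
     Max ((\<lambda>(i, j). flow_completion I S i j k) ` ({..<num_ports I} \<times> {..<num_ports I}))"

definition objective :: "coflow_instance \<Rightarrow> schedule \<Rightarrow> real" where
  "objective I S = (\<Sum>k<num_coflows I. real_of_rat (weight I k) * coflow_completion I S k)"

definition optimum :: "coflow_instance \<Rightarrow> real" where
  "optimum I = (INF S\<in>{S. feasible I S}. objective I S)"


section \<open>Model of computation\<close>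

text \<open>
  A random access machine, programmed in a while language.  The memory consists of arrays of
  natural numbers, a scalar being cell 0 of an array; \<open>Sub\<close> is truncated.  A run has two costs:
  the number of elementary operations (unit cost), and the logarithmic cost, in which every
  operation is charged the bit lengths of the numbers and addresses it handles.  The
  logarithmic cost is polynomially related to the running time of a Turing machine.
\<close>

type_synonym state = "string \<Rightarrow> nat \<Rightarrow> nat"

datatype aexp =
    Const nat
  | Read string aexp
  | Add aexp aexp
  | Sub aexp aexp
  | Mul aexp aexp

datatype bexp =
    Less aexp aexp
  | Neg bexp
  | Conj bexp bexp

datatype com =
    Skip
  | Write string aexp aexp
  | Seq com com
  | Cond bexp com com
  | While bexp com

primrec aval :: "aexp \<Rightarrow> state \<Rightarrow> nat" where
  "aval (Const c) s = c"
| "aval (Read x a) s = s x (aval a s)"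
| "aval (Add a b) s = aval a s + aval b s"
| "aval (Sub a b) s = aval a s - aval b s"
| "aval (Mul a b) s = aval a s * aval b s"

primrec bval :: "bexp \<Rightarrow> state \<Rightarrow> bool" where
  "bval (Less a b) s \<longleftrightarrow> aval a s < aval b s"
| "bval (Neg b) s \<longleftrightarrow> \<not> bval b s"
| "bval (Conj b c) s \<longleftrightarrow> bval b s \<and> bval c s"

primrec aops :: "aexp \<Rightarrow> nat" where
  "aops (Const c) = 1"
| "aops (Read x a) = 1 + aops a"
| "aops (Add a b) = 1 + aops a + aops b"
| "aops (Sub a b) = 1 + aops a + aops b"
| "aops (Mul a b) = 1 + aops a + aops b"

primrec bops :: "bexp \<Rightarrow> nat" where
  "bops (Less a b) = 1 + aops a + aops b"
| "bops (Neg b) = 1 + bops b"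
| "bops (Conj b c) = 1 + bops b + bops c"

text \<open>
  \<open>floorlog 2 v\<close> is the bit length of \<open>v\<close>.  Every node of an expression pays for its own result,
  so the operands of an operation, addresses included, are paid for by its subexpressions.
\<close>

primrec acost :: "aexp \<Rightarrow> state \<Rightarrow> nat" where
  "acost (Const c) s = 1 + floorlog 2 c"
| "acost (Read x a) s = 1 + acost a s + floorlog 2 (aval (Read x a) s)"
| "acost (Add a b) s = 1 + acost a s + acost b s + floorlog 2 (aval (Add a b) s)"
| "acost (Sub a b) s = 1 + acost a s + acost b s + floorlog 2 (aval (Sub a b) s)"
| "acost (Mul a b) s = 1 + acost a s + acost b s + floorlog 2 (aval (Mul a b) s)"

primrec bcost :: "bexp \<Rightarrow> state \<Rightarrow> nat" where
  "bcost (Less a b) s = 1 + acost a s + acost b s"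
| "bcost (Neg b) s = 1 + bcost b s"
| "bcost (Conj b c) s = 1 + bcost b s + bcost c s"

text \<open>
  \<open>exec c s u l s'\<close>: started in \<open>s\<close>, program \<open>c\<close> halts in \<open>s'\<close> after \<open>u\<close> elementary operations and
  with logarithmic cost \<open>l\<close>.
\<close>

inductive exec :: "com \<Rightarrow> state \<Rightarrow> nat \<Rightarrow> nat \<Rightarrow> state \<Rightarrow> bool" where
  Skip: "exec Skip s 1 1 s"
| Write: "exec (Write x a b) s (1 + aops a + aops b) (1 + acost a s + acost b s)
            (s(x := (s x)(aval a s := aval b s)))"
| Seq: "exec c s u l s' \<Longrightarrow> exec d s' v r s'' \<Longrightarrow> exec (Seq c d) s (u + v) (l + r) s''"
| CondTrue: "bval b s \<Longrightarrow> exec c s u l s' \<Longrightarrow>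
     exec (Cond b c d) s (bops b + u) (bcost b s + l) s'"
| CondFalse: "\<not> bval b s \<Longrightarrow> exec d s u l s' \<Longrightarrow>
     exec (Cond b c d) s (bops b + u) (bcost b s + l) s'"
| WhileFalse: "\<not> bval b s \<Longrightarrow> exec (While b c) s (bops b) (bcost b s) s"
| WhileTrue: "bval b s \<Longrightarrow> exec c s u l s' \<Longrightarrow> exec (While b c) s' v r s'' \<Longrightarrow>
     exec (While b c) s (bops b + u + v) (bcost b s + l + r) s''"

lemma exec_deterministic:
  "exec c s u l s' \<Longrightarrow> exec c s v r s'' \<Longrightarrow> v = u \<and> r = l \<and> s'' = s'"
proof (induction arbitrary: v r s'' rule: exec.induct)
  case Skip
  then show ?case by (auto elim: exec.cases)
next
  case Write
  then show ?case by (auto elim: exec.cases)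
next
  case (Seq c s u l s' d v' r' s2)
  from Seq.prems show ?case
    by cases (use Seq.IH in blast)
next
  case (CondTrue b s c u l s' d)
  from CondTrue.prems show ?case
    by cases (use CondTrue.IH CondTrue.hyps in blast)+
next
  case (CondFalse b s d u l s' c)
  from CondFalse.prems show ?case
    by cases (use CondFalse.IH CondFalse.hyps in blast)+
next
  case (WhileFalse b s c)
  from WhileFalse.prems show ?case
    by cases (use WhileFalse.hyps in blast)+
next
  case (WhileTrue b s c u l s' v' r' s2)
  from WhileTrue.prems show ?case
    by cases (use WhileTrue.IH WhileTrue.hyps in blast)+
qed


section \<open>Algorithms for coflow scheduling\<close>

text \<open>The demand of flow \<open>(i, j, k)\<close> is stored in cell \<open>(k * N + i) * N + j\<close> of array \<open>d\<close>.\<close>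

definition input_state :: "coflow_instance \<Rightarrow> state" where
  "input_state I = (\<lambda>x a.
     let N = num_ports I; n = num_coflows I in
     if x = ''N'' \<and> a = 0 then N
     else if x = ''m'' \<and> a = 0 then num_cores I
     else if x = ''n'' \<and> a = 0 then n
     else if x = ''wnum'' \<and> a < n then nat (fst (quotient_of (weight I a)))
     else if x = ''wden'' \<and> a < n then nat (snd (quotient_of (weight I a)))
     else if x = ''d'' \<and> a < n * N * N
       then demand I (a div N mod N) (a mod N) (a div (N * N))
     else 0)"

definition input_size :: "coflow_instance \<Rightarrow> nat" where
  "input_size I =
     num_ports I + num_cores I + num_coflows I +
     (\<Sum>k<num_coflows I. floorlog 2 (nat (fst (quotient_of (weight I k)))) +
                         floorlog 2 (nat (snd (quotient_of (weight I k))))) +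
     (\<Sum>i<num_ports I. \<Sum>j<num_ports I. \<Sum>k<num_coflows I. floorlog 2 (demand I i j k))"

text \<open>
  The output is an assignment of coflows to cores and a list of \<open>len\<close> transmissions, the \<open>r\<close>-th
  of which sends flow \<open>(src r, dst r, coflow r)\<close> at rate 1 during \<open>[start r, stop r)\<close>.
\<close>

definition output_schedule :: "state \<Rightarrow> schedule" where
  "output_schedule s =
     \<lparr>core_of = s ''core'',
      rate = (\<lambda>i j k t.
        if \<exists>r < s ''len'' 0. s ''src'' r = i \<and> s ''dst'' r = j \<and> s ''coflow'' r = k \<and>
             real (s ''start'' r) \<le> t \<and> t < real (s ''stop'' r)
        then 1 else 0)\<rparr>"

definition polynomial_time :: "com \<Rightarrow> bool" where
  "polynomial_time c \<longleftrightarrow>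
     (\<exists>p :: nat poly. \<forall>I. wf_instance I \<longrightarrow>
        (\<exists>u l s. exec c (input_state I) u l s \<and> l \<le> poly p (input_size I)))"

text \<open>
  There is no standard formal definition of a combinatorial algorithm.  The word sets an algorithm
  apart from those that call a numerical solver for a linear program; this is rendered by requiring
  that the number of elementary operations (additions, subtractions, multiplications, comparisons
  and memory accesses) is bounded by a polynomial in the dimensions of the instance alone, whatever
  the magnitude of its numbers.  Together with \<open>polynomial_time\<close> this is strong polynomiality.
\<close>

definition combinatorial :: "com \<Rightarrow> bool" where
  "combinatorial c \<longleftrightarrow>
     (\<exists>p :: nat poly. \<forall>I. wf_instance I \<longrightarrow>
        (\<exists>u l s. exec c (input_state I) u l s \<and>
           u \<le> poly p (num_ports I + num_cores I + num_coflows I)))"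

definition has_approximation_ratio :: "com \<Rightarrow> (coflow_instance \<Rightarrow> real) \<Rightarrow> bool" where
  "has_approximation_ratio c \<rho> \<longleftrightarrow>
     (\<forall>I. wf_instance I \<longrightarrow>
        (\<exists>u l s. exec c (input_state I) u l s \<and>
           feasible I (output_schedule s) \<and>
           objective I (output_schedule s) \<le> \<rho> I * optimum I))"

end

theory Submission
  imports Defs
begin

text \<open>
  All coflows are sent over core 0.  A primal-dual scheme orders them from last to first: it takes a
  port \<open>\<mu>\<close> of maximal remaining load, puts last a remaining coflow \<open>b\<close> with the smallest ratio of
  weight to load at \<open>\<mu>\<close>, and subtracts from all weights the multiple of the loads at \<open>\<mu>\<close> that makes the
  weight of \<open>b\<close> vanish.  In any schedule on \<open>m\<close> cores the loads \<open>P k\<close> at one port and the completion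
  times \<open>C k\<close> satisfy \<open>(\<Sum>k\<in>U. P k)\<^sup>2 \<le> 2 m (\<Sum>k\<in>U. P k * C k)\<close> for every set \<open>U\<close> of coflows, so by induction
  along the decomposition of the weights, the weighted sum of the maximal prefix loads of the order is
  at most \<open>2 m\<close> times the optimum.

  Along this order, unfinished flows are repeatedly matched greedily and sent until one of the matched
  flows is finished.  An unfinished flow is at any time either sent or blocked at one of its two ports
  by a flow of no lower priority, so a coflow is complete after twice the maximal load of its prefix,
  which gives the factor \<open>4 m\<close>.

  To stay strongly polynomial without division, the weights are kept as integers over a common
  denominator; each round multiplies them by a single load, so their bit lengths grow additively.
\<close>

section \<open>Programs with bounded loops\<close>

text \<open>The factor \<open>m\<close> is paid entirely in the lower bound: by time
  \<open>C k\<close> one port moves at most \<open>m * C k\<close> over all cores, so leaving all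
  cores but one idle costs nothing beyond it. The 2 in \<open>2 m\<close> comes from splitting a
  square into ordered pairs. The induction closes because the port has maximal load: for the coflow
  placed last the maximal prefix load is the load at that very port, so the subtracted multiple of
  the loads contributes at most a multiple of the square of their sum, exactly what the inequality
  bounds. The order is built from the back, so its prefixes are known only when the loop ends. Its
  invariant is therefore an implication about every order that extends the suffix placed so far.
  Both running time claims are reduced to syntax. Loop bounds depend on \<open>N\<close> and
  \<open>n\<close> alone, so a polynomial for the operation count can be read off the program; the
  logarithmic cost then follows from this count, since the only products ever stored have a single
  factor that is itself built from products, which rules out repeated squaring.\<close>

datatype prog =
    PSkip
  | PWrite string aexp aexp
  | PSeq prog prog
  | PCond bexp prog prog
  | PFor string aexp prog

abbreviation scalar :: "string \<Rightarrow> aexp" where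
  "scalar x \<equiv> Read x (Const 0)"

definition upd :: "state \<Rightarrow> string \<Rightarrow> nat \<Rightarrow> nat \<Rightarrow> state" where
  "upd s x a v = s(x := (s x)(a := v))"

lemma upd_apply: "upd s x a v y b = (if y = x \<and> b = a then v else s y b)"
  by (simp add: upd_def)

lemma upd_same: "upd s x a v x = (s x)(a := v)"
  by (simp add: upd_def)

lemma upd_other: "y \<noteq> x \<Longrightarrow> upd s x a v y = s y"
  by (simp add: upd_def)

fun compile :: "prog \<Rightarrow> com" where
  "compile PSkip = Skip"
| "compile (PWrite x a b) = Write x a b"
| "compile (PSeq p q) = Seq (compile p) (compile q)"
| "compile (PCond b p q) = Cond b (compile p) (compile q)"
| "compile (PFor x e p) =
     Seq (Write x (Const 0) (Const 0))
         (While (Less (scalar x) e)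
            (Seq (compile p) (Write x (Const 0) (Add (scalar x) (Const 1)))))"

text \<open>The bound is evaluated once here, whereas the compiled loop evaluates it before every
  iteration; \<open>static\<close> makes the two agree. The counter is left equal to the bound, as
  the while loop leaves it.\<close>

fun run :: "prog \<Rightarrow> state \<Rightarrow> state" where
  "run PSkip s = s"
| "run (PWrite x a b) s = upd s x (aval a s) (aval b s)"
| "run (PSeq p q) s = run q (run p s)"
| "run (PCond b p q) s = (if bval b s then run p s else run q s)"
| "run (PFor x e p) s =
     upd (fold (\<lambda>k t. run p (upd t x 0 k)) [0..<aval e s] s) x 0 (aval e s)"

fun writes :: "prog \<Rightarrow> string set" where
  "writes PSkip = {}"
| "writes (PWrite x a b) = {x}"
| "writes (PSeq p q) = writes p \<union> writes q"
| "writes (PCond b p q) = writes p \<union> writes q"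
| "writes (PFor x e p) = insert x (writes p)"

lemma fold_frame:
  assumes "\<And>k t. f k t x = t x"
  shows "fold f ks s x = s x"
  using assms by (induction ks arbitrary: s) auto

lemma run_frame: "x \<notin> writes p \<Longrightarrow> run p s x = s x"
proof (induction p arbitrary: s)
  case (PFor y e p)
  have "fold (\<lambda>k t. run p (upd t y 0 k)) ks s x = s x" for ks
    by (rule fold_frame) (use PFor in \<open>auto simp: upd_def\<close>)
  then show ?case using PFor.prems by (auto simp: upd_def)
qed (auto simp: upd_def)

text \<open>Hoare rule for counted loops. The step may assume that whatever the loop does not write
  still has its value from before the loop, so invariants need no frame conditions.\<close>

lemma run_For_invariant:
  assumes "I 0 s"
    and step: "\<And>k t. k < aval e s \<Longrightarrow> I k t \<Longrightarrow> (\<And>y. y \<notin> writes (PFor x e p) \<Longrightarrow> t y = s y) \<Longrightarrow>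
                I (Suc k) (run p (upd t x 0 k))"
    and final: "\<And>t. I (aval e s) t \<Longrightarrow> Q (upd t x 0 (aval e s))"
  shows "Q (run (PFor x e p) s)"
proof -
  let ?f = "\<lambda>k t. run p (upd t x 0 k)"
  have frame: "fold ?f ks s y = s y" if "y \<notin> writes (PFor x e p)" for y ks
    by (rule fold_frame) (use that in \<open>auto simp: upd_def run_frame\<close>)
  have "k \<le> aval e s \<Longrightarrow> I k (fold ?f [0..<k] s)" for k
  proof (induction k)
    case 0
    then show ?case using assms(1) by simp
  next
    case (Suc k)
    then have "I (Suc k) (run p (upd (fold ?f [0..<k] s) x 0 k))"
      by (intro step frame) auto
    then show ?case by simp
  qed
  then show ?thesis using final by simp
qed

text \<open>Loop bounds may only depend on the two dimensions, which no program overwrites.\<close>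

fun static :: "aexp \<Rightarrow> bool" where
  "static (Const c) \<longleftrightarrow> True"
| "static (Read x a) \<longleftrightarrow> (x = ''N'' \<or> x = ''n'') \<and> a = Const 0"
| "static (Add a b) \<longleftrightarrow> static a \<and> static b"
| "static (Sub a b) \<longleftrightarrow> static a \<and> static b"
| "static (Mul a b) \<longleftrightarrow> static a \<and> static b"

fun well_formed :: "prog \<Rightarrow> bool" where
  "well_formed PSkip \<longleftrightarrow> True"
| "well_formed (PWrite x a b) \<longleftrightarrow> x \<noteq> ''N'' \<and> x \<noteq> ''n''"
| "well_formed (PSeq p q) \<longleftrightarrow> well_formed p \<and> well_formed q"
| "well_formed (PCond b p q) \<longleftrightarrow> well_formed p \<and> well_formed q"
| "well_formed (PFor x e p) \<longleftrightarrow>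
     x \<noteq> ''N'' \<and> x \<noteq> ''n'' \<and> static e \<and> x \<notin> writes p \<and> well_formed p"

text \<open>A static expression reads only the two dimensions, and both are replaced by one variable
  standing for a common upper bound. Truncated subtraction is bounded by its minuend.\<close>

fun bound_poly :: "aexp \<Rightarrow> nat poly" where
  "bound_poly (Const c) = [:c:]"
| "bound_poly (Read x a) = [:0, 1:]"
| "bound_poly (Add a b) = bound_poly a + bound_poly b"
| "bound_poly (Sub a b) = bound_poly a"
| "bound_poly (Mul a b) = bound_poly a * bound_poly b"

text \<open>Origin of the loop constants: initializing the counter costs 3, every test
  \<open>3 + aops e\<close>, every increment 6. The failing last test together with the
  initialization gives \<open>6 + aops e\<close>, each iteration \<open>9 + aops e\<close> besides
  its body.\<close>

fun ops_poly :: "prog \<Rightarrow> nat poly" where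
  "ops_poly PSkip = [:1:]"
| "ops_poly (PWrite x a b) = [:1 + aops a + aops b:]"
| "ops_poly (PSeq p q) = ops_poly p + ops_poly q"
| "ops_poly (PCond b p q) = [:bops b:] + ops_poly p + ops_poly q"
| "ops_poly (PFor x e p) =
     [:6 + aops e:] + bound_poly e * ([:9 + aops e:] + ops_poly p)"

lemma well_formed_writes: "well_formed p \<Longrightarrow> ''N'' \<notin> writes p \<and> ''n'' \<notin> writes p"
  by (induction p) auto

lemma aval_static_cong:
  "static e \<Longrightarrow> t ''N'' = s ''N'' \<Longrightarrow> t ''n'' = s ''n'' \<Longrightarrow> aval e t = aval e s"
  by (induction e) auto

lemma aval_static_le:
  "static e \<Longrightarrow> s ''N'' 0 \<le> v \<Longrightarrow> s ''n'' 0 \<le> v \<Longrightarrow> aval e s \<le> poly (bound_poly e) v"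
  by (induction e) (auto intro: add_mono mult_mono)

lemma exec_compile:
  assumes "well_formed p" "s ''N'' 0 \<le> v" "s ''n'' 0 \<le> v"
  shows "\<exists>u l. exec (compile p) s u l (run p s) \<and> u \<le> poly (ops_poly p) v"
  using assms
proof (induction p arbitrary: s)
  case PSkip
  show ?case using exec.Skip[of s] by (intro exI[of _ 1]) auto
next
  case (PWrite x a b)
  have "exec (Write x a b) s (1 + aops a + aops b) (1 + acost a s + acost b s)
          (upd s x (aval a s) (aval b s))"
    unfolding upd_def by (rule exec.Write)
  then show ?case by fastforce
next
  case (PSeq p q)
  obtain u l where 1: "exec (compile p) s u l (run p s)" "u \<le> poly (ops_poly p) v"
    using PSeq.IH(1)[of s] PSeq.prems by auto
  have "run p s ''N'' = s ''N''" "run p s ''n'' = s ''n''"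
    using PSeq.prems well_formed_writes by (auto intro!: run_frame)
  then obtain u' l' where
    2: "exec (compile q) (run p s) u' l' (run q (run p s))" "u' \<le> poly (ops_poly q) v"
    using PSeq.IH(2)[of "run p s"] PSeq.prems by auto
  have "exec (compile (PSeq p q)) s (u + u') (l + l') (run (PSeq p q) s)"
    using 1 2 by (auto intro: exec.Seq)
  moreover have "u + u' \<le> poly (ops_poly (PSeq p q)) v" using 1 2 by simp
  ultimately show ?case by blast
next
  case (PCond b p q)
  show ?case
  proof (cases "bval b s")
    case True
    obtain u l where 1: "exec (compile p) s u l (run p s)" "u \<le> poly (ops_poly p) v"
      using PCond.IH(1)[of s] PCond.prems by auto
    have "bops b + u \<le> poly (ops_poly (PCond b p q)) v" using 1 by simp
    moreover have "exec (compile (PCond b p q)) s (bops b + u) (bcost b s + l) (run (PCond b p q) s)"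
      using exec.CondTrue[OF True 1(1)] True by simp
    ultimately show ?thesis by blast
  next
    case False
    obtain u l where 1: "exec (compile q) s u l (run q s)" "u \<le> poly (ops_poly q) v"
      using PCond.IH(2)[of s] PCond.prems by auto
    have "bops b + u \<le> poly (ops_poly (PCond b p q)) v" using 1 by simp
    moreover have "exec (compile (PCond b p q)) s (bops b + u) (bcost b s + l) (run (PCond b p q) s)"
      using exec.CondFalse[OF False 1(1)] False by simp
    ultimately show ?thesis by blast
  qed
next
  case (PFor x e p)
  let ?M = "aval e s"
  let ?f = "\<lambda>k t. run p (upd t x 0 k)"
  let ?w = "While (Less (scalar x) e)
            (Seq (compile p) (Write x (Const 0) (Add (scalar x) (Const 1))))"
  let ?U = "poly (ops_poly p) v"
  have wf: "x \<noteq> ''N''" "x \<noteq> ''n''" "static e" "x \<notin> writes p" "well_formed p"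
    using PFor.prems by auto
  \<comment> \<open>The induction starts at the exit \<open>k = ?M\<close> and goes down, so each
    step peels off the first of the remaining iterations, as the while rule does.\<close>
  have loop: "\<exists>u l. exec ?w (upd t x 0 k) u l (upd (fold ?f [k..<?M] t) x 0 ?M) \<and>
      u \<le> 3 + aops e + (?M - k) * (9 + aops e + ?U)"
    if "k \<le> ?M" "t ''N'' = s ''N''" "t ''n'' = s ''n''" for k t
    using that
  proof (induction k arbitrary: t rule: inc_induct)
    case base
    have "aval e (upd t x 0 ?M) = ?M"
      using wf base by (intro aval_static_cong) (auto simp: upd_def)
    then have "\<not> bval (Less (scalar x) e) (upd t x 0 ?M)"
      by (simp add: upd_apply)
    from exec.WhileFalse[OF this, of "Seq (compile p) (Write x (Const 0) (Add (scalar x) (Const 1)))"]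
    have "exec ?w (upd t x 0 ?M) (3 + aops e) (bcost (Less (scalar x) e) (upd t x 0 ?M)) (upd t x 0 ?M)"
      by (simp add: numeral_3_eq_3)
    then show ?case by auto
  next
    case (step k)
    let ?t = "upd t x 0 k"
    let ?t' = "run p ?t"
    have N: "?t ''N'' = s ''N''" "?t ''n'' = s ''n''"
      using wf step by (auto simp: upd_def)
    have N': "?t' ''N'' = s ''N''" "?t' ''n'' = s ''n''"
      using N wf well_formed_writes by (auto simp: run_frame)
    have "aval e ?t = ?M" using N wf by (intro aval_static_cong) auto
    with step.hyps have b: "bval (Less (scalar x) e) ?t" by (simp add: upd_apply)
    obtain u l where 1: "exec (compile p) ?t u l ?t'" "u \<le> ?U"
      using PFor.IH[of ?t] N wf PFor.prems by auto
    have x: "?t' x 0 = k" using wf by (simp add: run_frame upd_apply)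
    have "exec (Write x (Const 0) (Add (scalar x) (Const 1))) ?t'
       (1 + aops (Const 0) + aops (Add (scalar x) (Const 1)))
       (1 + acost (Const 0) ?t' + acost (Add (scalar x) (Const 1)) ?t') (upd ?t' x 0 (Suc k))"
      using exec.Write[of x "Const 0" "Add (scalar x) (Const 1)" ?t'] x by (simp add: upd_def)
    from exec.Seq[OF 1(1) this]
    obtain l' where 2: "exec (Seq (compile p) (Write x (Const 0) (Add (scalar x) (Const 1)))) ?t
       (u + 6) l' (upd ?t' x 0 (Suc k))"
      by (auto simp: numeral_eq_Suc)
    obtain u'' l'' where 3: "exec ?w (upd ?t' x 0 (Suc k)) u'' l'' (upd (fold ?f [Suc k..<?M] ?t') x 0 ?M)"
      "u'' \<le> 3 + aops e + (?M - Suc k) * (9 + aops e + ?U)"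
      using step.IH[of ?t'] N' by auto
    have 4: "fold ?f [k..<?M] t = fold ?f [Suc k..<?M] ?t'"
      using step.hyps by (simp add: upt_conv_Cons)
    have "bops (Less (scalar x) e) + (u + 6) + u'' \<le>
        3 + aops e + (1 + (?M - Suc k)) * (9 + aops e + ?U)"
      using 1(2) 3(2) by (simp add: algebra_simps)
    moreover have "1 + (?M - Suc k) = ?M - k" using step.hyps by simp
    ultimately have "bops (Less (scalar x) e) + (u + 6) + u'' \<le>
        3 + aops e + (?M - k) * (9 + aops e + ?U)" by (simp only:)
    then show ?case
      using exec.WhileTrue[OF b 2 3(1)] unfolding 4 by blast
  qed
  obtain u l where 1: "exec ?w (upd s x 0 0) u l (run (PFor x e p) s)"
    "u \<le> 3 + aops e + ?M * (9 + aops e + ?U)"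
    using loop[of 0 s] by auto
  have "?M * (9 + aops e + ?U) \<le> poly (bound_poly e) v * (9 + aops e + ?U)"
    using PFor.prems wf by (intro mult_right_mono aval_static_le) auto
  with 1(2) have u: "3 + u \<le> poly (ops_poly (PFor x e p)) v" by (simp add: algebra_simps)
  have "exec (Write x (Const 0) (Const 0)) s (1 + aops (Const 0) + aops (Const 0))
       (1 + acost (Const 0) s + acost (Const 0) s) (upd s x 0 0)"
    using exec.Write[of x "Const 0" "Const 0" s] by (simp add: upd_def)
  from exec.Seq[OF this 1(1)]
  have "exec (compile (PFor x e p)) s (3 + u) (1 + acost (Const 0) s + acost (Const 0) s + l)
      (run (PFor x e p) s)"
    by (simp add: numeral_3_eq_3 del: run.simps)
  with u show ?case by blast
qed

section \<open>Logarithmic cost from the number of operations\<close>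

text \<open>
  The arrays outside \<open>H\<close> are only written with values obtained without multiplication, so their bit
  lengths grow by a constant per operation.  An array in \<open>H\<close> may also be written with the product of
  one entry of \<open>H\<close> and entries outside \<open>H\<close>, so its bit lengths still grow only polynomially in the
  number of operations.
\<close>

fun small :: "aexp \<Rightarrow> bool" where
  "small (Const c) \<longleftrightarrow> c \<le> 1"
| "small (Read x a) \<longleftrightarrow> small a"
| "small (Add a b) \<longleftrightarrow> small a \<and> small b"
| "small (Sub a b) \<longleftrightarrow> small a \<and> small b"
| "small (Mul a b) \<longleftrightarrow> small a \<and> small b"

fun bsmall :: "bexp \<Rightarrow> bool" where
  "bsmall (Less a b) \<longleftrightarrow> small a \<and> small b"
| "bsmall (Neg b) \<longleftrightarrow> bsmall b"
| "bsmall (Conj b c) \<longleftrightarrow> bsmall b \<and> bsmall c"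

text \<open>Addresses of reads are unrestricted, since only the value read is stored, and so are
  subtrahends, since truncated subtraction never exceeds the minuend.\<close>

fun light :: "string set \<Rightarrow> aexp \<Rightarrow> bool" where
  "light H (Const c) \<longleftrightarrow> True"
| "light H (Read x a) \<longleftrightarrow> x \<notin> H"
| "light H (Add a b) \<longleftrightarrow> light H a \<and> light H b"
| "light H (Sub a b) \<longleftrightarrow> light H a"
| "light H (Mul a b) \<longleftrightarrow> False"

fun heavy :: "string set \<Rightarrow> aexp \<Rightarrow> bool" where
  "heavy H (Const c) \<longleftrightarrow> True"
| "heavy H (Read x a) \<longleftrightarrow> True"
| "heavy H (Add a b) \<longleftrightarrow> heavy H a \<and> heavy H b"
| "heavy H (Sub a b) \<longleftrightarrow> heavy H a"
| "heavy H (Mul a b) \<longleftrightarrow> heavy H a \<and> light H b"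

fun tame :: "string set \<Rightarrow> com \<Rightarrow> bool" where
  "tame H Skip \<longleftrightarrow> True"
| "tame H (Write x a b) \<longleftrightarrow> small a \<and> small b \<and> (if x \<in> H then heavy H b else light H b)"
| "tame H (Seq c d) \<longleftrightarrow> tame H c \<and> tame H d"
| "tame H (Cond b c d) \<longleftrightarrow> bsmall b \<and> tame H c \<and> tame H d"
| "tame H (While b c) \<longleftrightarrow> bsmall b \<and> tame H c"

definition bit_bounded :: "string set \<Rightarrow> nat \<Rightarrow> nat \<Rightarrow> state \<Rightarrow> bool" where
  "bit_bounded H A B s \<longleftrightarrow>
     1 \<le> A \<and> A \<le> B \<and> (\<forall>x a. s x a < 2 ^ B) \<and> (\<forall>x a. x \<notin> H \<longrightarrow> s x a < 2 ^ A)"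

section \<open>Bit lengths of the values of expressions\<close>

lemma less_power_mono: "(x::nat) < 2 ^ a \<Longrightarrow> a \<le> b \<Longrightarrow> x < 2 ^ b"
  by (meson less_le_trans one_le_numeral power_increasing)

lemma bit_bounded_mono:
  "bit_bounded H A B s \<Longrightarrow> A \<le> A' \<Longrightarrow> B \<le> B' \<Longrightarrow> A' \<le> B' \<Longrightarrow> bit_bounded H A' B' s"
  unfolding bit_bounded_def by (meson less_power_mono order_trans)

text \<open>The target shape after \<open>u\<close> operations: each adds at most one bit to a value
  outside \<open>H\<close>, and at most the final light length \<open>A + u\<close> to a value in
  \<open>H\<close>.\<close>

lemma bit_bounded_grow:
  assumes "bit_bounded H A' B' s" "1 \<le> A" "A \<le> B" "A' \<le> A + u" "B' \<le> B + u * (A + u)"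
  shows "bit_bounded H (A + u) (B + u * (A + u)) s"
proof (rule bit_bounded_mono[OF assms(1,4,5)])
  have "u * 1 \<le> u * (A + u)" using assms(2) by (intro mult_left_mono) auto
  then show "A + u \<le> B + u * (A + u)" using assms(3) by linarith
qed

lemma bit_boundedD: "bit_bounded H A B s \<Longrightarrow> 1 \<le> A \<and> A \<le> B"
  by (simp add: bit_bounded_def)

lemma add_less_power:
  assumes "(x::nat) < 2 ^ a" "y < 2 ^ b" "a < c" "b < c"
  shows "x + y < 2 ^ c"
proof -
  obtain c' where c: "c = Suc c'" "a \<le> c'" "b \<le> c'" using assms by (cases c) auto
  then have "x < 2 ^ c'" "y < 2 ^ c'" using assms less_power_mono by blast+
  then show ?thesis using c by simp
qed

lemma mult_less_power:
  assumes "(x::nat) < 2 ^ a" "y < 2 ^ b" "a + b \<le> c"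
  shows "x * y < 2 ^ c"
proof -
  have "x * y < 2 ^ a * 2 ^ b" using assms by (intro mult_strict_mono) auto
  then have "x * y < 2 ^ (a + b)" by (simp add: power_add)
  then show ?thesis using assms less_power_mono by blast
qed

lemma floorlog_2_le_iff: "floorlog 2 x \<le> k \<longleftrightarrow> x < 2 ^ k"
proof
  assume "x < 2 ^ k" then show "floorlog 2 x \<le> k"
    by (intro floorlog_leI) auto
next
  assume *: "floorlog 2 x \<le> k"
  have "x < 2 ^ floorlog 2 x"
  proof (cases "x = 0")
    case False
    then show ?thesis using floorlog_bounds[of x 2] by auto
  qed auto
  then show "x < 2 ^ k" using * less_power_mono by blast
qed

lemma aops_pos: "1 \<le> aops e"
  by (induction e) auto

text \<open>A coarse bound for arbitrary expressions, in which products simply add bit lengths. It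
  serves to charge the cost of addresses and comparisons, while the growth of stored values is
  controlled by the two sharper bounds that follow.\<close>

lemma aval_less:
  assumes "bit_bounded H A B s" "small e"
  shows "aval e s < 2 ^ (B * aops e)"
  using assms(2)
proof (induction e)
  case (Const c)
  have "1 \<le> B" using assms by (auto simp: bit_bounded_def)
  then have "c < 2 ^ B" using Const less_power_mono[of c 1 B] by auto
  then show ?case by simp
next
  case (Read x a)
  have "s x (aval a s) < 2 ^ B" using assms by (auto simp: bit_bounded_def)
  then show ?case by (auto intro: less_power_mono)
next
  case (Add a b)
  have "1 \<le> B" using assms by (auto simp: bit_bounded_def)
  with Add aops_pos[of a] aops_pos[of b] show ?case
    by (auto intro!: add_less_power simp: algebra_simps)
next
  case (Sub a b)
  then have "aval a s < 2 ^ (B * aops a)" by simp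
  then have "aval a s < 2 ^ (B * aops (Sub a b))"
    by (rule less_power_mono) (simp add: algebra_simps)
  then show ?case by simp
next
  case (Mul a b)
  then show ?case by (auto intro!: mult_less_power simp: algebra_simps)
qed

lemma aval_light_less:
  assumes "bit_bounded H A B s" "small e" "light H e"
  shows "aval e s < 2 ^ (A + aops e)"
  using assms(2,3)
proof (induction e)
  case (Const c)
  then have "c < 2 ^ (A + 1)" using less_power_mono[of c 1 "A + 1"] by simp
  then show ?case by simp
next
  case (Read x a)
  then have "s x (aval a s) < 2 ^ A" using assms by (auto simp: bit_bounded_def)
  then have "s x (aval a s) < 2 ^ (A + aops (Read x a))" by (rule less_power_mono) simp
  then show ?case by simp
next
  case (Add a b)
  then have "aval a s + aval b s < 2 ^ (A + aops (Add a b))"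
    by (intro add_less_power[where a = "A + aops a" and b = "A + aops b"]) auto
  then show ?case by simp
next
  case (Sub a b)
  then have "aval a s < 2 ^ (A + aops a)" by simp
  then have "aval a s < 2 ^ (A + aops (Sub a b))" by (rule less_power_mono) simp
  then show ?case by simp
qed auto

text \<open>In an admissible product the right factor is light, so the product adds only
  \<open>A + aops b\<close> bits to the bound of the left factor instead of doubling it.\<close>

lemma aval_heavy_less:
  assumes "bit_bounded H A B s" "small e" "heavy H e"
  shows "aval e s < 2 ^ (B + aops e * (A + aops e))"
  using assms(2,3)
proof (induction e)
  case (Const c)
  then have "c < 2 ^ (B + (A + 1))" using less_power_mono[of c 1 "B + (A + 1)"] by simp
  then show ?case by simp
next
  case (Read x a)
  have "s x (aval a s) < 2 ^ B" using assms by (auto simp: bit_bounded_def)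
  then have "s x (aval a s) < 2 ^ (B + aops (Read x a) * (A + aops (Read x a)))"
    by (rule less_power_mono) simp
  then show ?case by simp
next
  case (Add a b)
  then have "aval a s + aval b s < 2 ^ (B + aops (Add a b) * (A + aops (Add a b)))"
    by (intro add_less_power[where a = "B + aops a * (A + aops a)" and b = "B + aops b * (A + aops b)"])
       (auto simp: algebra_simps)
  then show ?case by simp
next
  case (Sub a b)
  then have "aval a s < 2 ^ (B + aops a * (A + aops a))" by simp
  then have "aval a s < 2 ^ (B + aops (Sub a b) * (A + aops (Sub a b)))"
    by (rule less_power_mono) (simp add: algebra_simps)
  then show ?case by simp
next
  case (Mul a b)
  have "aval b s < 2 ^ (A + aops b)" using aval_light_less Mul.prems assms(1) by simp
  with Mul have "aval a s * aval b s < 2 ^ (B + aops (Mul a b) * (A + aops (Mul a b)))"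
    by (intro mult_less_power[where a = "B + aops a * (A + aops a)" and b = "A + aops b"])
       (auto simp: algebra_simps)
  then show ?case by simp
qed

lemma acost_le:
  assumes "bit_bounded H A B s" "small e"
  shows "acost e s \<le> aops e * (1 + B * aops e)"
  using assms(2)
proof (induction e)
  case (Const c)
  have "floorlog 2 (aval (Const c) s) \<le> B * aops (Const c)"
    using aval_less[OF assms(1) Const] by (simp only: floorlog_2_le_iff)
  then show ?case by simp
next
  case (Read x a)
  have "floorlog 2 (aval (Read x a) s) \<le> B * aops (Read x a)"
    using aval_less[OF assms(1) Read.prems] by (simp only: floorlog_2_le_iff)
  with Read show ?case by (simp add: algebra_simps)
next
  case (Add a b)
  have "floorlog 2 (aval (Add a b) s) \<le> B * aops (Add a b)"
    using aval_less[OF assms(1) Add.prems] by (simp only: floorlog_2_le_iff)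
  with Add show ?case by (simp add: algebra_simps)
next
  case (Sub a b)
  have "floorlog 2 (aval (Sub a b) s) \<le> B * aops (Sub a b)"
    using aval_less[OF assms(1) Sub.prems] by (simp only: floorlog_2_le_iff)
  with Sub show ?case by (simp add: algebra_simps)
next
  case (Mul a b)
  have "floorlog 2 (aval (Mul a b) s) \<le> B * aops (Mul a b)"
    using aval_less[OF assms(1) Mul.prems] by (simp only: floorlog_2_le_iff)
  with Mul show ?case by (simp add: algebra_simps)
qed

lemma bcost_le:
  assumes "bit_bounded H A B s"
  shows "bsmall b \<Longrightarrow> bcost b s \<le> bops b * (1 + B * bops b)"
proof (induction b)
  case (Less a b)
  then show ?case using acost_le[OF assms, of a] acost_le[OF assms, of b]
    by (simp add: algebra_simps)
qed (simp_all add: algebra_simps)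

text \<open>Each of the \<open>u\<close> operations is charged 1 plus a bit length:
  \<open>B + u * (A + u)\<close> bounds the entries of the memory throughout the run, and one
  expression, having at most \<open>u\<close> nodes, multiplies this by at most
  \<open>u\<close>.\<close>

definition cost_bound :: "nat \<Rightarrow> nat \<Rightarrow> nat \<Rightarrow> nat" where
  "cost_bound A B u = u * (1 + (B + u * (A + u)) * u)"

text \<open>Composition of runs: the second part starts from the memory bounds that the first part
  has enlarged.\<close>

lemma cost_bound_add:
  "cost_bound A B u + cost_bound (A + u) (B + u * (A + u)) v \<le> cost_bound A B (u + v)"
  by (simp add: cost_bound_def algebra_simps)

lemma cost_bound_mono: "u \<le> v \<Longrightarrow> cost_bound A B u \<le> cost_bound A B v"
  unfolding cost_bound_def by (intro mult_mono add_mono) auto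

lemma cost_bound_ge: "u * (1 + B * u) \<le> cost_bound A B u"
  by (simp add: cost_bound_def algebra_simps)

lemma cost_bound_superadd: "cost_bound A B u + cost_bound A B v \<le> cost_bound A B (u + v)"
  by (simp add: cost_bound_def algebra_simps)

lemma bcost_le_cost_bound:
  assumes "bit_bounded H A B s" "bsmall b"
  shows "bcost b s \<le> cost_bound A B (bops b)"
  using bcost_le[OF assms] cost_bound_ge[of "bops b" B A] by linarith

text \<open>The induction follows the execution, not the program. Iterations of a while loop then
  compose like a sequence, and since \<open>u\<close> already counts them no separate bound on their
  number enters.\<close>

lemma exec_cost:
  assumes "exec c s u l s'" "tame H c" "bit_bounded H A B s"
  shows "bit_bounded H (A + u) (B + u * (A + u)) s' \<and> l \<le> cost_bound A B u"
  using assms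
proof (induction arbitrary: A B rule: exec.induct)
  case (Skip s)
  then have AB: "1 \<le> A" "A \<le> B" by (auto dest: bit_boundedD)
  show ?case using bit_bounded_grow[OF Skip(2) AB, of 1] by (simp add: cost_bound_def)
next
  case (Write x a b s)
  let ?u = "1 + aops a + aops b"
  have AB: "1 \<le> A" "A \<le> B" using Write by (auto dest: bit_boundedD)
  have b: "bit_bounded H (A + ?u) (B + ?u * (A + ?u)) s"
    by (rule bit_bounded_grow[OF Write(2) AB]) auto
  have h: "aval b s < 2 ^ (B + ?u * (A + ?u)) \<and> (x \<notin> H \<longrightarrow> aval b s < 2 ^ (A + ?u))"
  proof (cases "x \<in> H")
    case True
    then have "aval b s < 2 ^ (B + aops b * (A + aops b))"
      using Write by (auto intro: aval_heavy_less)
    then have "aval b s < 2 ^ (B + ?u * (A + ?u))"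
      by (rule less_power_mono) (intro mult_mono add_mono; simp)
    then show ?thesis using True by simp
  next
    case False
    then have "aval b s < 2 ^ (A + aops b)"
      using Write by (auto intro: aval_light_less)
    then have "aval b s < 2 ^ (A + ?u)" by (rule less_power_mono) simp
    moreover from this have "aval b s < 2 ^ (B + ?u * (A + ?u))"
      by (rule less_power_mono) (use bit_boundedD[OF b] in simp)
    ultimately show ?thesis by simp
  qed
  have "1 + acost a s + acost b s \<le> ?u * (1 + B * ?u)"
    using acost_le[OF Write(2), of a] acost_le[OF Write(2), of b] Write(1)
    by (simp add: algebra_simps)
  then have "1 + acost a s + acost b s \<le> cost_bound A B ?u"
    using cost_bound_ge[of ?u B A] by linarith
  moreover have "bit_bounded H (A + ?u) (B + ?u * (A + ?u)) (s(x := (s x)(aval a s := aval b s)))"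
    using b h unfolding bit_bounded_def by (simp del: power_Suc)
  ultimately show ?case by blast
next
  case (Seq c s u l s' d v r s'')
  then have AB: "1 \<le> A" "A \<le> B" by (auto dest: bit_boundedD)
  have 1: "bit_bounded H (A + u) (B + u * (A + u)) s'" "l \<le> cost_bound A B u"
    using Seq by auto
  then have 2: "bit_bounded H (A + u + v) (B + u * (A + u) + v * (A + u + v)) s''"
    "r \<le> cost_bound (A + u) (B + u * (A + u)) v" using Seq by auto
  have "bit_bounded H (A + (u + v)) (B + (u + v) * (A + (u + v))) s''"
    by (rule bit_bounded_grow[OF 2(1) AB]) (simp_all add: algebra_simps)
  with 1 2 cost_bound_add[of A B u v] show ?case by linarith
next
  case (CondTrue b s c u l s' d)
  then have AB: "1 \<le> A" "A \<le> B" by (auto dest: bit_boundedD)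
  have 1: "bit_bounded H (A + u) (B + u * (A + u)) s'" "l \<le> cost_bound A B u"
    using CondTrue by auto
  have "bcost b s \<le> cost_bound A B (bops b)"
    using bcost_le_cost_bound CondTrue.prems by simp
  moreover have "bit_bounded H (A + (bops b + u)) (B + (bops b + u) * (A + (bops b + u))) s'"
    by (rule bit_bounded_grow[OF 1(1) AB]) (simp_all add: algebra_simps)
  ultimately show ?case using 1 cost_bound_superadd[of A B "bops b" u] by linarith
next
  case (CondFalse b s d u l s' c)
  then have AB: "1 \<le> A" "A \<le> B" by (auto dest: bit_boundedD)
  have 1: "bit_bounded H (A + u) (B + u * (A + u)) s'" "l \<le> cost_bound A B u"
    using CondFalse by auto
  have "bcost b s \<le> cost_bound A B (bops b)"
    using bcost_le_cost_bound CondFalse.prems by simp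
  moreover have "bit_bounded H (A + (bops b + u)) (B + (bops b + u) * (A + (bops b + u))) s'"
    by (rule bit_bounded_grow[OF 1(1) AB]) (simp_all add: algebra_simps)
  ultimately show ?case using 1 cost_bound_superadd[of A B "bops b" u] by linarith
next
  case (WhileFalse b s c)
  then have AB: "1 \<le> A" "A \<le> B" by (auto dest: bit_boundedD)
  have "bit_bounded H (A + bops b) (B + bops b * (A + bops b)) s"
    by (rule bit_bounded_grow[OF WhileFalse.prems(2) AB]) auto
  then show ?case using bcost_le_cost_bound WhileFalse.prems by simp
next
  case (WhileTrue b s c u l s' v r s'')
  then have AB: "1 \<le> A" "A \<le> B" by (auto dest: bit_boundedD)
  have 1: "bit_bounded H (A + u) (B + u * (A + u)) s'" "l \<le> cost_bound A B u"
    using WhileTrue by auto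
  then have 2: "bit_bounded H (A + u + v) (B + u * (A + u) + v * (A + u + v)) s''"
    "r \<le> cost_bound (A + u) (B + u * (A + u)) v" using WhileTrue by auto
  have 3: "bcost b s \<le> cost_bound A B (bops b)"
    using bcost_le_cost_bound WhileTrue.prems by simp
  have "bit_bounded H (A + (bops b + (u + v))) (B + (bops b + (u + v)) * (A + (bops b + (u + v)))) s''"
    by (rule bit_bounded_grow[OF 2(1) AB]) (simp_all add: algebra_simps)
  with 1 2 3 cost_bound_add[of A B u v] cost_bound_superadd[of A B "bops b" "u + v"]
  show ?case unfolding add.assoc by linarith
qed

lemma poly_nat_mono: "(x::nat) \<le> y \<Longrightarrow> poly p x \<le> poly p y"
  by (induction p) (auto intro: add_mono mult_mono)

text \<open>The dimensions and the number of cores enter the input size by value and are covered by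
  \<open>v < 2 ^ v\<close>; every other entry contributes its bit length as one of the
  summands.\<close>

lemma input_state_bit_bounded:
  assumes "wf_instance I"
  shows "bit_bounded H (input_size I) (input_size I) (input_state I)"
proof -
  let ?S = "input_size I" and ?N = "num_ports I" and ?n = "num_coflows I"
  have less: "x < 2 ^ ?S" if "x \<le> ?S" for x
    using that less_exp[of ?S] by linarith
  have dims: "?N \<le> ?S" "num_cores I \<le> ?S" "?n \<le> ?S" by (auto simp: input_size_def)
  have num: "floorlog 2 (nat (fst (quotient_of (weight I k)))) \<le> ?S"
    and den: "floorlog 2 (nat (snd (quotient_of (weight I k)))) \<le> ?S" if "k < ?n" for k
  proof -
    have "floorlog 2 (nat (fst (quotient_of (weight I k)))) +
          floorlog 2 (nat (snd (quotient_of (weight I k)))) \<le>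
       (\<Sum>k<?n. floorlog 2 (nat (fst (quotient_of (weight I k)))) +
                         floorlog 2 (nat (snd (quotient_of (weight I k)))))"
      using that by (intro member_le_sum[where f = "\<lambda>k. floorlog 2 (nat (fst (quotient_of (weight I k)))) + floorlog 2 (nat (snd (quotient_of (weight I k))))"]) auto
    then show "floorlog 2 (nat (fst (quotient_of (weight I k)))) \<le> ?S"
      "floorlog 2 (nat (snd (quotient_of (weight I k)))) \<le> ?S"
      unfolding input_size_def by linarith+
  qed
  have dem: "floorlog 2 (demand I i j k) \<le> ?S" if "i < ?N" "j < ?N" "k < ?n" for i j k
  proof -
    have "floorlog 2 (demand I i j k) \<le> (\<Sum>k<?n. floorlog 2 (demand I i j k))"
      using that by (intro member_le_sum[where f = "\<lambda>k. floorlog 2 (demand I i j k)"]) auto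
    also have "\<dots> \<le> (\<Sum>j<?N. \<Sum>k<?n. floorlog 2 (demand I i j k))"
      using that by (intro member_le_sum[where f = "\<lambda>j. \<Sum>k<?n. floorlog 2 (demand I i j k)"]) auto
    also have "\<dots> \<le> (\<Sum>i<?N. \<Sum>j<?N. \<Sum>k<?n. floorlog 2 (demand I i j k))"
      using that by (intro member_le_sum[where f = "\<lambda>i. \<Sum>j<?N. \<Sum>k<?n. floorlog 2 (demand I i j k)"]) auto
    finally show ?thesis unfolding input_size_def by linarith
  qed
  have cell: "a div ?N mod ?N < ?N" "a mod ?N < ?N" "a div (?N * ?N) < ?n"
    if "a < ?n * ?N * ?N" for a
    using that assms by (auto simp: wf_instance_def less_mult_imp_div_less algebra_simps)
  have "input_state I x a < 2 ^ ?S" for x a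
    using less dims num[unfolded floorlog_2_le_iff] den[unfolded floorlog_2_le_iff]
      dem[unfolded floorlog_2_le_iff] cell
    by (auto simp: input_state_def Let_def)
  moreover have "1 \<le> ?S" using assms dims by (auto simp: wf_instance_def)
  ultimately show ?thesis by (auto simp: bit_bounded_def)
qed

lemma combinatorial_compile:
  assumes "well_formed p"
  shows "combinatorial (compile p)"
  unfolding combinatorial_def
proof (intro exI[of _ "ops_poly p"] allI impI)
  fix I assume "wf_instance I"
  let ?v = "num_ports I + num_cores I + num_coflows I"
  have "input_state I ''N'' 0 \<le> ?v" "input_state I ''n'' 0 \<le> ?v"
    by (auto simp: input_state_def Let_def)
  from exec_compile[where s = "input_state I", OF assms this]
  show "\<exists>u l s. exec (compile p) (input_state I) u l s \<and> u \<le> poly (ops_poly p) ?v"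
    by blast
qed

lemma polynomial_time_compile:
  assumes "well_formed p" "tame H (compile p)"
  shows "polynomial_time (compile p)"
proof -
  obtain q where q: "\<And>I. wf_instance I \<Longrightarrow> \<exists>u l s. exec (compile p) (input_state I) u l s \<and>
      u \<le> poly q (num_ports I + num_cores I + num_coflows I)"
    using combinatorial_compile[OF assms(1)] unfolding combinatorial_def by blast
  \<comment> \<open>This is \<open>cost_bound\<close> with \<open>A\<close> and \<open>B\<close>
    replaced by the variable, standing for the input size, and \<open>u\<close> by
    \<open>q\<close>.\<close>
  let ?r = "q * (1 + ([:0, 1:] + q * ([:0, 1:] + q)) * q)"
  show ?thesis
    unfolding polynomial_time_def
  proof (intro exI[of _ ?r] allI impI)
    fix I assume I: "wf_instance I"
    let ?S = "input_size I"
    obtain u l s where e: "exec (compile p) (input_state I) u l s"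
      "u \<le> poly q (num_ports I + num_cores I + num_coflows I)" using q[OF I] by blast
    have "poly q (num_ports I + num_cores I + num_coflows I) \<le> poly q ?S"
      by (rule poly_nat_mono) (simp add: input_size_def)
    with e have u: "u \<le> poly q ?S" by simp
    have "l \<le> cost_bound ?S ?S u"
      using exec_cost[OF e(1) assms(2) input_state_bit_bounded[OF I]] by simp
    also have "\<dots> \<le> cost_bound ?S ?S (poly q ?S)" by (rule cost_bound_mono[OF u])
    also have "\<dots> = poly ?r ?S" by (simp add: cost_bound_def)
    finally show "\<exists>u l s. exec (compile p) (input_state I) u l s \<and> l \<le> poly ?r ?S"
      using e(1) by blast
  qed
qed

section \<open>Port loads and the lower bound\<close>

text \<open>Ports \<open>0..<N\<close> are the input ports, ports \<open>N..<2N\<close> the output ports.\<close>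

definition load :: "nat \<Rightarrow> (nat \<Rightarrow> nat \<Rightarrow> nat \<Rightarrow> nat) \<Rightarrow> nat \<Rightarrow> nat \<Rightarrow> nat" where
  "load N f \<mu> k = (if \<mu> < N then \<Sum>j<N. f \<mu> j k else \<Sum>i<N. f i (\<mu> - N) k)"

text \<open>Of any two coflows one finishes no later than the other, so each product
  \<open>P k * P l\<close> of the expanded square is dominated by \<open>?g k l + ?g l k\<close>,
  with ties counted twice. The two halves are equal by symmetry, whence the factor 2, and each is a
  sum of \<open>P k\<close> times the load finished by time \<open>C k\<close>.\<close>

lemma sum_pairs_le_square:
  fixes P C :: "'a \<Rightarrow> real"
  assumes "finite U" "\<And>k. k \<in> U \<Longrightarrow> 0 \<le> P k"
    and "\<And>k. k \<in> U \<Longrightarrow> (\<Sum>l | l \<in> U \<and> C l \<le> C k. P l) \<le> m * C k"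
  shows "(\<Sum>k\<in>U. P k)\<^sup>2 \<le> 2 * m * (\<Sum>k\<in>U. P k * C k)"
proof -
  let ?g = "\<lambda>k l. if C l \<le> C k then P k * P l else 0"
  have "(\<Sum>k\<in>U. P k)\<^sup>2 = (\<Sum>k\<in>U. \<Sum>l\<in>U. P k * P l)"
    by (simp add: power2_eq_square sum_product)
  also have "\<dots> \<le> (\<Sum>k\<in>U. \<Sum>l\<in>U. ?g k l + ?g l k)"
    using assms(2) by (intro sum_mono) (auto simp: mult.commute)
  also have "\<dots> = (\<Sum>k\<in>U. \<Sum>l\<in>U. ?g k l) + (\<Sum>k\<in>U. \<Sum>l\<in>U. ?g l k)"
    by (simp add: sum.distrib)
  also have "(\<Sum>k\<in>U. \<Sum>l\<in>U. ?g l k) = (\<Sum>k\<in>U. \<Sum>l\<in>U. ?g k l)"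
    by (rule sum.swap)
  also have "(\<Sum>k\<in>U. \<Sum>l\<in>U. ?g k l) = (\<Sum>k\<in>U. P k * (\<Sum>l | l \<in> U \<and> C l \<le> C k. P l))"
  proof (rule sum.cong[OF refl])
    fix k assume "k \<in> U"
    have "(\<Sum>l\<in>U. ?g k l) = (\<Sum>l | l \<in> U \<and> C l \<le> C k. P k * P l)"
      by (rule sum.mono_neutral_cong_right) (use assms(1) in auto)
    then show "(\<Sum>l\<in>U. ?g k l) = P k * (\<Sum>l | l \<in> U \<and> C l \<le> C k. P l)"
      by (simp add: sum_distrib_left)
  qed
  also have "\<dots> \<le> (\<Sum>k\<in>U. P k * (m * C k))"
    using assms(2,3) by (intro sum_mono mult_left_mono) auto
  finally show ?thesis by (simp add: sum_distrib_left algebra_simps)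
qed

section \<open>Capacity of a port over all cores\<close>

lemma sum_le_1_if_card_le_1:
  fixes f :: "'a \<Rightarrow> real"
  assumes "finite A" "\<And>x. x \<in> A \<Longrightarrow> 0 \<le> f x \<and> f x \<le> 1" "card {x \<in> A. f x > 0} \<le> 1"
  shows "sum f A \<le> 1"
proof -
  have "sum f A = sum f {x \<in> A. f x > 0}"
    by (rule sum.mono_neutral_right) (use assms in \<open>auto simp: order_less_le\<close>)
  also have "\<dots> \<le> of_nat (card {x \<in> A. f x > 0}) * 1"
    using assms by (intro sum_bounded_above) auto
  also have "\<dots> \<le> 1" using assms(3) by simp
  finally show ?thesis .
qed

lemma feasibleD:
  assumes "feasible I S"
  shows "k < num_coflows I \<Longrightarrow> core_of S k < num_cores I"
    and "i < num_ports I \<Longrightarrow> j < num_ports I \<Longrightarrow> k < num_coflows I \<Longrightarrow>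
           rate S i j k \<in> borel_measurable borel"
    and "i < num_ports I \<Longrightarrow> j < num_ports I \<Longrightarrow> k < num_coflows I \<Longrightarrow> 0 \<le> t \<Longrightarrow>
           0 \<le> rate S i j k t \<and> rate S i j k t \<le> 1"
    and "h < num_cores I \<Longrightarrow> i < num_ports I \<Longrightarrow> 0 \<le> t \<Longrightarrow>
           card {(j, k). j < num_ports I \<and> k < num_coflows I \<and> core_of S k = h \<and>
                         rate S i j k t > 0} \<le> 1"
    and "h < num_cores I \<Longrightarrow> j < num_ports I \<Longrightarrow> 0 \<le> t \<Longrightarrow>
           card {(i, k). i < num_ports I \<and> k < num_coflows I \<and> core_of S k = h \<and>
                         rate S i j k t > 0} \<le> 1"
    and "i < num_ports I \<Longrightarrow> j < num_ports I \<Longrightarrow> k < num_coflows I \<Longrightarrow> 0 \<le> T \<Longrightarrow>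
           transmitted S i j k T \<le> real (demand I i j k)"
    and "i < num_ports I \<Longrightarrow> j < num_ports I \<Longrightarrow> k < num_coflows I \<Longrightarrow>
           \<exists>T\<ge>0. transmitted S i j k T = real (demand I i j k)"
proof -
  note * = assms[unfolded feasible_def]
  show "k < num_coflows I \<Longrightarrow> core_of S k < num_cores I"
    by (rule *[THEN conjunct1, rule_format])
  show "i < num_ports I \<Longrightarrow> j < num_ports I \<Longrightarrow> k < num_coflows I \<Longrightarrow>
           rate S i j k \<in> borel_measurable borel"
    by (rule *[THEN conjunct2, THEN conjunct1, rule_format, THEN conjunct1])
  show "i < num_ports I \<Longrightarrow> j < num_ports I \<Longrightarrow> k < num_coflows I \<Longrightarrow> 0 \<le> t \<Longrightarrow>
           0 \<le> rate S i j k t \<and> rate S i j k t \<le> 1"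
    by (rule *[THEN conjunct2, THEN conjunct1, rule_format, THEN conjunct2, rule_format])
  show "h < num_cores I \<Longrightarrow> i < num_ports I \<Longrightarrow> 0 \<le> t \<Longrightarrow>
           card {(j, k). j < num_ports I \<and> k < num_coflows I \<and> core_of S k = h \<and>
                         rate S i j k t > 0} \<le> 1"
    by (rule *[THEN conjunct2, THEN conjunct2, THEN conjunct1, rule_format])
  show "h < num_cores I \<Longrightarrow> j < num_ports I \<Longrightarrow> 0 \<le> t \<Longrightarrow>
           card {(i, k). i < num_ports I \<and> k < num_coflows I \<and> core_of S k = h \<and>
                         rate S i j k t > 0} \<le> 1"
    by (rule *[THEN conjunct2, THEN conjunct2, THEN conjunct2, THEN conjunct1, rule_format])
  show "i < num_ports I \<Longrightarrow> j < num_ports I \<Longrightarrow> k < num_coflows I \<Longrightarrow> 0 \<le> T \<Longrightarrow>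
           transmitted S i j k T \<le> real (demand I i j k)"
    by (rule *[THEN conjunct2, THEN conjunct2, THEN conjunct2, THEN conjunct2, rule_format, THEN conjunct1, rule_format])
  show "i < num_ports I \<Longrightarrow> j < num_ports I \<Longrightarrow> k < num_coflows I \<Longrightarrow>
           \<exists>T\<ge>0. transmitted S i j k T = real (demand I i j k)"
    by (rule *[THEN conjunct2, THEN conjunct2, THEN conjunct2, THEN conjunct2, rule_format, THEN conjunct2])
qed

lemma set_integrable_unit_rate:
  fixes f :: "real \<Rightarrow> real"
  assumes "f \<in> borel_measurable borel" "\<And>t. 0 \<le> t \<Longrightarrow> 0 \<le> f t \<and> f t \<le> 1"
  shows "set_integrable lborel {0..T} f"
  unfolding set_integrable_def
proof (rule Bochner_Integration.integrable_bound)
  show "integrable lborel (indicat_real {0..T})"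
    by (rule integrable_real_indicator) (auto simp: emeasure_lborel_Icc_eq)
  show "AE t in lborel. norm (indicat_real {0..T} t *\<^sub>R f t) \<le> norm (indicat_real {0..T} t)"
    using assms(2) by (auto simp: indicator_def)
  show "(\<lambda>t. indicat_real {0..T} t *\<^sub>R f t) \<in> borel_measurable lborel"
    using assms(1) by simp
qed

text \<open>Group the coflows by core: each core contributes a total rate of at most 1 at this port,
  so at most \<open>m\<close> is transmitted at any moment, and integration gives the claim. The
  index \<open>a\<close> is the opposite port, which lets the lemma serve input and output ports
  alike.\<close>

lemma port_capacity:
  fixes r :: "nat \<Rightarrow> nat \<Rightarrow> real \<Rightarrow> real"
  assumes meas: "\<And>a k. a < N \<Longrightarrow> k \<in> K \<Longrightarrow> r a k \<in> borel_measurable borel"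
    and bnd: "\<And>a k t. a < N \<Longrightarrow> k \<in> K \<Longrightarrow> 0 \<le> t \<Longrightarrow> 0 \<le> r a k t \<and> r a k t \<le> 1"
    and K: "finite K" "\<And>k. k \<in> K \<Longrightarrow> c k < m"
    and one: "\<And>h t. h < m \<Longrightarrow> 0 \<le> t \<Longrightarrow> card {(a, k). a < N \<and> k \<in> K \<and> c k = h \<and> r a k t > 0} \<le> 1"
    and T: "0 \<le> T"
  shows "(\<Sum>k\<in>K. \<Sum>a<N. LINT t:{0..T}|lborel. r a k t) \<le> real m * T"
proof -
  have int: "set_integrable lborel {0..T} (r a k)" if "a < N" "k \<in> K" for a k
    using meas[OF that] bnd[OF that] by (rule set_integrable_unit_rate)
  have pointwise: "(\<Sum>k\<in>K. \<Sum>a<N. r a k t) \<le> real m" if t: "t \<in> {0..T}" for t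
  proof -
    have "(\<Sum>k\<in>K. \<Sum>a<N. r a k t) = (\<Sum>h<m. \<Sum>k | k \<in> K \<and> c k = h. \<Sum>a<N. r a k t)"
      by (rule sum.group[symmetric]) (use K in auto)
    also have "\<dots> \<le> (\<Sum>h<m. 1)"
    proof (rule sum_mono)
      fix h assume h: "h \<in> {..<m}"
      let ?A = "{..<N} \<times> {k. k \<in> K \<and> c k = h}"
      have "(\<Sum>k | k \<in> K \<and> c k = h. \<Sum>a<N. r a k t) = (\<Sum>(a, k)\<in>?A. r a k t)"
        by (subst sum.swap) (simp add: sum.cartesian_product)
      also have "\<dots> \<le> 1"
      proof (rule sum_le_1_if_card_le_1)
        show "finite ?A" using K by auto
        show "\<And>x. x \<in> ?A \<Longrightarrow> 0 \<le> (case x of (a, k) \<Rightarrow> r a k t) \<and> (case x of (a, k) \<Rightarrow> r a k t) \<le> 1"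
          using bnd t by auto
        have "{x \<in> ?A. 0 < (case x of (a, k) \<Rightarrow> r a k t)}
          = {(a, k). a < N \<and> k \<in> K \<and> c k = h \<and> r a k t > 0}" by auto
        then show "card {x \<in> ?A. 0 < (case x of (a, k) \<Rightarrow> r a k t)} \<le> 1"
          using one[of h t] h t by simp
      qed
      finally show "(\<Sum>k | k \<in> K \<and> c k = h. \<Sum>a<N. r a k t) \<le> 1" .
    qed
    finally show ?thesis by simp
  qed
  have int': "integrable lborel (\<lambda>t. indicat_real {0..T} t *\<^sub>R r a k t)" if "a < N" "k \<in> K" for a k
    using int[OF that] by (simp add: set_integrable_def)
  have "(\<Sum>k\<in>K. \<Sum>a<N. LINT t:{0..T}|lborel. r a k t)
      = (LINT t|lborel. (\<Sum>k\<in>K. \<Sum>a<N. indicat_real {0..T} t *\<^sub>R r a k t))"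
  proof -
    have "(LINT t|lborel. (\<Sum>k\<in>K. \<Sum>a<N. indicat_real {0..T} t *\<^sub>R r a k t))
        = (\<Sum>k\<in>K. LINT t|lborel. (\<Sum>a<N. indicat_real {0..T} t *\<^sub>R r a k t))"
      using int' by (intro Bochner_Integration.integral_sum Bochner_Integration.integrable_sum) auto
    also have "\<dots> = (\<Sum>k\<in>K. \<Sum>a<N. LINT t:{0..T}|lborel. r a k t)"
      unfolding set_lebesgue_integral_def
      using int' by (intro sum.cong refl Bochner_Integration.integral_sum) auto
    finally show ?thesis by simp
  qed
  also have "\<dots> \<le> (LINT t|lborel. indicat_real {0..T} t *\<^sub>R real m)"
  proof (rule integral_mono)
    show "integrable lborel (\<lambda>t. \<Sum>k\<in>K. \<Sum>a<N. indicat_real {0..T} t *\<^sub>R r a k t)"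
      using int' by (intro Bochner_Integration.integrable_sum) auto
    have "integrable lborel (indicat_real {0..T})"
      by (rule integrable_real_indicator) (auto simp: emeasure_lborel_Icc_eq)
    then show "integrable lborel (\<lambda>t. indicat_real {0..T} t *\<^sub>R real m)" by simp
    fix t
    show "(\<Sum>k\<in>K. \<Sum>a<N. indicat_real {0..T} t *\<^sub>R r a k t) \<le> indicat_real {0..T} t *\<^sub>R real m"
      using pointwise[of t] by (cases "t \<in> {0..T}") auto
  qed
  also have "\<dots> = real m * T" using T by simp
  finally show ?thesis .
qed

lemma flow_completion_le_coflow_completion:
  assumes "i < num_ports I" "j < num_ports I"
  shows "flow_completion I S i j k \<le> coflow_completion I S k"
  unfolding coflow_completion_def using assms by (intro Max_ge) auto

lemma transmitted_mono:
  assumes "feasible I S" "i < num_ports I" "j < num_ports I" "k < num_coflows I" "0 \<le> T" "T \<le> T'"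
  shows "transmitted S i j k T \<le> transmitted S i j k T'"
proof -
  have int: "set_integrable lborel {0..T} (rate S i j k)" for T
    using feasibleD(2,3)[OF assms(1-4)] by (rule set_integrable_unit_rate)
  show ?thesis
    unfolding transmitted_def set_lebesgue_integral_def
    using int[of T] int[of T'] assms(5,6) feasibleD(3)[OF assms(1-4)]
    by (intro integral_mono) (auto simp: indicator_def set_integrable_def)
qed

text \<open>\<open>flow_completion\<close> is an infimum. A time strictly beyond it has a witness
  below it, so it need not be shown that the infimum is attained; monotonicity and the cap by the
  demand then fix the amount.\<close>

lemma transmitted_after_completion:
  assumes S: "feasible I S" and ijk: "i < num_ports I" "j < num_ports I" "k < num_coflows I"
    and T: "coflow_completion I S k < T"
  shows "transmitted S i j k T = real (demand I i j k)" "0 \<le> T"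
proof -
  let ?X = "{T. T \<ge> 0 \<and> transmitted S i j k T = real (demand I i j k)}"
  have le: "\<forall>T\<ge>0. transmitted S i j k T \<le> real (demand I i j k)" and "?X \<noteq> {}"
    using feasibleD(6,7)[OF S ijk] by auto
  moreover have "Inf ?X < T"
    using flow_completion_le_coflow_completion[OF ijk(1,2), of S k] T
    by (simp add: flow_completion_def)
  ultimately obtain T' where T': "T' \<in> ?X" "T' < T"
    using cInf_lessD[of ?X T] by auto
  then show "0 \<le> T" by simp
  have "transmitted S i j k T' \<le> transmitted S i j k T"
    using T' by (intro transmitted_mono[OF S ijk]) auto
  then show "transmitted S i j k T = real (demand I i j k)"
    using T' le \<open>0 \<le> T\<close> by (auto intro: antisym)
qed

text \<open>By time \<open>T\<close> every flow of the coflows in \<open>U\<close> is fully sent, so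
  their joint load at the port is data that has crossed it, and the capacity bound applies.\<close>

lemma load_bound:
  assumes S: "feasible I S" and \<mu>: "\<mu> < 2 * num_ports I"
    and U: "U \<subseteq> {..<num_coflows I}"
    and T: "\<And>k. k \<in> U \<Longrightarrow> coflow_completion I S k < T" "0 \<le> T"
  shows "(\<Sum>k\<in>U. real (load (num_ports I) (demand I) \<mu> k)) \<le> real (num_cores I) * T"
proof -
  let ?N = "num_ports I" and ?n = "num_coflows I" and ?m = "num_cores I"
  have fin: "finite U" using U finite_subset by blast
  have core: "\<And>k. k \<in> U \<Longrightarrow> core_of S k < ?m"
    using feasibleD(1)[OF S] U by auto
  have rate: "rate S i j k \<in> borel_measurable borel \<and>
      (\<forall>t\<ge>0. 0 \<le> rate S i j k t \<and> rate S i j k t \<le> 1)" if "i < ?N" "j < ?N" "k \<in> U" for i j k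
    using feasibleD(2,3)[OF S that(1,2), of k] U that(3) by auto
  have tr: "transmitted S i j k T = real (demand I i j k)" if "i < ?N" "j < ?N" "k \<in> U" for i j k
    using transmitted_after_completion[OF S that(1,2) _ T(1)[OF that(3)]] that U by blast
  show ?thesis
  proof (cases "\<mu> < ?N")
    case True
    have "(\<Sum>k\<in>U. real (load ?N (demand I) \<mu> k)) = (\<Sum>k\<in>U. \<Sum>j<?N. transmitted S \<mu> j k T)"
      using True tr by (simp add: load_def)
    also have "\<dots> \<le> real ?m * T"
      unfolding transmitted_def
    proof (rule port_capacity[where c = "core_of S"])
      fix h t assume h: "h < ?m" "0 \<le> (t::real)"
      let ?B = "{(j, k). j < ?N \<and> k < ?n \<and> core_of S k = h \<and> rate S \<mu> j k t > 0}"
      have "finite ?B" by (rule finite_subset[of _ "{..<?N} \<times> {..<?n}"]) auto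
      then have "card {(j, k). j < ?N \<and> k \<in> U \<and> core_of S k = h \<and> rate S \<mu> j k t > 0} \<le> card ?B"
        using U by (intro card_mono) auto
      also have "\<dots> \<le> 1" using feasibleD(4)[OF S h(1) True h(2)] .
      finally show "card {(j, k). j < ?N \<and> k \<in> U \<and> core_of S k = h \<and> rate S \<mu> j k t > 0} \<le> 1" .
    qed (use rate True core fin T in auto)
    finally show ?thesis .
  next
    case False
    let ?j = "\<mu> - ?N"
    have j: "?j < ?N" using False \<mu> by simp
    have "(\<Sum>k\<in>U. real (load ?N (demand I) \<mu> k)) = (\<Sum>k\<in>U. \<Sum>i<?N. transmitted S i ?j k T)"
      using False tr j by (simp add: load_def)
    also have "\<dots> \<le> real ?m * T"
      unfolding transmitted_def
    proof (rule port_capacity[where c = "core_of S"])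
      fix h t assume h: "h < ?m" "0 \<le> (t::real)"
      let ?B = "{(i, k). i < ?N \<and> k < ?n \<and> core_of S k = h \<and> rate S i ?j k t > 0}"
      have "finite ?B" by (rule finite_subset[of _ "{..<?N} \<times> {..<?n}"]) auto
      then have "card {(i, k). i < ?N \<and> k \<in> U \<and> core_of S k = h \<and> rate S i ?j k t > 0} \<le> card ?B"
        using U by (intro card_mono) auto
      also have "\<dots> \<le> 1" using feasibleD(5)[OF S h(1) j h(2)] .
      finally show "card {(i, k). i < ?N \<and> k \<in> U \<and> core_of S k = h \<and> rate S i ?j k t > 0} \<le> 1" .
    qed (use rate j core fin T in auto)
    finally show ?thesis .
  qed
qed

lemma coflow_completion_nonneg:
  assumes "wf_instance I" "feasible I S" "k < num_coflows I"
  shows "0 \<le> coflow_completion I S k"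
proof -
  have 0: "0 < num_ports I" using assms by (simp add: wf_instance_def)
  have "{T. T \<ge> 0 \<and> transmitted S 0 0 k T = real (demand I 0 0 k)} \<noteq> {}"
    using feasibleD(7)[OF assms(2) 0 0 assms(3)] by auto
  then have "0 \<le> flow_completion I S 0 0 k"
    unfolding flow_completion_def by (intro cInf_greatest) auto
  then show ?thesis using flow_completion_le_coflow_completion[OF 0 0, of S k] by linarith
qed

text \<open>These inequalities are all that is used about the optimal schedule.\<close>

definition parallel_ineqs :: "nat \<Rightarrow> nat \<Rightarrow> nat \<Rightarrow> (nat \<Rightarrow> nat \<Rightarrow> nat) \<Rightarrow> (nat \<Rightarrow> real) \<Rightarrow> bool" where
  "parallel_ineqs M m n P C \<longleftrightarrow>
     (\<forall>k<n. 0 \<le> C k) \<and>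
     (\<forall>\<mu><M. \<forall>U\<subseteq>{..<n}. (\<Sum>k\<in>U. real (P \<mu> k))\<^sup>2 \<le> 2 * real m * (\<Sum>k\<in>U. real (P \<mu> k) * C k))"

lemma feasible_parallel_ineqs:
  assumes "wf_instance I" "feasible I S"
  shows "parallel_ineqs (2 * num_ports I) (num_cores I) (num_coflows I)
           (load (num_ports I) (demand I)) (coflow_completion I S)"
  unfolding parallel_ineqs_def
proof (intro conjI allI impI)
  let ?C = "coflow_completion I S"
  show "0 \<le> ?C k" if "k < num_coflows I" for k
    using coflow_completion_nonneg[OF assms that] .
  fix \<mu> U assume \<mu>: "\<mu> < 2 * num_ports I" and U: "U \<subseteq> {..<num_coflows I}"
  show "(\<Sum>k\<in>U. real (load (num_ports I) (demand I) \<mu> k))\<^sup>2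
     \<le> 2 * real (num_cores I) * (\<Sum>k\<in>U. real (load (num_ports I) (demand I) \<mu> k) * ?C k)"
  proof (rule sum_pairs_le_square)
    show "finite U" using U finite_subset by blast
    fix k assume k: "k \<in> U"
    have m: "0 < real (num_cores I)" using assms by (simp add: wf_instance_def)
    let ?s = "\<Sum>l | l \<in> U \<and> ?C l \<le> ?C k. real (load (num_ports I) (demand I) \<mu> l)"
    \<comment> \<open>\<open>load_bound\<close> speaks only of times strictly after completion; the
      bound at \<open>?C k\<close> itself is reached by letting \<open>T\<close> decrease to
      it.\<close>
    have "?s / real (num_cores I) \<le> T" if "?C k < T" for T
    proof -
      have "0 \<le> ?C k" using coflow_completion_nonneg[OF assms] k U by auto
      then have "?s \<le> real (num_cores I) * T"
        using U that by (intro load_bound[OF assms(2) \<mu>]) auto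
      then show ?thesis using m by (simp add: field_simps)
    qed
    then have "?s / real (num_cores I) \<le> ?C k" by (rule dense_ge)
    then show "?s \<le> real (num_cores I) * ?C k" using m by (simp add: field_simps)
  qed auto
qed

section \<open>The primal-dual order\<close>

definition max_prefix_load :: "nat \<Rightarrow> (nat \<Rightarrow> nat \<Rightarrow> nat) \<Rightarrow> (nat \<Rightarrow> nat) \<Rightarrow> nat \<Rightarrow> nat" where
  "max_prefix_load M P \<sigma> q = Max ((\<lambda>\<mu>. \<Sum>p\<le>q. P \<mu> (\<sigma> p)) ` {..<M})"

text \<open>Schedules enter only through \<open>parallel_ineqs\<close>, and \<open>W\<close> is
  arbitrary because the weights change in every round. Restricting to the first \<open>r\<close>
  positions allows an induction from the empty prefix, where the claim is trivial.\<close>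

definition good_order ::
  "nat \<Rightarrow> nat \<Rightarrow> nat \<Rightarrow> (nat \<Rightarrow> nat \<Rightarrow> nat) \<Rightarrow> (nat \<Rightarrow> nat) \<Rightarrow> nat \<Rightarrow> (nat \<Rightarrow> nat) \<Rightarrow> bool" where
  "good_order M m n P \<sigma> r W \<longleftrightarrow>
     (\<forall>C. parallel_ineqs M m n P C \<longrightarrow>
        (\<Sum>q<r. real (W (\<sigma> q)) * real (max_prefix_load M P \<sigma> q)) \<le>
        2 * real m * (\<Sum>q<r. real (W (\<sigma> q)) * C (\<sigma> q)))"

lemma max_prefix_load_ge: "\<mu> < M \<Longrightarrow> (\<Sum>p\<le>q. P \<mu> (\<sigma> p)) \<le> max_prefix_load M P \<sigma> q"
  unfolding max_prefix_load_def by (intro Max_ge) auto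

lemma max_prefix_load_mono:
  assumes "0 < M" "q \<le> q'"
  shows "max_prefix_load M P \<sigma> q \<le> max_prefix_load M P \<sigma> q'"
proof -
  have "max_prefix_load M P \<sigma> q \<in> (\<lambda>\<mu>. \<Sum>p\<le>q. P \<mu> (\<sigma> p)) ` {..<M}"
    unfolding max_prefix_load_def using assms by (intro Max_in) auto
  then obtain \<mu> where \<mu>: "\<mu> < M" "max_prefix_load M P \<sigma> q = (\<Sum>p\<le>q. P \<mu> (\<sigma> p))" by auto
  note \<mu>(2)
  also have "(\<Sum>p\<le>q. P \<mu> (\<sigma> p)) \<le> (\<Sum>p\<le>q'. P \<mu> (\<sigma> p))"
    using assms by (intro sum_mono2) auto
  also have "\<dots> \<le> max_prefix_load M P \<sigma> q'" by (rule max_prefix_load_ge[OF \<mu>(1)])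
  finally show ?thesis .
qed

text \<open>
  With \<open>\<theta> = W b / P \<mu> b\<close> the weights split as \<open>W = W' / P \<mu> b + \<theta> P \<mu>\<close>.  The first part is covered by the
  remaining coflows, the second by the parallel inequality of the bottleneck port \<open>\<mu>\<close>.
\<close>

lemma good_order_step:
  assumes M: "0 < M" and r: "r < n"
    and \<sigma>: "bij_betw \<sigma> {..<n} {..<n}"
    and \<mu>: "\<mu> < M" "\<And>\<nu>. \<nu> < M \<Longrightarrow> (\<Sum>p\<le>r. P \<nu> (\<sigma> p)) \<le> (\<Sum>p\<le>r. P \<mu> (\<sigma> p))"
    and b: "\<And>q. q \<le> r \<Longrightarrow> W (\<sigma> r) * P \<mu> (\<sigma> q) \<le> W (\<sigma> q) * P \<mu> (\<sigma> r)"
    and W': "W' = (if P \<mu> (\<sigma> r) = 0 then W else (\<lambda>k. W k * P \<mu> (\<sigma> r) - W (\<sigma> r) * P \<mu> k))"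
    and good: "good_order M m n P \<sigma> r W'"
  shows "good_order M m n P \<sigma> (Suc r) W"
  unfolding good_order_def
proof (intro allI impI)
  fix C assume C: "parallel_ineqs M m n P C"
  let ?D = "\<lambda>q. real (max_prefix_load M P \<sigma> q)"
  let ?p = "\<lambda>k. real (P \<mu> k)"
  have inj: "inj_on \<sigma> {..r}"
    using \<sigma> r by (auto simp: bij_betw_def intro: inj_on_subset)
  have sub: "\<sigma> ` {..r} \<subseteq> {..<n}" using \<sigma> r by (auto simp: bij_betw_def)
  have D: "?D r = (\<Sum>q\<le>r. ?p (\<sigma> q))"
  proof -
    have "max_prefix_load M P \<sigma> r = (\<Sum>q\<le>r. P \<mu> (\<sigma> q))"
      unfolding max_prefix_load_def by (rule Max_eqI) (use \<mu> in auto)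
    then show ?thesis by simp
  qed
  have IH: "(\<Sum>q<r. real (W' (\<sigma> q)) * ?D q) \<le> 2 * real m * (\<Sum>q<r. real (W' (\<sigma> q)) * C (\<sigma> q))"
    using good C by (auto simp: good_order_def)
  have Cr: "0 \<le> C (\<sigma> r)" using C sub by (auto simp: parallel_ineqs_def)
  show "(\<Sum>q<Suc r. real (W (\<sigma> q)) * ?D q) \<le> 2 * real m * (\<Sum>q<Suc r. real (W (\<sigma> q)) * C (\<sigma> q))"
  proof (cases "P \<mu> (\<sigma> r) = 0")
    case True
    \<comment> \<open>Without load of the last coflow at \<open>\<mu>\<close> there is no multiple
      to subtract. Minimality then forces its weight to vanish or all remaining coflows to have no
      load at \<open>\<mu>\<close>; as \<open>\<mu>\<close> is the bottleneck, \<open>?D r\<close>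
      is 0 in the latter case.\<close>
    have "real (W (\<sigma> r)) * ?D r = 0"
    proof (cases "W (\<sigma> r) = 0")
      case False
      then have "P \<mu> (\<sigma> q) = 0" if "q \<le> r" for q using b[OF that] True by simp
      then show ?thesis using D by simp
    qed simp
    moreover have "0 \<le> 2 * real m * (real (W (\<sigma> r)) * C (\<sigma> r))" using Cr by simp
    moreover have "W' = W" using True W' by simp
    ultimately show ?thesis using IH by (simp only: sum.lessThan_Suc distrib_left)
  next
    case False
    let ?a = "?p (\<sigma> r)" and ?w = "real (W (\<sigma> r))"
    have a: "0 < ?a" using False by simp
    have split: "?a * real (W (\<sigma> q)) = real (W' (\<sigma> q)) + ?w * ?p (\<sigma> q)" if "q \<le> r" for q
      using b[OF that] False W' by (simp add: of_nat_diff mult.commute)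
    have W'r: "W' (\<sigma> r) = 0" using W' False by simp
    \<comment> \<open>The splitting of the weights, multiplied through by \<open>?a\<close> to avoid
      division. It is used both for the prefix loads and for the completion times; the last coflow
      leaves the first sum because its reduced weight is 0.\<close>
    have expand: "?a * (\<Sum>q<Suc r. real (W (\<sigma> q)) * f q) =
        (\<Sum>q<r. real (W' (\<sigma> q)) * f q) + ?w * (\<Sum>q\<le>r. ?p (\<sigma> q) * f q)" for f :: "nat \<Rightarrow> real"
    proof -
      have "?a * (\<Sum>q<Suc r. real (W (\<sigma> q)) * f q) = (\<Sum>q\<le>r. (?a * real (W (\<sigma> q))) * f q)"
        by (simp only: lessThan_Suc_atMost sum_distrib_left mult.assoc)
      also have "\<dots> = (\<Sum>q\<le>r. (real (W' (\<sigma> q)) + ?w * ?p (\<sigma> q)) * f q)"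
        using split by (intro sum.cong) auto
      also have "\<dots> = (\<Sum>q\<le>r. real (W' (\<sigma> q)) * f q) + ?w * (\<Sum>q\<le>r. ?p (\<sigma> q) * f q)"
        by (simp add: sum.distrib sum_distrib_left algebra_simps)
      also have "(\<Sum>q\<le>r. real (W' (\<sigma> q)) * f q) = (\<Sum>q<r. real (W' (\<sigma> q)) * f q)"
        using W'r by (simp add: lessThan_Suc_atMost[symmetric])
      finally show ?thesis .
    qed
    \<comment> \<open>Prefix loads grow along the order, and the last one is the whole load at
      \<open>\<mu>\<close>. This turns the weighted sum into the square that the parallel inequality
      bounds.\<close>
    have "(\<Sum>q\<le>r. ?p (\<sigma> q) * ?D q) \<le> (\<Sum>q\<le>r. ?p (\<sigma> q) * ?D r)"
      using M by (intro sum_mono mult_left_mono) (auto intro: max_prefix_load_mono)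
    also have "\<dots> = (\<Sum>q\<le>r. ?p (\<sigma> q))\<^sup>2"
      by (simp add: D sum_distrib_right[symmetric] power2_eq_square)
    also have "\<dots> = (\<Sum>k\<in>\<sigma> ` {..r}. ?p k)\<^sup>2" by (simp add: sum.reindex[OF inj])
    also have "\<dots> \<le> 2 * real m * (\<Sum>k\<in>\<sigma> ` {..r}. ?p k * C k)"
      using C \<mu>(1) sub by (auto simp: parallel_ineqs_def)
    also have "(\<Sum>k\<in>\<sigma> ` {..r}. ?p k * C k) = (\<Sum>q\<le>r. ?p (\<sigma> q) * C (\<sigma> q))"
      by (simp add: sum.reindex[OF inj])
    finally have port: "(\<Sum>q\<le>r. ?p (\<sigma> q) * ?D q) \<le> 2 * real m * (\<Sum>q\<le>r. ?p (\<sigma> q) * C (\<sigma> q))" .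
    have "?a * (\<Sum>q<Suc r. real (W (\<sigma> q)) * ?D q) =
        (\<Sum>q<r. real (W' (\<sigma> q)) * ?D q) + ?w * (\<Sum>q\<le>r. ?p (\<sigma> q) * ?D q)"
      by (rule expand)
    also have "\<dots> \<le> 2 * real m * (\<Sum>q<r. real (W' (\<sigma> q)) * C (\<sigma> q)) +
        ?w * (2 * real m * (\<Sum>q\<le>r. ?p (\<sigma> q) * C (\<sigma> q)))"
      using IH port by (intro add_mono mult_left_mono) auto
    also have "\<dots> = 2 * real m * (?a * (\<Sum>q<Suc r. real (W (\<sigma> q)) * C (\<sigma> q)))"
      unfolding expand by (simp add: algebra_simps)
    finally have "?a * (\<Sum>q<Suc r. real (W (\<sigma> q)) * ?D q) \<le>
        ?a * (2 * real m * (\<Sum>q<Suc r. real (W (\<sigma> q)) * C (\<sigma> q)))" by (simp only: mult_ac)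
    then show ?thesis using a by (simp only: mult_le_cancel_left_pos)
  qed
qed

section \<open>Greedy transmission along an order\<close>

text \<open>Both ports are summed because either can block the flow. It is applied to the full
  demands, giving the completion bound, and to the amounts sent so far, which account for elapsed
  time.\<close>

definition prefix_load ::
  "nat \<Rightarrow> (nat \<Rightarrow> nat) \<Rightarrow> (nat \<Rightarrow> nat \<Rightarrow> nat \<Rightarrow> nat) \<Rightarrow> nat \<Rightarrow> nat \<Rightarrow> nat \<Rightarrow> nat" where
  "prefix_load N \<sigma> f i j q = (\<Sum>p\<le>q. load N f i (\<sigma> p) + load N f (N + j) (\<sigma> p))"

text \<open>
  State of the greedy algorithm at time \<open>T\<close>: \<open>rem i j k\<close> is the untransmitted part of flow \<open>(i, j, k)\<close>,
  and \<open>act i j k t\<close> says that this flow is transmitted at time \<open>t\<close>.  As long as a flow is unfinished,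
  each unit of time has been used by a flow of no lower priority at one of its two ports.
\<close>

definition greedy_inv ::
  "nat \<Rightarrow> nat \<Rightarrow> (nat \<Rightarrow> nat) \<Rightarrow> (nat \<Rightarrow> nat \<Rightarrow> nat \<Rightarrow> nat) \<Rightarrow> nat \<Rightarrow> (nat \<Rightarrow> nat \<Rightarrow> nat \<Rightarrow> nat) \<Rightarrow>
   (nat \<Rightarrow> nat \<Rightarrow> nat \<Rightarrow> real \<Rightarrow> bool) \<Rightarrow> bool" where
  "greedy_inv N n \<sigma> dem T rem act \<longleftrightarrow>
     (\<forall>i<N. \<forall>j<N. \<forall>k<n. rem i j k \<le> dem i j k \<and> {t. act i j k t} \<in> sets lborel \<and>
        emeasure lborel {t. act i j k t} = ennreal (real (dem i j k - rem i j k))) \<and>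
     (\<forall>i j k t. act i j k t \<longrightarrow> i < N \<and> j < N \<and> k < n \<and> 0 \<le> t \<and> t < real T) \<and>
     (\<forall>i j j' k k' t. act i j k t \<longrightarrow> act i j' k' t \<longrightarrow> j' = j \<and> k' = k) \<and>
     (\<forall>i i' j k k' t. act i j k t \<longrightarrow> act i' j k' t \<longrightarrow> i' = i \<and> k' = k) \<and>
     (\<forall>q<n. \<forall>i<N. \<forall>j<N. rem i j (\<sigma> q) > 0 \<longrightarrow>
        T \<le> prefix_load N \<sigma> (\<lambda>i j k. dem i j k - rem i j k) i j q) \<and>
     (\<forall>q<n. \<forall>i<N. \<forall>j<N. \<forall>t. act i j (\<sigma> q) t \<longrightarrow> t < real (prefix_load N \<sigma> dem i j q))"

lemma greedy_invI:
  assumes "\<And>i j k. i < N \<Longrightarrow> j < N \<Longrightarrow> k < n \<Longrightarrow> rem i j k \<le> dem i j k"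
    and "\<And>i j k. i < N \<Longrightarrow> j < N \<Longrightarrow> k < n \<Longrightarrow> {t. act i j k t} \<in> sets lborel"
    and "\<And>i j k. i < N \<Longrightarrow> j < N \<Longrightarrow> k < n \<Longrightarrow>
           emeasure lborel {t. act i j k t} = ennreal (real (dem i j k - rem i j k))"
    and "\<And>i j k t. act i j k t \<Longrightarrow> i < N \<and> j < N \<and> k < n \<and> 0 \<le> t \<and> t < real T"
    and "\<And>i j j' k k' t. act i j k t \<Longrightarrow> act i j' k' t \<Longrightarrow> j' = j \<and> k' = k"
    and "\<And>i i' j k k' t. act i j k t \<Longrightarrow> act i' j k' t \<Longrightarrow> i' = i \<and> k' = k"
    and "\<And>q i j. q < n \<Longrightarrow> i < N \<Longrightarrow> j < N \<Longrightarrow> rem i j (\<sigma> q) > 0 \<Longrightarrow>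
           T \<le> prefix_load N \<sigma> (\<lambda>i j k. dem i j k - rem i j k) i j q"
    and "\<And>q i j t. q < n \<Longrightarrow> i < N \<Longrightarrow> j < N \<Longrightarrow> act i j (\<sigma> q) t \<Longrightarrow>
           t < real (prefix_load N \<sigma> dem i j q)"
  shows "greedy_inv N n \<sigma> dem T rem act"
  unfolding greedy_inv_def
proof (intro conjI)
  show "\<forall>i<N. \<forall>j<N. \<forall>k<n. rem i j k \<le> dem i j k \<and> {t. act i j k t} \<in> sets lborel \<and>
      emeasure lborel {t. act i j k t} = ennreal (real (dem i j k - rem i j k))"
    using assms(1-3) by simp
qed (intro allI impI; rule assms(4-); assumption)+

lemma greedy_invD:
  assumes "greedy_inv N n \<sigma> dem T rem act"
  shows "i < N \<Longrightarrow> j < N \<Longrightarrow> k < n \<Longrightarrow> rem i j k \<le> dem i j k"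
    and "i < N \<Longrightarrow> j < N \<Longrightarrow> k < n \<Longrightarrow> {t. act i j k t} \<in> sets lborel"
    and "i < N \<Longrightarrow> j < N \<Longrightarrow> k < n \<Longrightarrow>
           emeasure lborel {t. act i j k t} = ennreal (real (dem i j k - rem i j k))"
    and "act i j k t \<Longrightarrow> i < N \<and> j < N \<and> k < n \<and> 0 \<le> t \<and> t < real T"
    and "act i j k t \<Longrightarrow> act i j' k' t \<Longrightarrow> j' = j \<and> k' = k"
    and "act i j k t \<Longrightarrow> act i' j k' t \<Longrightarrow> i' = i \<and> k' = k"
    and "q < n \<Longrightarrow> i < N \<Longrightarrow> j < N \<Longrightarrow> rem i j (\<sigma> q) > 0 \<Longrightarrow>
           T \<le> prefix_load N \<sigma> (\<lambda>i j k. dem i j k - rem i j k) i j q"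
    and "q < n \<Longrightarrow> i < N \<Longrightarrow> j < N \<Longrightarrow> act i j (\<sigma> q) t \<Longrightarrow>
           t < real (prefix_load N \<sigma> dem i j q)"
proof -
  note * = assms[unfolded greedy_inv_def]
  note ** = *[THEN conjunct2] *[THEN conjunct2, THEN conjunct2]
    *[THEN conjunct2, THEN conjunct2, THEN conjunct2]
    *[THEN conjunct2, THEN conjunct2, THEN conjunct2, THEN conjunct2]
  show "i < N \<Longrightarrow> j < N \<Longrightarrow> k < n \<Longrightarrow> rem i j k \<le> dem i j k"
    and "i < N \<Longrightarrow> j < N \<Longrightarrow> k < n \<Longrightarrow> {t. act i j k t} \<in> sets lborel"
    and "i < N \<Longrightarrow> j < N \<Longrightarrow> k < n \<Longrightarrow>
           emeasure lborel {t. act i j k t} = ennreal (real (dem i j k - rem i j k))"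
    using *[THEN conjunct1, rule_format, of i j k] by simp_all
  show "act i j k t \<Longrightarrow> i < N \<and> j < N \<and> k < n \<and> 0 \<le> t \<and> t < real T"
    by (rule **(1)[THEN conjunct1, rule_format])
  show "act i j k t \<Longrightarrow> act i j' k' t \<Longrightarrow> j' = j \<and> k' = k"
    by (rule **(2)[THEN conjunct1, rule_format])
  show "act i j k t \<Longrightarrow> act i' j k' t \<Longrightarrow> i' = i \<and> k' = k"
    by (rule **(3)[THEN conjunct1, rule_format])
  show "q < n \<Longrightarrow> i < N \<Longrightarrow> j < N \<Longrightarrow> rem i j (\<sigma> q) > 0 \<Longrightarrow>
           T \<le> prefix_load N \<sigma> (\<lambda>i j k. dem i j k - rem i j k) i j q"
    by (rule **(4)[THEN conjunct1, rule_format])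
  show "q < n \<Longrightarrow> i < N \<Longrightarrow> j < N \<Longrightarrow> act i j (\<sigma> q) t \<Longrightarrow>
           t < real (prefix_load N \<sigma> dem i j q)"
    by (rule **(4)[THEN conjunct2, rule_format])
qed

lemma load_mono:
  assumes "\<And>i j. i < N \<Longrightarrow> j < N \<Longrightarrow> f i j k \<le> g i j k" "\<mu> < 2 * N"
  shows "load N f \<mu> k \<le> load N g \<mu> k"
  using assms by (auto simp: load_def intro!: sum_mono)

lemma sum_increase:
  fixes f g :: "'a \<Rightarrow> nat"
  assumes "finite A" "x \<in> A" "\<And>y. y \<in> A \<Longrightarrow> f y \<le> g y" "f x + e \<le> g x"
  shows "sum f A + e \<le> sum g A"
proof -
  have "sum f (A - {x}) \<le> sum g (A - {x})" using assms by (intro sum_mono) auto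
  then show ?thesis using assms by (simp add: sum.remove[of A x])
qed

text \<open>One summand at the shared port grows by \<open>e\<close> and no other shrinks. With
  \<open>f\<close> and \<open>g\<close> the amounts sent before and after a round, the length
  \<open>e\<close> of the round is charged to a flow of no lower priority at a port of
  \<open>(i, j)\<close>.\<close>

lemma prefix_load_increase:
  assumes le: "\<And>i j k. i < N \<Longrightarrow> j < N \<Longrightarrow> k \<in> \<sigma> ` {..q} \<Longrightarrow> f i j k \<le> g i j k"
    and p: "p \<le> q" and "i < N" "j < N" "i' < N" "j' < N"
    and inc: "f i' j' (\<sigma> p) + e \<le> g i' j' (\<sigma> p)" and share: "i' = i \<or> j' = j"
  shows "prefix_load N \<sigma> f i j q + e \<le> prefix_load N \<sigma> g i j q"
  unfolding prefix_load_def
proof (rule sum_increase)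
  have m: "load N f \<mu> (\<sigma> p') \<le> load N g \<mu> (\<sigma> p')" if "p' \<le> q" "\<mu> < 2 * N" for \<mu> p'
    using le that by (intro load_mono) auto
  show "p \<in> {..q}" using p by simp
  show "load N f i (\<sigma> p') + load N f (N + j) (\<sigma> p') \<le> load N g i (\<sigma> p') + load N g (N + j) (\<sigma> p')"
    if "p' \<in> {..q}" for p'
    using m that assms by (intro add_mono) auto
  show "load N f i (\<sigma> p) + load N f (N + j) (\<sigma> p) + e \<le> load N g i (\<sigma> p) + load N g (N + j) (\<sigma> p)"
    using share
  proof
    assume i: "i' = i"
    have "load N f i (\<sigma> p) + e \<le> load N g i (\<sigma> p)"
      unfolding load_def using assms i by (auto intro!: sum_increase[where x = j'])
    then show ?thesis using m[of p "N + j"] assms by simp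
  next
    assume j: "j' = j"
    have "load N f (N + j) (\<sigma> p) + e \<le> load N g (N + j) (\<sigma> p)"
      unfolding load_def using assms j by (auto intro!: sum_increase[where x = i'])
    then show ?thesis using m[of p i] assms by simp
  qed
qed auto

lemma prefix_load_mono:
  assumes "\<And>i j k. i < N \<Longrightarrow> j < N \<Longrightarrow> k \<in> \<sigma> ` {..q} \<Longrightarrow> f i j k \<le> g i j k" "i < N" "j < N"
  shows "prefix_load N \<sigma> f i j q \<le> prefix_load N \<sigma> g i j q"
  unfolding prefix_load_def using assms by (intro sum_mono add_mono load_mono) auto

lemma greedy_inv_init:
  assumes "\<And>i j k t. \<not> act i j k t"
  shows "greedy_inv N n \<sigma> dem 0 dem act"
  by (rule greedy_invI) (use assms in auto)

text \<open>All earlier activity lies before \<open>T\<close>, so the new interval is disjoint from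
  it and measures add. By \<open>block\<close>, every flow unfinished at the start sees
  \<open>\<delta>\<close> further units sent at one of its ports by a flow of no lower
  priority.\<close>

lemma greedy_inv_round:
  assumes inv: "greedy_inv N n \<sigma> dem T rem act"
    and \<sigma>: "bij_betw \<sigma> {..<n} {..<n}"
    and X: "\<And>i j k. (i, j, k) \<in> X \<Longrightarrow> i < N \<and> j < N \<and> k < n \<and> \<delta> \<le> rem i j k \<and> 0 < rem i j k"
    and in1: "\<And>i j j' k k'. (i, j, k) \<in> X \<Longrightarrow> (i, j', k') \<in> X \<Longrightarrow> j' = j \<and> k' = k"
    and out1: "\<And>i i' j k k'. (i, j, k) \<in> X \<Longrightarrow> (i', j, k') \<in> X \<Longrightarrow> i' = i \<and> k' = k"
    and block: "\<And>q i j. q < n \<Longrightarrow> i < N \<Longrightarrow> j < N \<Longrightarrow> rem i j (\<sigma> q) > 0 \<Longrightarrow>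
        \<exists>p\<le>q. \<exists>i' j'. (i', j', \<sigma> p) \<in> X \<and> (i' = i \<or> j' = j)"
    and rem': "\<And>i j k. i < N \<Longrightarrow> j < N \<Longrightarrow> k < n \<Longrightarrow>
        rem' i j k = rem i j k - (if (i, j, k) \<in> X then \<delta> else 0)"
    and act': "\<And>i j k t. act' i j k t \<longleftrightarrow>
        act i j k t \<or> (i, j, k) \<in> X \<and> real T \<le> t \<and> t < real (T + \<delta>)"
  shows "greedy_inv N n \<sigma> dem (T + \<delta>) rem' act'"
proof -
  note D = greedy_invD[OF inv]
  have \<sigma>n: "\<sigma> q < n" if "q < n" for q using \<sigma> that by (auto simp: bij_betw_def)
  have disj: "\<not> act i j k t" if "real T \<le> t" for i j k t using D(4)[of i j k t] that by auto
  \<comment> \<open>The premise mentions \<open>rem\<close>, not \<open>rem'\<close>, so that flows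
    finished by this very round are covered: their last interval must also end in time.\<close>
  have step: "T + \<delta> \<le> prefix_load N \<sigma> (\<lambda>i j k. dem i j k - rem' i j k) i j q"
    if q: "q < n" "i < N" "j < N" "rem i j (\<sigma> q) > 0" for q i j
  proof -
    obtain p i' j' where p: "p \<le> q" "(i', j', \<sigma> p) \<in> X" "i' = i \<or> j' = j"
      using block[OF q] by blast
    have "prefix_load N \<sigma> (\<lambda>i j k. dem i j k - rem i j k) i j q + \<delta>
        \<le> prefix_load N \<sigma> (\<lambda>i j k. dem i j k - rem' i j k) i j q"
    proof (rule prefix_load_increase[OF _ p(1) q(2,3) _ _ _ p(3)])
      show "i' < N" "j' < N" using X[OF p(2)] by auto
      show "dem i j k - rem i j k \<le> dem i j k - rem' i j k" if "i < N" "j < N" "k \<in> \<sigma> ` {..q}" for i j k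
        using that q \<sigma>n by (auto simp: rem')
      show "dem i' j' (\<sigma> p) - rem i' j' (\<sigma> p) + \<delta> \<le> dem i' j' (\<sigma> p) - rem' i' j' (\<sigma> p)"
        using X[OF p(2)] p(2) D(1)[of i' j' "\<sigma> p"] by (simp add: rem')
    qed
    then show ?thesis using D(7)[OF q] by linarith
  qed
  show ?thesis
  proof (rule greedy_invI)
    fix i j k assume ijk: "i < N" "j < N" "k < n"
    show "rem' i j k \<le> dem i j k" using D(1)[OF ijk] rem'[OF ijk] by simp
    let ?A = "{t. act i j k t}" and ?I = "{real T..<real (T + \<delta>)}"
    have A': "{t. act' i j k t} = (if (i, j, k) \<in> X then ?A \<union> ?I else ?A)"
      using act' by auto
    show "{t. act' i j k t} \<in> sets lborel" unfolding A' using D(2)[OF ijk] by auto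
    show "emeasure lborel {t. act' i j k t} = ennreal (real (dem i j k - rem' i j k))"
    proof (cases "(i, j, k) \<in> X")
      case True
      have "emeasure lborel {t. act' i j k t} = emeasure lborel ?A + emeasure lborel ?I"
        unfolding A' using True D(2)[OF ijk] disj by (subst plus_emeasure) auto
      also have "\<dots> = ennreal (real (dem i j k - rem i j k)) + ennreal (real \<delta>)"
        using D(3)[OF ijk] by simp
      also have "\<dots> = ennreal (real (dem i j k - rem' i j k))"
        using X[OF True] D(1)[OF ijk] rem'[OF ijk] True
        by (simp add: ennreal_plus[symmetric] of_nat_diff del: ennreal_plus)
      finally show ?thesis .
    next
      case False
      then show ?thesis unfolding A' using D(3)[OF ijk] rem'[OF ijk] by simp
    qed
  next
    fix i j k t assume "act' i j k t"
    then show "i < N \<and> j < N \<and> k < n \<and> 0 \<le> t \<and> t < real (T + \<delta>)"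
      using act' D(4)[of i j k t] X[of i j k] by auto
  next
    fix i j j' k k' t assume "act' i j k t" "act' i j' k' t"
    then show "j' = j \<and> k' = k"
      unfolding act' using D(5)[of i j k t j' k'] in1[of i j k j' k'] disj by auto
  next
    fix i i' j k k' t assume "act' i j k t" "act' i' j k' t"
    then show "i' = i \<and> k' = k"
      unfolding act' using D(6)[of i j k t i' k'] out1[of i j k i' k'] disj by blast
  next
    fix q i j assume q: "q < n" "i < N" "j < N" "rem' i j (\<sigma> q) > 0"
    then have "rem i j (\<sigma> q) > 0" using rem'[of i j "\<sigma> q"] \<sigma>n by simp
    then show "T + \<delta> \<le> prefix_load N \<sigma> (\<lambda>i j k. dem i j k - rem' i j k) i j q"
      using q step by blast
  next
    fix q i j t assume q: "q < n" "i < N" "j < N" and a: "act' i j (\<sigma> q) t"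
    show "t < real (prefix_load N \<sigma> dem i j q)"
    proof (cases "act i j (\<sigma> q) t")
      case True then show ?thesis using D(8) q by blast
    next
      case False
      with a have x: "(i, j, \<sigma> q) \<in> X" "t < real (T + \<delta>)" using act' by auto
      have "T + \<delta> \<le> prefix_load N \<sigma> (\<lambda>i j k. dem i j k - rem' i j k) i j q"
        using step[OF q] X[OF x(1)] by simp
      also have "\<dots> \<le> prefix_load N \<sigma> dem i j q"
        using q by (intro prefix_load_mono) auto
      finally show ?thesis using x(2) by linarith
    qed
  qed
qed

lemma prefix_load_le:
  assumes "i < N" "j < N"
  shows "prefix_load N \<sigma> f i j q \<le> 2 * max_prefix_load (2 * N) (load N f) \<sigma> q"
proof -
  have "prefix_load N \<sigma> f i j q = (\<Sum>p\<le>q. load N f i (\<sigma> p)) + (\<Sum>p\<le>q. load N f (N + j) (\<sigma> p))"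
    by (simp add: prefix_load_def sum.distrib)
  also have "\<dots> \<le> max_prefix_load (2 * N) (load N f) \<sigma> q + max_prefix_load (2 * N) (load N f) \<sigma> q"
    using assms by (intro add_mono max_prefix_load_ge) auto
  finally show ?thesis by simp
qed

text \<open>With rates 0 and 1 the amount transmitted is the measure of the active times. A flow is
  never active at or after its prefix load, so it is complete by then, and each of its two ports
  contributes at most the maximal prefix load.\<close>

lemma greedy_schedule:
  assumes wf: "wf_instance I"
    and inv: "greedy_inv (num_ports I) (num_coflows I) \<sigma> (demand I) T rem act"
    and \<sigma>: "bij_betw \<sigma> {..<num_coflows I} {..<num_coflows I}"
    and rem: "\<And>i j k. i < num_ports I \<Longrightarrow> j < num_ports I \<Longrightarrow> k < num_coflows I \<Longrightarrow> rem i j k = 0"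
    and S: "\<And>k. core_of S k = 0" "\<And>i j k t. rate S i j k t = (if act i j k t then 1 else 0)"
  shows "feasible I S"
    and "q < num_coflows I \<Longrightarrow> coflow_completion I S (\<sigma> q) \<le>
           2 * real (max_prefix_load (2 * num_ports I) (load (num_ports I) (demand I)) \<sigma> q)"
proof -
  let ?N = "num_ports I" and ?n = "num_coflows I"
  note D = greedy_invD[OF inv]
  let ?A = "\<lambda>i j k. {t. act i j k t}"
  have tr: "transmitted S i j k T' = measure lborel ({0..T'} \<inter> ?A i j k)" for i j k T'
  proof -
    have "transmitted S i j k T' = (LINT t|lborel. indicat_real ({0..T'} \<inter> ?A i j k) t)"
      unfolding transmitted_def set_lebesgue_integral_def S(2)
      by (rule Bochner_Integration.integral_cong) (auto simp: indicator_def)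
    then show ?thesis by simp
  qed
  have mA: "measure lborel (?A i j k) = real (demand I i j k)" if "i < ?N" "j < ?N" "k < ?n" for i j k
    using D(3)[OF that] rem[OF that] by (simp add: measure_def)
  have le: "transmitted S i j k T' \<le> real (demand I i j k)" if "i < ?N" "j < ?N" "k < ?n" for i j k T'
    unfolding tr mA[OF that, symmetric]
    using D(2,3)[OF that] by (intro measure_mono_fmeasurable) (auto simp: fmeasurable_def)
  have eq: "transmitted S i j k T' = real (demand I i j k)"
    if "i < ?N" "j < ?N" "k < ?n" "\<And>t. act i j k t \<Longrightarrow> t \<le> T'" for i j k T'
  proof -
    have "{0..T'} \<inter> ?A i j k = ?A i j k" using that(4) D(4) by auto
    then show ?thesis unfolding tr using mA[OF that(1-3)] by simp
  qed
  have card1: "card B \<le> 1" if "\<And>x y. x \<in> B \<Longrightarrow> y \<in> B \<Longrightarrow> x = y" for B :: "(nat \<times> nat) set"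
  proof -
    have "B = {} \<or> (\<exists>x. B = {x})" using that by blast
    then show ?thesis by auto
  qed
  show "feasible I S"
    unfolding feasible_def
  proof (intro conjI allI impI)
    show "core_of S k < num_cores I" for k using wf S(1) by (simp add: wf_instance_def)
    fix i j k assume ijk: "i < ?N" "j < ?N" "k < ?n"
    have "rate S i j k = indicat_real (?A i j k)" by (auto simp: S(2) indicator_def)
    then show "rate S i j k \<in> borel_measurable borel" using D(2)[OF ijk] by simp
    show "transmitted S i j k T' \<le> real (demand I i j k)" for T' by (rule le[OF ijk])
    have "transmitted S i j k (real T) = real (demand I i j k)"
      using D(4) by (intro eq[OF ijk]) force
    then show "\<exists>T\<ge>0. transmitted S i j k T = real (demand I i j k)"
      by (intro exI[of _ "real T"]) simp
  next
    show "card {(j, k). j < ?N \<and> k < ?n \<and> core_of S k = h \<and> rate S i j k t > 0} \<le> 1" for h i t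
      by (rule card1) (use D(5) in \<open>auto simp: S(2) split: if_splits\<close>)
    show "card {(i, k). i < ?N \<and> k < ?n \<and> core_of S k = h \<and> rate S i j k t > 0} \<le> 1" for h j t
      by (rule card1) (use D(6) in \<open>auto simp: S(2) split: if_splits\<close>)
  qed (auto simp: S(2))
  show "coflow_completion I S (\<sigma> q) \<le> 2 * real (max_prefix_load (2 * ?N) (load ?N (demand I)) \<sigma> q)"
    if q: "q < ?n"
  proof -
    have \<sigma>q: "\<sigma> q < ?n" using \<sigma> q by (auto simp: bij_betw_def)
    have "flow_completion I S i j (\<sigma> q) \<le> 2 * real (max_prefix_load (2 * ?N) (load ?N (demand I)) \<sigma> q)"
      if ij: "i < ?N" "j < ?N" for i j
    proof -
      let ?T = "real (prefix_load ?N \<sigma> (demand I) i j q)"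
      have "transmitted S i j (\<sigma> q) ?T = real (demand I i j (\<sigma> q))"
        using D(8)[OF q ij] by (intro eq[OF ij \<sigma>q]) force
      then have "flow_completion I S i j (\<sigma> q) \<le> ?T"
        unfolding flow_completion_def by (intro cInf_lower) (auto intro: bdd_belowI[of _ 0])
      also have "\<dots> \<le> 2 * real (max_prefix_load (2 * ?N) (load ?N (demand I)) \<sigma> q)"
        using prefix_load_le[OF ij, of \<sigma> "demand I" q] by linarith
      finally show ?thesis .
    qed
    moreover have "0 < ?N" using wf by (simp add: wf_instance_def)
    ultimately show ?thesis
      unfolding coflow_completion_def by (subst Max_le_iff) auto
  qed
qed

section \<open>The greedy phase\<close>

definition cell :: "nat \<Rightarrow> nat \<Rightarrow> nat \<Rightarrow> nat \<Rightarrow> nat" where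
  "cell N i j k = (k * N + i) * N + j"

lemma cell_inject:
  assumes "i < N" "j < N" "i' < N" "j' < N"
  shows "cell N i j k = cell N i' j' k' \<longleftrightarrow> i = i' \<and> j = j' \<and> k = k'"
proof
  assume eq: "cell N i j k = cell N i' j' k'"
  have "cell N i j k mod N = j" "cell N i j k div N = k * N + i"
    "cell N i' j' k' mod N = j'" "cell N i' j' k' div N = k' * N + i'"
    using assms by (simp_all add: cell_def)
  with eq have 1: "j = j'" "k * N + i = k' * N + i'" by simp_all
  have "(k * N + i) mod N = i" "(k * N + i) div N = k"
    "(k' * N + i') mod N = i'" "(k' * N + i') div N = k'"
    using assms by simp_all
  with 1 show "i = i' \<and> j = j' \<and> k = k'" by simp
qed simp

definition cell_exp :: "aexp \<Rightarrow> aexp \<Rightarrow> aexp \<Rightarrow> aexp" where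
  "cell_exp i j k = Add (Mul (Add (Mul k (scalar ''N'')) i) (scalar ''N'')) j"

lemma aval_cell_exp:
  "aval (cell_exp i j k) s = cell (s ''N'' 0) (aval i s) (aval j s) (aval k s)"
  by (simp add: cell_exp_def cell_def)

abbreviation flow_exp :: aexp where
  "flow_exp \<equiv> cell_exp (scalar ''i'') (scalar ''j'') (Read ''ord'' (scalar ''q''))"

abbreviation all_flows :: "prog \<Rightarrow> prog" where
  "all_flows p \<equiv> PFor ''q'' (scalar ''n'') (PFor ''i'' (scalar ''N'') (PFor ''j'' (scalar ''N'') p))"

definition flow_box :: "nat \<Rightarrow> nat \<Rightarrow> (nat \<times> nat \<times> nat) set" where
  "flow_box n N = {..<n} \<times> {..<N} \<times> {..<N}"

text \<open>Replaces three nested loop invariants by one indexed by the set \<open>Z\<close> of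
  visited flows. Positions form the outermost loop, hence visited flows have position at most
  \<open>q\<close>; \<open>loop_vars\<close> absorbs the writes to the counters between two
  visits.\<close>

lemma run_all_flows:
  fixes J :: "(nat \<times> nat \<times> nat) set \<Rightarrow> state \<Rightarrow> bool"
  assumes init: "J {} s"
    and N: "s ''N'' 0 = N" "s ''n'' 0 = n"
    and loop_vars: "\<And>Z t x v. x \<in> {''q'', ''i'', ''j''} \<Longrightarrow> J Z t \<Longrightarrow> J Z (upd t x 0 v)"
    and wr: "writes p \<inter> {''N'', ''n'', ''q'', ''i'', ''j''} = {}"
    and step: "\<And>Z q i j t. q < n \<Longrightarrow> i < N \<Longrightarrow> j < N \<Longrightarrow> Z \<subseteq> flow_box n N \<Longrightarrow> (q, i, j) \<notin> Z \<Longrightarrow>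
        (\<And>q' i' j'. (q', i', j') \<in> Z \<Longrightarrow> q' \<le> q) \<Longrightarrow> J Z t \<Longrightarrow>
        (\<And>y. y \<notin> writes (all_flows p) \<Longrightarrow> t y = s y) \<Longrightarrow>
        t ''q'' 0 = q \<Longrightarrow> t ''i'' 0 = i \<Longrightarrow> t ''j'' 0 = j \<Longrightarrow> J (insert (q, i, j) Z) (run p t)"
  shows "J (flow_box n N) (run (all_flows p) s)"
proof (rule run_For_invariant[where I = "\<lambda>q. J (flow_box q N)"])
  show "J (flow_box 0 N) s" using init by (simp add: flow_box_def)
  show "J (flow_box n N) (upd t ''q'' 0 (aval (scalar ''n'') s))"
    if "J (flow_box (aval (scalar ''n'') s) N) t" for t
    using that N loop_vars by simp
  fix q t
  assume q: "q < aval (scalar ''n'') s" and Jt: "J (flow_box q N) t"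
    and fr: "\<And>y. y \<notin> writes (all_flows p) \<Longrightarrow> t y = s y"
  define t1 where "t1 = upd t ''q'' 0 q"
  have fr1: "t1 y = s y" if "y \<notin> writes (all_flows p)" for y
    using that fr by (auto simp: t1_def upd_def)
  have N1: "t1 ''N'' 0 = N" "t1 ''q'' 0 = q"
    using fr1[of "''N''"] wr N by (auto simp: t1_def upd_def)
  let ?I2 = "\<lambda>i t. J (flow_box q N \<union> {q} \<times> {..<i} \<times> {..<N}) t"
  have "J (flow_box (Suc q) N) (run (PFor ''i'' (scalar ''N'') (PFor ''j'' (scalar ''N'') p)) t1)"
  proof (rule run_For_invariant[where I = ?I2])
    show "?I2 0 t1" using Jt loop_vars by (simp add: t1_def)
    have "flow_box q N \<union> {q} \<times> {..<N} \<times> {..<N} = flow_box (Suc q) N"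
      by (auto simp: flow_box_def)
    then show "J (flow_box (Suc q) N) (upd t ''i'' 0 (aval (scalar ''N'') t1))"
      if "?I2 (aval (scalar ''N'') t1) t" for t
      using that N1 loop_vars by simp
    fix i t'
    assume i: "i < aval (scalar ''N'') t1" and Jt': "?I2 i t'"
      and fr': "\<And>y. y \<notin> writes (PFor ''i'' (scalar ''N'') (PFor ''j'' (scalar ''N'') p)) \<Longrightarrow> t' y = t1 y"
    define t2 where "t2 = upd t' ''i'' 0 i"
    have fr2: "t2 y = s y" if "y \<notin> writes (all_flows p)" for y
      using that fr1 fr' by (auto simp: t2_def upd_def)
    have "t' ''q'' = t1 ''q''" using wr by (intro fr') auto
    then have N2: "t2 ''N'' 0 = N" "t2 ''q'' 0 = q" "t2 ''i'' 0 = i"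
      using fr2[of "''N''"] wr N N1 by (auto simp: t2_def upd_def)
    let ?I3 = "\<lambda>j t. J (flow_box q N \<union> {q} \<times> {..<i} \<times> {..<N} \<union> {q} \<times> {i} \<times> {..<j}) t"
    show "?I2 (Suc i) (run (PFor ''j'' (scalar ''N'') p) (upd t' ''i'' 0 i))"
      unfolding t2_def[symmetric]
    proof (rule run_For_invariant[where I = ?I3])
      show "?I3 0 t2" using Jt' loop_vars by (simp add: t2_def)
      have "flow_box q N \<union> {q} \<times> {..<i} \<times> {..<N} \<union> {q} \<times> {i} \<times> {..<N} =
          flow_box q N \<union> {q} \<times> {..<Suc i} \<times> {..<N}"
        by auto
      then show "?I2 (Suc i) (upd t ''j'' 0 (aval (scalar ''N'') t2))"
        if "?I3 (aval (scalar ''N'') t2) t" for t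
        using that N2 loop_vars by simp
      fix j t''
      assume j: "j < aval (scalar ''N'') t2" and Jt'': "?I3 j t''"
        and fr'': "\<And>y. y \<notin> writes (PFor ''j'' (scalar ''N'') p) \<Longrightarrow> t'' y = t2 y"
      define t3 where "t3 = upd t'' ''j'' 0 j"
      let ?Z = "flow_box q N \<union> {q} \<times> {..<i} \<times> {..<N} \<union> {q} \<times> {i} \<times> {..<j}"
      have "t'' ''q'' = t2 ''q''" "t'' ''i'' = t2 ''i''" using wr by (auto intro!: fr'')
      then have N3: "t3 ''q'' 0 = q" "t3 ''i'' 0 = i" "t3 ''j'' 0 = j"
        using N2 by (auto simp: t3_def upd_def)
      have "J (insert (q, i, j) ?Z) (run p t3)"
      proof (rule step)
        show "q < n" "i < N" "j < N" using q i j N N1 N2 by auto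
        then show "?Z \<subseteq> flow_box n N" by (auto simp: flow_box_def)
        show "(q, i, j) \<notin> ?Z" by (auto simp: flow_box_def)
        show "q' \<le> q" if "(q', i', j') \<in> ?Z" for q' i' j' using that by (auto simp: flow_box_def)
        show "J ?Z t3" using Jt'' loop_vars by (simp add: t3_def)
        show "t3 y = s y" if "y \<notin> writes (all_flows p)" for y
          using that fr2 fr'' by (auto simp: t3_def upd_def)
      qed (use N3 in auto)
      moreover have "insert (q, i, j) ?Z =
        flow_box q N \<union> {q} \<times> {..<i} \<times> {..<N} \<union> {q} \<times> {i} \<times> {..<Suc j}" by auto
      ultimately show "?I3 (Suc j) (run p (upd t'' ''j'' 0 j))" by (simp add: t3_def)
    qed
  qed
  then show "J (flow_box (Suc q) N)
      (run (PFor ''i'' (scalar ''N'') (PFor ''j'' (scalar ''N'') p)) (upd t ''q'' 0 q))"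
    by (simp add: t1_def)
qed

text \<open>
  Arrays: \<open>ord\<close> is the priority order, \<open>d\<close> holds the untransmitted demands, \<open>mt\<close> marks the matched flows,
  \<open>bi\<close> and \<open>bo\<close> the busy input and output ports; \<open>dl\<close> is the length of the round (0 while nothing is
  matched).
\<close>

definition select_flow :: prog where
  "select_flow =
     PSeq (PWrite ''mt'' flow_exp (Const 0))
       (PCond (Conj (Less (Const 0) (Read ''d'' flow_exp))
                (Conj (Less (Read ''bi'' (scalar ''i'')) (Const 1))
                      (Less (Read ''bo'' (scalar ''j'')) (Const 1))))
         (PSeq (PWrite ''mt'' flow_exp (Const 1))
         (PSeq (PWrite ''bi'' (scalar ''i'') (Const 1))
         (PSeq (PWrite ''bo'' (scalar ''j'') (Const 1))
            (PCond (Conj (Less (Const 0) (scalar ''dl'')) (Neg (Less (Read ''d'' flow_exp) (scalar ''dl''))))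
               PSkip
               (PWrite ''dl'' (Const 0) (Read ''d'' flow_exp))))))
         PSkip)"

text \<open>\<open>X\<close> is the set of selected flows among the inspected flows \<open>Z\<close>, given as (position, source, destination).\<close>

definition selection ::
  "(nat \<Rightarrow> nat) \<Rightarrow> (nat \<Rightarrow> nat \<Rightarrow> nat \<Rightarrow> nat) \<Rightarrow> (nat \<times> nat \<times> nat) set \<Rightarrow> (nat \<times> nat \<times> nat) set \<Rightarrow>
   nat \<Rightarrow> bool" where
  "selection \<sigma> rem Z X \<delta> \<longleftrightarrow>
     X \<subseteq> Z \<and>
     (\<forall>q i j. (q, i, j) \<in> X \<longrightarrow> 0 < \<delta> \<and> \<delta> \<le> rem i j (\<sigma> q)) \<and>
     (\<forall>q q' i j j'. (q, i, j) \<in> X \<longrightarrow> (q', i, j') \<in> X \<longrightarrow> q' = q \<and> j' = j) \<and>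
     (\<forall>q q' i i' j. (q, i, j) \<in> X \<longrightarrow> (q', i', j) \<in> X \<longrightarrow> q' = q \<and> i' = i) \<and>
     (\<forall>q i j. (q, i, j) \<in> Z \<longrightarrow> 0 < rem i j (\<sigma> q) \<longrightarrow>
        (\<exists>q' i' j'. (q', i', j') \<in> X \<and> q' \<le> q \<and> (i' = i \<or> j' = j))) \<and>
     (X \<noteq> {} \<longrightarrow> (\<exists>q i j. (q, i, j) \<in> X \<and> rem i j (\<sigma> q) = \<delta>)) \<and>
     (X = {} \<longrightarrow> \<delta> = 0)"

text \<open>The new length is the minimum of the old one and the added flow, with 0 in the role of
  the empty minimum; the conditional mirrors the branch in the program.\<close>

lemma selection_insert_selected:
  assumes sel: "selection \<sigma> rem Z X \<delta>" and pos: "0 < rem i j (\<sigma> q)"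
    and free: "\<And>q' j'. (q', i, j') \<notin> X" "\<And>q' i'. (q', i', j) \<notin> X"
  shows "selection \<sigma> rem (insert (q, i, j) Z) (insert (q, i, j) X)
           (if 0 < \<delta> \<and> \<not> rem i j (\<sigma> q) < \<delta> then \<delta> else rem i j (\<sigma> q))"
    (is "selection _ _ ?Z ?X ?\<delta>")
proof -
  note * = sel[unfolded selection_def]
  note ** = *[THEN conjunct2] *[THEN conjunct2, THEN conjunct2]
    *[THEN conjunct2, THEN conjunct2, THEN conjunct2]
    *[THEN conjunct2, THEN conjunct2, THEN conjunct2, THEN conjunct2]
    *[THEN conjunct2, THEN conjunct2, THEN conjunct2, THEN conjunct2, THEN conjunct2]
  have f1: "?X \<subseteq> ?Z" using *[THEN conjunct1] by auto
  have f2: "\<forall>q' i' j'. (q', i', j') \<in> ?X \<longrightarrow> 0 < ?\<delta> \<and> ?\<delta> \<le> rem i' j' (\<sigma> q')"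
  proof (intro allI impI)
    fix q' i' j' assume "(q', i', j') \<in> ?X"
    then consider "(q', i', j') = (q, i, j)" | "(q', i', j') \<in> X" by auto
    then show "0 < ?\<delta> \<and> ?\<delta> \<le> rem i' j' (\<sigma> q')"
    proof cases
      case 2
      from **(1)[THEN conjunct1, rule_format, OF this] pos show ?thesis by auto
    qed (use pos in auto)
  qed
  have f3: "\<forall>q1 q2 i' j1 j2. (q1, i', j1) \<in> ?X \<longrightarrow> (q2, i', j2) \<in> ?X \<longrightarrow> q2 = q1 \<and> j2 = j1"
    using **(2)[THEN conjunct1] free(1) by (auto simp: insert_iff)
  have f4: "\<forall>q1 q2 i1 i2 j'. (q1, i1, j') \<in> ?X \<longrightarrow> (q2, i2, j') \<in> ?X \<longrightarrow> q2 = q1 \<and> i2 = i1"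
    using **(3)[THEN conjunct1] free(2) by (auto simp: insert_iff)
  have f5: "\<forall>q' i' j'. (q', i', j') \<in> ?Z \<longrightarrow> 0 < rem i' j' (\<sigma> q') \<longrightarrow>
      (\<exists>q2 i2 j2. (q2, i2, j2) \<in> ?X \<and> q2 \<le> q' \<and> (i2 = i' \<or> j2 = j'))"
  proof (intro allI impI)
    fix q' i' j' assume Z: "(q', i', j') \<in> ?Z" and r: "0 < rem i' j' (\<sigma> q')"
    from Z consider "(q', i', j') = (q, i, j)" | "(q', i', j') \<in> Z" by auto
    then show "\<exists>q2 i2 j2. (q2, i2, j2) \<in> ?X \<and> q2 \<le> q' \<and> (i2 = i' \<or> j2 = j')"
    proof cases
      case 1 then show ?thesis by (intro exI[of _ q] exI[of _ i] exI[of _ j]) auto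
    next
      case 2
      from **(4)[THEN conjunct1, rule_format, OF this r] show ?thesis by auto
    qed
  qed
  have f6: "?X \<noteq> {} \<longrightarrow> (\<exists>q' i' j'. (q', i', j') \<in> ?X \<and> rem i' j' (\<sigma> q') = ?\<delta>)"
  proof (cases "0 < \<delta> \<and> \<not> rem i j (\<sigma> q) < \<delta>")
    case True
    then have "X \<noteq> {}" using **(5)[THEN conjunct2] by auto
    with **(5)[THEN conjunct1] True show ?thesis by auto
  qed auto
  have f7: "?X = {} \<longrightarrow> ?\<delta> = 0" by blast
  show ?thesis
    unfolding selection_def
    by (rule conjI[OF f1 conjI[OF f2 conjI[OF f3 conjI[OF f4 conjI[OF f5 conjI[OF f6 f7]]]]]])
qed

lemma selection_insert_rejected:
  assumes sel: "selection \<sigma> rem Z X \<delta>"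
    and blocked: "0 < rem i j (\<sigma> q) \<Longrightarrow> \<exists>q' i' j'. (q', i', j') \<in> X \<and> q' \<le> q \<and> (i' = i \<or> j' = j)"
  shows "selection \<sigma> rem (insert (q, i, j) Z) X \<delta>"
proof -
  have "\<forall>q' i' j'. (q', i', j') \<in> insert (q, i, j) Z \<longrightarrow> 0 < rem i' j' (\<sigma> q') \<longrightarrow>
      (\<exists>q2 i2 j2. (q2, i2, j2) \<in> X \<and> q2 \<le> q' \<and> (i2 = i' \<or> j2 = j'))"
    using sel blocked by (simp add: selection_def)
  then show ?thesis using sel unfolding selection_def by (intro conjI) auto
qed

definition matching_inv ::
  "nat \<Rightarrow> (nat \<Rightarrow> nat) \<Rightarrow> (nat \<Rightarrow> nat \<Rightarrow> nat \<Rightarrow> nat) \<Rightarrow> (nat \<times> nat \<times> nat) set \<Rightarrow> (nat \<times> nat \<times> nat) set \<Rightarrow>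
   state \<Rightarrow> bool" where
  "matching_inv N \<sigma> rem Z X t \<longleftrightarrow>
     selection \<sigma> rem Z X (t ''dl'' 0) \<and>
     (\<forall>q i j. (q, i, j) \<in> Z \<longrightarrow> t ''mt'' (cell N i j (\<sigma> q)) = (if (q, i, j) \<in> X then 1 else 0)) \<and>
     (\<forall>i<N. t ''bi'' i = (if \<exists>q j. (q, i, j) \<in> X then 1 else 0)) \<and>
     (\<forall>j<N. t ''bo'' j = (if \<exists>q i. (q, i, j) \<in> X then 1 else 0))"

text \<open>Injectivity of \<open>ord\<close> gives distinct flows distinct cells, so marking one
  keeps the other marks; each visit first clears the mark left by the previous round. A rejected
  flow with demand left meets a busy port, and the flow occupying it was visited before and so has
  no lower priority.\<close>

lemma run_select_flows:
  assumes N: "s ''N'' 0 = N" "s ''n'' 0 = n"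
    and inj: "inj_on (s ''ord'') {..<n}"
    and init: "\<And>i. i < N \<Longrightarrow> s ''bi'' i = 0" "\<And>j. j < N \<Longrightarrow> s ''bo'' j = 0" "s ''dl'' 0 = 0"
  shows "\<exists>X. matching_inv N (s ''ord'') (\<lambda>i j k. s ''d'' (cell N i j k)) (flow_box n N) X
           (run (all_flows select_flow) s)" (is "\<exists>X. matching_inv N ?\<sigma> ?rem _ X _")
proof (rule run_all_flows[where n = n and N = N and J = "\<lambda>Z t. \<exists>X. matching_inv N ?\<sigma> ?rem Z X t"])
  show "\<exists>X. matching_inv N ?\<sigma> ?rem {} X s"
    using init by (intro exI[of _ "{}"]) (simp add: matching_inv_def selection_def)
  show "\<exists>X. matching_inv N ?\<sigma> ?rem Z X (upd t x 0 v)"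
    if "x \<in> {''q'', ''i'', ''j''}" "\<exists>X. matching_inv N ?\<sigma> ?rem Z X t" for Z t x v
  proof -
    have "matching_inv N ?\<sigma> ?rem Z X (upd t x 0 v) = matching_inv N ?\<sigma> ?rem Z X t" for X
      using that(1) unfolding matching_inv_def by (elim insertE) (simp_all add: upd_other)
    then show ?thesis using that(2) by simp
  qed
  show "writes select_flow \<inter> {''N'', ''n'', ''q'', ''i'', ''j''} = {}"
    by (simp add: select_flow_def)
  fix Z q i j t
  assume qij: "q < n" "i < N" "j < N" and Z: "Z \<subseteq> flow_box n N" "(q, i, j) \<notin> Z"
    and le: "\<And>q' i' j'. (q', i', j') \<in> Z \<Longrightarrow> q' \<le> q"
    and inv: "\<exists>X. matching_inv N ?\<sigma> ?rem Z X t"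
    and fr: "\<And>y. y \<notin> writes (all_flows select_flow) \<Longrightarrow> t y = s y"
    and vars: "t ''q'' 0 = q" "t ''i'' 0 = i" "t ''j'' 0 = j"
  from inv obtain X where sel: "selection ?\<sigma> ?rem Z X (t ''dl'' 0)"
    and mt: "\<And>q i j. (q, i, j) \<in> Z \<Longrightarrow> t ''mt'' (cell N i j (?\<sigma> q)) = (if (q, i, j) \<in> X then 1 else 0)"
    and bi: "\<And>i. i < N \<Longrightarrow> t ''bi'' i = (if \<exists>q j. (q, i, j) \<in> X then 1 else 0)"
    and bo: "\<And>j. j < N \<Longrightarrow> t ''bo'' j = (if \<exists>q i. (q, i, j) \<in> X then 1 else 0)"
    unfolding matching_inv_def by (elim exE conjE) blast
  have XZ: "X \<subseteq> Z" using sel by (simp add: selection_def)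
  have t: "t ''N'' 0 = N" "t ''ord'' = ?\<sigma>" "t ''d'' = s ''d''"
    using fr[of "''N''"] fr[of "''ord''"] fr[of "''d''"] N by (simp_all add: select_flow_def)
  let ?c = "cell N i j (?\<sigma> q)" and ?r = "?rem i j (?\<sigma> q)"
  let ?t = "run select_flow t"
  define B where "B \<longleftrightarrow> 0 < ?r \<and> t ''bi'' i < 1 \<and> t ''bo'' j < 1"
  have mt': "?t ''mt'' a = (if a = ?c then (if B then 1 else 0) else t ''mt'' a)" for a
    by (simp add: select_flow_def B_def aval_cell_exp upd_apply t vars)
  have bi': "?t ''bi'' a = (if B \<and> a = i then 1 else t ''bi'' a)" for a
    by (simp add: select_flow_def B_def aval_cell_exp upd_apply t vars)
  have bo': "?t ''bo'' a = (if B \<and> a = j then 1 else t ''bo'' a)" for a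
    by (simp add: select_flow_def B_def aval_cell_exp upd_apply t vars)
  have dl': "?t ''dl'' 0 = (if B then if 0 < t ''dl'' 0 \<and> \<not> ?r < t ''dl'' 0 then t ''dl'' 0 else ?r
      else t ''dl'' 0)"
    by (simp add: select_flow_def B_def aval_cell_exp upd_apply t vars)
  have old: "cell N i' j' (?\<sigma> q') \<noteq> ?c" if "(q', i', j') \<in> Z" for q' i' j'
  proof
    assume eq: "cell N i' j' (?\<sigma> q') = ?c"
    have b: "q' < n" "i' < N" "j' < N" using that Z(1) by (auto simp: flow_box_def)
    with eq qij have "i' = i" "j' = j" "?\<sigma> q' = ?\<sigma> q" by (auto simp: cell_inject)
    moreover from this have "q' = q" using inj b(1) qij(1) by (auto dest: inj_onD)
    ultimately show False using that Z(2) by simp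
  qed
  show "\<exists>X. matching_inv N ?\<sigma> ?rem (insert (q, i, j) Z) X ?t"
  proof (cases B)
    case True
    have free: "(q', i, j') \<notin> X" "(q', i', j) \<notin> X" for q' i' j'
      using True bi[OF qij(2)] bo[OF qij(3)] by (auto simp: B_def split: if_splits)
    have "selection ?\<sigma> ?rem (insert (q, i, j) Z) (insert (q, i, j) X) (?t ''dl'' 0)"
      using selection_insert_selected[OF sel _ free, of q] True
      by (simp add: dl' B_def del: not_less split del: if_split)
    then have "matching_inv N ?\<sigma> ?rem (insert (q, i, j) Z) (insert (q, i, j) X) ?t"
      unfolding matching_inv_def
      using mt bi bo old Z(2) True by (auto simp: mt' bi' bo')
    then show ?thesis by blast
  next
    case False
    have "selection ?\<sigma> ?rem (insert (q, i, j) Z) X (?t ''dl'' 0)"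
    proof -
      have "\<exists>q' i' j'. (q', i', j') \<in> X \<and> q' \<le> q \<and> (i' = i \<or> j' = j)" if "0 < ?r"
      proof -
        from that False consider "\<exists>q' j'. (q', i, j') \<in> X" | "\<exists>q' i'. (q', i', j) \<in> X"
          using bi[OF qij(2)] bo[OF qij(3)] by (auto simp: B_def split: if_splits)
        then show ?thesis using le XZ by cases blast+
      qed
      from selection_insert_rejected[where rem = ?rem, OF sel this] show ?thesis
        using False by (simp add: dl')
    qed
    then have "matching_inv N ?\<sigma> ?rem (insert (q, i, j) Z) X ?t"
      unfolding matching_inv_def
      using mt bi bo old Z(2) XZ False by (auto simp: mt' bi' bo')
    then show ?thesis by blast
  qed
qed (use N in auto)

section \<open>Sending the matched flows\<close>

definition transmit_flow :: prog where
  "transmit_flow =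
     PCond (Less (Const 0) (Read ''mt'' flow_exp))
       (PSeq (PWrite ''src'' (scalar ''len'') (scalar ''i''))
       (PSeq (PWrite ''dst'' (scalar ''len'') (scalar ''j''))
       (PSeq (PWrite ''coflow'' (scalar ''len'') (Read ''ord'' (scalar ''q'')))
       (PSeq (PWrite ''start'' (scalar ''len'') (scalar ''T''))
       (PSeq (PWrite ''stop'' (scalar ''len'') (Add (scalar ''T'') (scalar ''dl'')))
       (PSeq (PWrite ''len'' (Const 0) (Add (scalar ''len'') (Const 1)))
             (PWrite ''d'' flow_exp (Sub (Read ''d'' flow_exp) (scalar ''dl'')))))))))
       PSkip"

text \<open>The condition under which \<open>output_schedule\<close> sets the rate to 1, as a
  predicate on states.\<close>

definition active :: "state \<Rightarrow> nat \<Rightarrow> nat \<Rightarrow> nat \<Rightarrow> real \<Rightarrow> bool" where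
  "active s i j k t \<longleftrightarrow>
     (\<exists>r < s ''len'' 0. s ''src'' r = i \<and> s ''dst'' r = j \<and> s ''coflow'' r = k \<and>
        real (s ''start'' r) \<le> t \<and> t < real (s ''stop'' r))"

lemma active_cong:
  assumes "t ''len'' 0 = s ''len'' 0" "t ''src'' = s ''src''" "t ''dst'' = s ''dst''"
    "t ''coflow'' = s ''coflow''" "t ''start'' = s ''start''" "t ''stop'' = s ''stop''"
  shows "active t = active s"
  using assms by (simp add: active_def fun_eq_iff)

text \<open>\<open>T\<close> and \<open>dl\<close> stay fixed during the pass, so all matched flows
  receive the same interval. Each cell belongs to one visited flow only and is therefore reduced at
  most once.\<close>

lemma run_transmit_flows:
  assumes N: "s ''N'' 0 = N" "s ''n'' 0 = n"
    and inj: "inj_on (s ''ord'') {..<n}"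
    and X: "X \<subseteq> flow_box n N"
    and mt: "\<forall>q i j. (q, i, j) \<in> flow_box n N \<longrightarrow>
        s ''mt'' (cell N i j (s ''ord'' q)) = (if (q, i, j) \<in> X then 1 else 0)"
  defines "s' \<equiv> run (all_flows transmit_flow) s"
  shows "active s' i j k t \<longleftrightarrow> active s i j k t \<or>
      (\<exists>q. (q, i, j) \<in> X \<and> k = s ''ord'' q \<and>
         real (s ''T'' 0) \<le> t \<and> t < real (s ''T'' 0 + s ''dl'' 0))"
    and "(q, i, j) \<in> flow_box n N \<Longrightarrow> s' ''d'' (cell N i j (s ''ord'' q)) =
      s ''d'' (cell N i j (s ''ord'' q)) - (if (q, i, j) \<in> X then s ''dl'' 0 else 0)"
proof -
  let ?\<sigma> = "s ''ord''"
  let ?J = "\<lambda>Z s'. (\<forall>i j k t. active s' i j k t \<longleftrightarrow> active s i j k t \<or>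
      (\<exists>q. (q, i, j) \<in> X \<inter> Z \<and> k = ?\<sigma> q \<and>
         real (s ''T'' 0) \<le> t \<and> t < real (s ''T'' 0 + s ''dl'' 0))) \<and>
    (\<forall>q i j. (q, i, j) \<in> flow_box n N \<longrightarrow> s' ''d'' (cell N i j (?\<sigma> q)) =
      s ''d'' (cell N i j (?\<sigma> q)) - (if (q, i, j) \<in> X \<inter> Z then s ''dl'' 0 else 0))"
  have "?J (flow_box n N) s'"
    unfolding s'_def
  proof (rule run_all_flows[where n = n and N = N and J = ?J])
    show "?J {} s" by simp
    show "?J Z (upd t x 0 v)" if "x \<in> {''q'', ''i'', ''j''}" "?J Z t" for Z t x v
    proof -
      have "active (upd t x 0 v) = active t"
        using that(1) by (intro active_cong) (auto simp: upd_def)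
      moreover have "upd t x 0 v ''d'' = t ''d''" using that(1) by (auto simp: upd_def)
      ultimately show ?thesis using that(2) by simp
    qed
    show "writes transmit_flow \<inter> {''N'', ''n'', ''q'', ''i'', ''j''} = {}"
      by (simp add: transmit_flow_def)
    fix Z q i j t
    assume qij: "q < n" "i < N" "j < N" and Z: "Z \<subseteq> flow_box n N" "(q, i, j) \<notin> Z"
      and J: "?J Z t"
      and fr: "\<And>y. y \<notin> writes (all_flows transmit_flow) \<Longrightarrow> t y = s y"
      and vars: "t ''q'' 0 = q" "t ''i'' 0 = i" "t ''j'' 0 = j"
    have t: "t ''N'' 0 = N" "t ''ord'' = ?\<sigma>" "t ''mt'' = s ''mt''" "t ''T'' = s ''T''" "t ''dl'' = s ''dl''"
      using fr[of "''N''"] fr[of "''ord''"] fr[of "''mt''"] fr[of "''T''"] fr[of "''dl''"] N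
      by (simp_all add: transmit_flow_def)
    have box: "(q, i, j) \<in> flow_box n N" using qij by (simp add: flow_box_def)
    let ?c = "cell N i j (?\<sigma> q)"
    let ?t = "run transmit_flow t"
    have mtc: "t ''mt'' ?c = (if (q, i, j) \<in> X then 1 else 0)" using mt[rule_format, OF box] t by simp
    show "?J (insert (q, i, j) Z) ?t"
    proof (cases "(q, i, j) \<in> X")
      case False
      then have "?t = t" using mtc by (simp add: transmit_flow_def aval_cell_exp t vars)
      moreover have "X \<inter> insert (q, i, j) Z = X \<inter> Z" using False by auto
      ultimately show ?thesis using J by simp
    next
      case True
      have new: "active ?t i' j' k' t' \<longleftrightarrow> active t i' j' k' t' \<or>
          (i' = i \<and> j' = j \<and> k' = ?\<sigma> q \<and> real (s ''T'' 0) \<le> t' \<and> t' < real (s ''T'' 0 + s ''dl'' 0))"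
        for i' j' k' t'
      proof -
        \<comment> \<open>The new transmission is stored at index \<open>len\<close> before
          \<open>len\<close> grows, so it is the only index added and the older entries are
          untouched.\<close>
        have last: "(\<exists>r<Suc L. Q r) \<longleftrightarrow> (\<exists>r<L. Q r) \<or> Q L" for Q L
          by (auto simp: less_Suc_eq)
        show ?thesis
          using mtc True
          by (simp add: active_def transmit_flow_def aval_cell_exp t vars upd_apply last cong: conj_cong)
             (auto simp: t)
      qed
      have d: "?t ''d'' a = (if a = ?c then t ''d'' a - s ''dl'' 0 else t ''d'' a)" for a
        using mtc True by (simp add: transmit_flow_def aval_cell_exp t vars upd_apply)
      have inter: "(q', i', j') \<in> X \<inter> insert (q, i, j) Z \<longleftrightarrow>
          (q', i', j') = (q, i, j) \<or> (q', i', j') \<in> X \<inter> Z" for q' i' j'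
        using True by auto
      have same: "cell N i' j' (?\<sigma> q') = ?c \<longleftrightarrow> (q', i', j') = (q, i, j)"
        if "(q', i', j') \<in> flow_box n N" for q' i' j'
        using that qij inj by (auto simp: flow_box_def cell_inject dest: inj_onD)
      show ?thesis
      proof (intro conjI allI impI)
        fix i' j' k' t'
        show "active ?t i' j' k' t' \<longleftrightarrow> active s i' j' k' t' \<or>
            (\<exists>q'. (q', i', j') \<in> X \<inter> insert (q, i, j) Z \<and> k' = ?\<sigma> q' \<and>
              real (s ''T'' 0) \<le> t' \<and> t' < real (s ''T'' 0 + s ''dl'' 0))"
          unfolding new inter using J[THEN conjunct1, rule_format, of i' j' k' t'] by auto
      next
        fix q' i' j' assume b: "(q', i', j') \<in> flow_box n N"
        show "?t ''d'' (cell N i' j' (?\<sigma> q')) = s ''d'' (cell N i' j' (?\<sigma> q')) -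
            (if (q', i', j') \<in> X \<inter> insert (q, i, j) Z then s ''dl'' 0 else 0)"
          unfolding d inter same[OF b] using J[THEN conjunct2, rule_format, OF b] Z(2) by auto
      qed
    qed
  qed (use N in auto)
  moreover have "X \<inter> flow_box n N = X" using X by auto
  ultimately show "active s' i j k t \<longleftrightarrow> active s i j k t \<or>
      (\<exists>q. (q, i, j) \<in> X \<and> k = s ''ord'' q \<and>
         real (s ''T'' 0) \<le> t \<and> t < real (s ''T'' 0 + s ''dl'' 0))"
    and "(q, i, j) \<in> flow_box n N \<Longrightarrow> s' ''d'' (cell N i j (s ''ord'' q)) =
      s ''d'' (cell N i j (s ''ord'' q)) - (if (q, i, j) \<in> X then s ''dl'' 0 else 0)"
    by simp_all
qed

definition greedy_round :: prog where
  "greedy_round =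
     PSeq (PFor ''i'' (scalar ''N'')
            (PSeq (PWrite ''bi'' (scalar ''i'') (Const 0)) (PWrite ''bo'' (scalar ''i'') (Const 0))))
     (PSeq (PWrite ''dl'' (Const 0) (Const 0))
     (PSeq (all_flows select_flow)
     (PSeq (all_flows transmit_flow)
           (PWrite ''T'' (Const 0) (Add (scalar ''T'') (scalar ''dl''))))))"

text \<open>Each round finishes a flow as long as one is left, so as many rounds as there are flows
  suffice. Surplus rounds match nothing and have length 0.\<close>

definition greedy_phase :: prog where
  "greedy_phase = PFor ''a'' (Mul (scalar ''n'') (Mul (scalar ''N'') (scalar ''N''))) greedy_round"

definition unfinished :: "nat \<Rightarrow> nat \<Rightarrow> (nat \<Rightarrow> nat) \<Rightarrow> (nat \<Rightarrow> nat \<Rightarrow> nat \<Rightarrow> nat) \<Rightarrow> (nat \<times> nat \<times> nat) set" where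
  "unfinished N n \<sigma> rem = {(q, i, j) \<in> flow_box n N. 0 < rem i j (\<sigma> q)}"

lemma finite_flow_box: "finite (flow_box n N)"
  by (simp add: flow_box_def)

lemma run_greedy_round:
  assumes N: "s ''N'' 0 = N" "s ''n'' 0 = n"
    and bij: "bij_betw (s ''ord'') {..<n} {..<n}"
    and inv: "greedy_inv N n (s ''ord'') dem (s ''T'' 0) (\<lambda>i j k. s ''d'' (cell N i j k)) (active s)"
  defines "s' \<equiv> run greedy_round s"
  shows "greedy_inv N n (s ''ord'') dem (s' ''T'' 0) (\<lambda>i j k. s' ''d'' (cell N i j k)) (active s')"
    and "card (unfinished N n (s ''ord'') (\<lambda>i j k. s' ''d'' (cell N i j k))) \<le>
         card (unfinished N n (s ''ord'') (\<lambda>i j k. s ''d'' (cell N i j k))) - 1"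
proof -
  let ?\<sigma> = "s ''ord''" and ?rem = "\<lambda>i j k. s ''d'' (cell N i j k)"
  let ?reset = "PFor ''i'' (scalar ''N'')
            (PSeq (PWrite ''bi'' (scalar ''i'') (Const 0)) (PWrite ''bo'' (scalar ''i'') (Const 0)))"
  define s1 where "s1 = upd (run ?reset s) ''dl'' 0 0"
  define s2 where "s2 = run (all_flows select_flow) s1"
  define s3 where "s3 = run (all_flows transmit_flow) s2"
  have s': "s' = upd s3 ''T'' 0 (s3 ''T'' 0 + s3 ''dl'' 0)"
    by (simp add: s'_def greedy_round_def s1_def s2_def s3_def del: run.simps(5))
  have "\<forall>i<N. run ?reset s ''bi'' i = 0 \<and> run ?reset s ''bo'' i = 0"
  proof (rule run_For_invariant[where I = "\<lambda>k t. \<forall>i<k. t ''bi'' i = 0 \<and> t ''bo'' i = 0"])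
  qed (auto simp: upd_apply N less_Suc_eq)
  then have reset: "\<And>i. i < N \<Longrightarrow> s1 ''bi'' i = 0" "\<And>j. j < N \<Longrightarrow> s1 ''bo'' j = 0" "s1 ''dl'' 0 = 0"
    by (simp_all add: s1_def upd_apply)
  have fr1: "s1 y = s y" if "y \<notin> {''i'', ''bi'', ''bo'', ''dl''}" for y
    using that by (simp add: s1_def upd_other run_frame del: run.simps)
  have fr2: "s2 y = s1 y" if "y \<notin> writes (all_flows select_flow)" for y
    using that unfolding s2_def by (rule run_frame)
  have fr3: "s3 y = s2 y" if "y \<notin> writes (all_flows transmit_flow)" for y
    using that unfolding s3_def by (rule run_frame)
  have e1: "s1 ''N'' = s ''N''" "s1 ''n'' = s ''n''" "s1 ''ord'' = s ''ord''" "s1 ''d'' = s ''d''"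
    "s1 ''T'' = s ''T''" "active s1 = active s"
    by (auto intro!: fr1 active_cong simp: fr1)
  have e2: "s2 ''N'' = s ''N''" "s2 ''n'' = s ''n''" "s2 ''ord'' = s ''ord''" "s2 ''d'' = s ''d''"
    "s2 ''T'' = s ''T''" "active s2 = active s"
  proof -
    have "active s2 = active s1" by (intro active_cong) (simp_all add: fr2 select_flow_def)
    then show "active s2 = active s" using e1 by simp
  qed (use e1 in \<open>simp_all add: fr2 select_flow_def\<close>)
  have e3: "s3 ''T'' = s ''T''" "s3 ''dl'' = s2 ''dl''"
    using e2 by (simp_all add: fr3 transmit_flow_def)
  have inj: "inj_on ?\<sigma> {..<n}" using bij by (simp add: bij_betw_def)
  obtain X where X: "matching_inv N ?\<sigma> ?rem (flow_box n N) X s2"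
    using run_select_flows[of s1 N n] reset e1 N inj unfolding s2_def by auto
  define \<delta> where "\<delta> = s2 ''dl'' 0"
  have sel: "selection ?\<sigma> ?rem (flow_box n N) X \<delta>"
    and mt: "\<forall>q i j. (q, i, j) \<in> flow_box n N \<longrightarrow>
      s2 ''mt'' (cell N i j (?\<sigma> q)) = (if (q, i, j) \<in> X then 1 else 0)"
    using X unfolding matching_inv_def \<delta>_def by blast+
  note * = sel[unfolded selection_def]
  note ** = *[THEN conjunct2] *[THEN conjunct2, THEN conjunct2]
    *[THEN conjunct2, THEN conjunct2, THEN conjunct2]
    *[THEN conjunct2, THEN conjunct2, THEN conjunct2, THEN conjunct2]
    *[THEN conjunct2, THEN conjunct2, THEN conjunct2, THEN conjunct2, THEN conjunct2]
  note Xsub = *[THEN conjunct1]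
  note Xrem = **(1)[THEN conjunct1, rule_format]
  note Xin = **(2)[THEN conjunct1, rule_format]
  note Xout = **(3)[THEN conjunct1, rule_format]
  note Xblock = **(4)[THEN conjunct1, rule_format]
  note transmit = run_transmit_flows[of s2 N n X, folded s3_def, unfolded e2, OF N inj Xsub mt, folded \<delta>_def]
  let ?rem' = "\<lambda>i j k. s' ''d'' (cell N i j k)"
  have d': "?rem' i j (?\<sigma> q) = ?rem i j (?\<sigma> q) - (if (q, i, j) \<in> X then \<delta> else 0)"
    if "(q, i, j) \<in> flow_box n N" for q i j
    using transmit(2)[OF that] by (simp add: s' upd_other)
  have T': "s' ''T'' 0 = s ''T'' 0 + \<delta>" by (simp add: s' upd_apply e3 \<delta>_def)
  have act': "active s' i j k t \<longleftrightarrow> active s i j k t \<or>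
      (\<exists>q. (q, i, j) \<in> X \<and> k = ?\<sigma> q \<and> real (s ''T'' 0) \<le> t \<and> t < real (s ''T'' 0 + \<delta>))" for i j k t
  proof -
    have "active s' = active s3" by (intro active_cong) (simp_all add: s' upd_other)
    then show ?thesis using transmit(1) by simp
  qed
  \<comment> \<open>The matching \<open>X\<close> with coflow numbers in place of positions, as
    \<open>greedy_inv_round\<close> expects it.\<close>
  define Y where "Y = {(i, j, k). \<exists>q. (q, i, j) \<in> X \<and> k = ?\<sigma> q}"
  have Y_iff: "(i, j, ?\<sigma> q) \<in> Y \<longleftrightarrow> (q, i, j) \<in> X" if "q < n" for i j q
    using that Xsub inj by (auto simp: Y_def flow_box_def dest: inj_onD)
  have \<sigma>n: "?\<sigma> q < n" if "q < n" for q using bij that by (auto simp: bij_betw_def)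
  show "greedy_inv N n ?\<sigma> dem (s' ''T'' 0) ?rem' (active s')"
    unfolding T'
  proof (rule greedy_inv_round[OF inv bij, where X = Y])
    fix i j k assume "(i, j, k) \<in> Y"
    then obtain q where q: "(q, i, j) \<in> X" "k = ?\<sigma> q" by (auto simp: Y_def)
    then have "q < n" "i < N" "j < N" using Xsub by (auto simp: flow_box_def)
    then show "i < N \<and> j < N \<and> k < n \<and> \<delta> \<le> ?rem i j k \<and> 0 < ?rem i j k"
      using Xrem[OF q(1)] q \<sigma>n by auto
  next
    fix i j j' k k' assume "(i, j, k) \<in> Y" "(i, j', k') \<in> Y"
    then obtain q q' where q: "(q, i, j) \<in> X" "k = ?\<sigma> q" "(q', i, j') \<in> X" "k' = ?\<sigma> q'"
      by (auto simp: Y_def)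
    then show "j' = j \<and> k' = k" using Xin[OF q(1,3)] by simp
  next
    fix i i' j k k' assume "(i, j, k) \<in> Y" "(i', j, k') \<in> Y"
    then obtain q q' where q: "(q, i, j) \<in> X" "k = ?\<sigma> q" "(q', i', j) \<in> X" "k' = ?\<sigma> q'"
      by (auto simp: Y_def)
    then show "i' = i \<and> k' = k" using Xout[OF q(1,3)] by simp
  next
    fix q i j assume q: "q < n" "i < N" "j < N" "0 < ?rem i j (?\<sigma> q)"
    then have "(q, i, j) \<in> flow_box n N" by (simp add: flow_box_def)
    from Xblock[OF this q(4)] obtain p i' j' where
      p: "(p, i', j') \<in> X" "p \<le> q" "i' = i \<or> j' = j" by blast
    then have "(i', j', ?\<sigma> p) \<in> Y" by (auto simp: Y_def)
    with p show "\<exists>p\<le>q. \<exists>i' j'. (i', j', ?\<sigma> p) \<in> Y \<and> (i' = i \<or> j' = j)" by blast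
  next
    fix i j k assume ijk: "i < N" "j < N" "k < n"
    then obtain q where q: "q < n" "k = ?\<sigma> q" using bij by (auto simp: bij_betw_def)
    then have "(q, i, j) \<in> flow_box n N" using ijk by (simp add: flow_box_def)
    from d'[OF this] show "?rem' i j k = ?rem i j k - (if (i, j, k) \<in> Y then \<delta> else 0)"
      using Y_iff[OF q(1)] q by simp
  next
    fix i j k t
    show "active s' i j k t \<longleftrightarrow> active s i j k t \<or>
        (i, j, k) \<in> Y \<and> real (s ''T'' 0) \<le> t \<and> t < real (s ''T'' 0 + \<delta>)"
      unfolding act' Y_def by auto
  qed
  let ?U = "unfinished N n ?\<sigma> ?rem" and ?U' = "unfinished N n ?\<sigma> ?rem'"
  have sub: "?U' \<subseteq> ?U" using d' by (auto simp: unfinished_def)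
  have fin: "finite ?U" using finite_flow_box[of n N] by (auto simp: unfinished_def intro: finite_subset)
  show "card ?U' \<le> card ?U - 1"
  proof (cases "?U = {}")
    case True
    then show ?thesis using sub by simp
  next
    case False
    then obtain q i j where "(q, i, j) \<in> flow_box n N" "0 < ?rem i j (?\<sigma> q)"
      by (auto simp: unfinished_def)
    \<comment> \<open>An unfinished flow forces a nonempty matching. Its shortest member has exactly
      \<open>\<delta>\<close> left, so this round finishes it.\<close>
    from Xblock[OF this] have "X \<noteq> {}" by auto
    then obtain q i j where x: "(q, i, j) \<in> X" "?rem i j (?\<sigma> q) = \<delta>"
      using **(5)[THEN conjunct1] by blast
    then have box: "(q, i, j) \<in> flow_box n N" using Xsub by auto
    then have "(q, i, j) \<in> ?U" using Xrem[OF x(1)] x by (auto simp: unfinished_def)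
    moreover have "(q, i, j) \<notin> ?U'" using d'[OF box] x by (simp add: unfinished_def)
    ultimately have "?U' \<subset> ?U" using sub by auto
    from psubset_card_mono[OF fin this] show ?thesis by linarith
  qed
qed

lemma run_greedy_phase:
  assumes N: "s ''N'' 0 = N" "s ''n'' 0 = n"
    and bij: "bij_betw (s ''ord'') {..<n} {..<n}"
    and init: "s ''T'' 0 = 0" "s ''len'' 0 = 0"
    and dem: "\<And>i j k. i < N \<Longrightarrow> j < N \<Longrightarrow> k < n \<Longrightarrow> s ''d'' (cell N i j k) = dem i j k"
  defines "s' \<equiv> run greedy_phase s"
  shows "\<exists>rem T. greedy_inv N n (s ''ord'') dem T rem (active s') \<and>
    (\<forall>i<N. \<forall>j<N. \<forall>k<n. rem i j k = 0)"
proof -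
  let ?\<sigma> = "s ''ord''"
  let ?rem = "\<lambda>t i j k. t ''d'' (cell N i j k)"
  let ?I = "\<lambda>a t. greedy_inv N n ?\<sigma> dem (t ''T'' 0) (?rem t) (active t) \<and>
      card (unfinished N n ?\<sigma> (?rem t)) \<le> n * (N * N) - a"
  have "?I (n * (N * N)) s'"
    unfolding s'_def greedy_phase_def
  proof (rule run_For_invariant[where I = ?I])
    have "greedy_inv N n ?\<sigma> dem 0 dem (active s)"
      by (rule greedy_inv_init) (simp add: active_def init)
    \<comment> \<open>The array agrees with \<open>dem\<close> only at indices in range; since
      \<open>?\<sigma>\<close> permutes the coflows, the clauses of \<open>greedy_inv\<close> never
      leave that range.\<close>
    then have "greedy_inv N n ?\<sigma> dem 0 (?rem s) (active s)"
      using dem bij by (auto simp: greedy_inv_def prefix_load_def load_def bij_betw_def)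
    moreover have "card (unfinished N n ?\<sigma> (?rem s)) \<le> card (flow_box n N)"
      using finite_flow_box by (intro card_mono) (auto simp: unfinished_def)
    ultimately show "?I 0 s" by (simp add: init flow_box_def card_cartesian_product)
    have upd_a: "?I m (upd t ''a'' 0 v) = ?I m t" for m t v
    proof -
      have "active (upd t ''a'' 0 v) = active t" by (intro active_cong) (simp_all add: upd_other)
      then show ?thesis by (simp add: upd_other)
    qed
    show "?I (n * (N * N)) (upd t ''a'' 0 (aval (Mul (scalar ''n'') (Mul (scalar ''N'') (scalar ''N''))) s))"
      if "?I (aval (Mul (scalar ''n'') (Mul (scalar ''N'') (scalar ''N''))) s) t" for t
      unfolding upd_a using that by (simp add: N)
    fix a t
    assume a: "a < aval (Mul (scalar ''n'') (Mul (scalar ''N'') (scalar ''N''))) s" and I: "?I a t"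
      and fr: "\<And>y. y \<notin> writes (PFor ''a'' (Mul (scalar ''n'') (Mul (scalar ''N'') (scalar ''N''))) greedy_round)
        \<Longrightarrow> t y = s y"
    let ?t = "upd t ''a'' 0 a"
    have e: "?t ''N'' = s ''N''" "?t ''n'' = s ''n''" "?t ''ord'' = ?\<sigma>"
      using fr by (simp_all add: upd_other greedy_round_def select_flow_def transmit_flow_def)
    have I': "?I a ?t" unfolding upd_a by (rule I)
    from run_greedy_round[of ?t N n dem, unfolded e, OF N bij conjunct1[OF I']] conjunct2[OF I']
    show "?I (Suc a) (run greedy_round ?t)" by auto
  qed
  then have inv: "greedy_inv N n ?\<sigma> dem (s' ''T'' 0) (?rem s') (active s')"
    and "card (unfinished N n ?\<sigma> (?rem s')) = 0" by auto
  moreover have "finite (unfinished N n ?\<sigma> (?rem s'))"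
    by (rule finite_subset[OF _ finite_flow_box[of n N]]) (auto simp: unfinished_def)
  ultimately have "unfinished N n ?\<sigma> (?rem s') = {}" by simp
  then have z: "?rem s' i j (?\<sigma> q) = 0" if "i < N" "j < N" "q < n" for i j q
    using that by (auto simp: unfinished_def flow_box_def)
  have "?rem s' i j k = 0" if "i < N" "j < N" "k < n" for i j k
  proof -
    have "k \<in> ?\<sigma> ` {..<n}" using that bij by (simp add: bij_betw_def)
    then show ?thesis using z that by auto
  qed
  with inv show ?thesis by (intro exI conjI allI impI)
qed

section \<open>The ordering phase\<close>

text \<open>
  Positions below \<open>r\<close> of \<open>ord\<close> hold the coflows that are not yet placed; \<open>bmu\<close> is the bottleneck port and
  \<open>pw\<close> holds the loads of all coflows at it.
\<close>

definition sum_load :: prog where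
  "sum_load =
     PSeq (PWrite ''t'' (Const 0) (Const 0))
       (PFor ''j'' (scalar ''N'')
         (PCond (Less (scalar ''mu'') (scalar ''N''))
           (PWrite ''t'' (Const 0) (Add (scalar ''t'')
              (Read ''d'' (cell_exp (scalar ''mu'') (scalar ''j'') (scalar ''k'')))))
           (PWrite ''t'' (Const 0) (Add (scalar ''t'')
              (Read ''d'' (cell_exp (scalar ''j'') (Sub (scalar ''mu'') (scalar ''N'')) (scalar ''k'')))))))"

lemma writes_sum_load: "writes sum_load = {''t'', ''j''}"
  by (auto simp: sum_load_def)

definition state_load :: "state \<Rightarrow> nat \<Rightarrow> nat \<Rightarrow> nat" where
  "state_load s = load (s ''N'' 0) (\<lambda>i j k. s ''d'' (cell (s ''N'' 0) i j k))"

lemma state_load_cong: "t ''N'' = s ''N'' \<Longrightarrow> t ''d'' = s ''d'' \<Longrightarrow> state_load t = state_load s"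
  by (simp add: state_load_def)

lemma run_sum_load: "run sum_load s ''t'' 0 = state_load s (s ''mu'' 0) (s ''k'' 0)"
proof -
  let ?N = "s ''N'' 0" and ?\<mu> = "s ''mu'' 0" and ?k = "s ''k'' 0"
  let ?f = "\<lambda>i j k. s ''d'' (cell ?N i j k)"
  let ?g = "\<lambda>j. if ?\<mu> < ?N then ?f ?\<mu> j ?k else ?f j (?\<mu> - ?N) ?k"
  have "run sum_load s ''t'' 0 = (\<Sum>j<?N. ?g j)"
    unfolding sum_load_def run.simps(3) run.simps(2) aval.simps
  proof (rule run_For_invariant[where I = "\<lambda>m t. t ''t'' 0 = (\<Sum>j<m. ?g j)"], goal_cases)
    case 1
    then show ?case by (simp add: upd_apply)
  next
    case (2 m t)
    then have "t ''N'' = s ''N''" "t ''mu'' = s ''mu''" "t ''k'' = s ''k''" "t ''d'' = s ''d''"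
      by (simp_all add: upd_other)
    with 2(2) show ?case by (simp add: upd_apply aval_cell_exp)
  next
    case (3 t)
    then show ?case by (simp add: upd_apply)
  qed
  then show ?thesis by (simp add: state_load_def load_def)
qed

text \<open>Only the dimensions may bound a loop, whereas \<open>r\<close> changes from round to
  round. The loop therefore visits all positions and a guard selects those below
  \<open>r\<close>.\<close>

definition port_total :: prog where
  "port_total =
     PSeq (PWrite ''ld'' (Const 0) (Const 0))
       (PFor ''q'' (scalar ''n'')
         (PCond (Less (scalar ''q'') (scalar ''r''))
           (PSeq (PWrite ''k'' (Const 0) (Read ''ord'' (scalar ''q'')))
           (PSeq sum_load
                 (PWrite ''ld'' (Const 0) (Add (scalar ''ld'') (scalar ''t'')))))
           PSkip))"

lemma writes_port_total: "writes port_total = {''ld'', ''q'', ''k'', ''t'', ''j''}"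
  by (auto simp: port_total_def writes_sum_load)

lemma run_port_total:
  assumes "s ''r'' 0 \<le> s ''n'' 0"
  shows "run port_total s ''ld'' 0 = (\<Sum>q<s ''r'' 0. state_load s (s ''mu'' 0) (s ''ord'' q))"
proof -
  let ?g = "\<lambda>q. state_load s (s ''mu'' 0) (s ''ord'' q)"
  have "run port_total s ''ld'' 0 = (\<Sum>q<min (s ''n'' 0) (s ''r'' 0). ?g q)"
    unfolding port_total_def run.simps(3) run.simps(2) aval.simps
  proof (rule run_For_invariant[where I = "\<lambda>m t. t ''ld'' 0 = (\<Sum>q<min m (s ''r'' 0). ?g q)"], goal_cases)
    case 1
    then show ?case by (simp add: upd_apply)
  next
    case (2 m t)
    then have e: "t ''N'' = s ''N''" "t ''mu'' = s ''mu''" "t ''ord'' = s ''ord''" "t ''d'' = s ''d''"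
      "t ''r'' = s ''r''"
      by (simp_all add: upd_other writes_sum_load)
    have ld: "state_load (upd (upd t ''q'' 0 m) ''k'' 0 v) = state_load s" for v
      using e by (intro state_load_cong) (simp_all add: upd_other)
    show ?case
    proof (cases "m < s ''r'' 0")
      case True
      then have "min (Suc m) (s ''r'' 0) = Suc m" "min m (s ''r'' 0) = m" by auto
      then show ?thesis using True 2(2) e ld
        by (simp add: upd_apply run_sum_load run_frame writes_sum_load)
    next
      case False
      then have "min (Suc m) (s ''r'' 0) = s ''r'' 0" "min m (s ''r'' 0) = s ''r'' 0" by auto
      then show ?thesis using False 2(2) e by (simp add: upd_apply)
    qed
  next
    case (3 t)
    then show ?case by (simp add: upd_apply)
  qed
  then show ?thesis using assms by (simp add: min_def)
qed

definition bottleneck :: prog where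
  "bottleneck =
     PSeq (PWrite ''best'' (Const 0) (Const 0))
     (PSeq (PWrite ''bmu'' (Const 0) (Const 0))
       (PFor ''mu'' (Add (scalar ''N'') (scalar ''N''))
         (PSeq port_total
           (PCond (Less (scalar ''best'') (scalar ''ld''))
             (PSeq (PWrite ''best'' (Const 0) (scalar ''ld'')) (PWrite ''bmu'' (Const 0) (scalar ''mu'')))
             PSkip))))"

lemma writes_bottleneck:
  "writes bottleneck = {''best'', ''bmu'', ''mu'', ''ld'', ''q'', ''k'', ''t'', ''j''}"
  by (auto simp: bottleneck_def writes_port_total)

lemma run_bottleneck:
  assumes N: "0 < s ''N'' 0" and r: "s ''r'' 0 \<le> s ''n'' 0"
  defines "\<mu> \<equiv> run bottleneck s ''bmu'' 0"
  shows "\<mu> < 2 * s ''N'' 0"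
    and "\<nu> < 2 * s ''N'' 0 \<Longrightarrow> (\<Sum>q<s ''r'' 0. state_load s \<nu> (s ''ord'' q)) \<le>
           (\<Sum>q<s ''r'' 0. state_load s \<mu> (s ''ord'' q))"
proof -
  let ?S = "\<lambda>\<nu>. \<Sum>q<s ''r'' 0. state_load s \<nu> (s ''ord'' q)"
  let ?N = "2 * s ''N'' 0"
  \<comment> \<open>An inequality, not an equation, links \<open>best\<close> to the total at
    \<open>bmu\<close>: both start at 0, although port 0 may already have a positive total. If all
    totals are 0, port 0 stays selected and is a valid maximum.\<close>
  let ?I = "\<lambda>m t. t ''bmu'' 0 < ?N \<and> t ''best'' 0 \<le> ?S (t ''bmu'' 0) \<and> (\<forall>\<nu><m. ?S \<nu> \<le> t ''best'' 0)"
  have "?I ?N (run bottleneck s)"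
    unfolding bottleneck_def run.simps(3) run.simps(2) aval.simps
  proof (rule run_For_invariant[where I = ?I], goal_cases)
    case 1
    then show ?case using N by (simp add: upd_apply)
  next
    case (2 m t)
    then have e: "t ''N'' = s ''N''" "t ''ord'' = s ''ord''" "t ''d'' = s ''d''" "t ''r'' = s ''r''"
      "t ''n'' = s ''n''"
      by (simp_all add: upd_other writes_port_total)
    have m: "m < ?N" using 2(1) by (simp add: upd_apply)
    let ?t = "upd t ''mu'' 0 m"
    have "state_load ?t = state_load s" using e by (intro state_load_cong) (simp_all add: upd_other)
    then have "run port_total ?t ''ld'' 0 = ?S m"
      using e r by (simp add: run_port_total upd_apply)
    then show ?case using 2(2) m
      by (auto simp: upd_apply run_frame writes_port_total less_Suc_eq)
  next
    case (3 t)
    then show ?case by (simp add: upd_apply mult_2)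
  qed
  then have "\<mu> < ?N" "run bottleneck s ''best'' 0 \<le> ?S \<mu>" "\<forall>\<nu><?N. ?S \<nu> \<le> run bottleneck s ''best'' 0"
    unfolding \<mu>_def by auto
  then show "\<mu> < ?N" "\<nu> < ?N \<Longrightarrow> ?S \<nu> \<le> ?S \<mu>" by (auto intro: order_trans)
qed

definition port_loads :: prog where
  "port_loads =
     PSeq (PWrite ''mu'' (Const 0) (scalar ''bmu''))
       (PFor ''k'' (scalar ''n'') (PSeq sum_load (PWrite ''pw'' (scalar ''k'') (scalar ''t''))))"

lemma writes_port_loads: "writes port_loads = {''mu'', ''k'', ''t'', ''j'', ''pw''}"
  by (auto simp: port_loads_def writes_sum_load)

lemma run_port_loads:
  "k < s ''n'' 0 \<Longrightarrow> run port_loads s ''pw'' k = state_load s (s ''bmu'' 0) k"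
proof -
  let ?f = "state_load s (s ''bmu'' 0)"
  have "\<forall>k<s ''n'' 0. run port_loads s ''pw'' k = ?f k"
    unfolding port_loads_def run.simps(3) run.simps(2) aval.simps
  proof (rule run_For_invariant[where I = "\<lambda>m t. \<forall>k<m. t ''pw'' k = ?f k"], goal_cases)
    case 1
    then show ?case by simp
  next
    case (2 m t)
    have "t ''mu'' = upd s ''mu'' 0 (s ''bmu'' 0) ''mu''"
      by (rule 2(3)) (simp add: writes_sum_load)
    moreover from 2(3) have "t ''N'' = s ''N''" "t ''d'' = s ''d''"
      by (simp_all add: upd_other writes_sum_load)
    ultimately have "run sum_load (upd t ''k'' 0 m) ''t'' 0 = ?f m"
      using state_load_cong[of "upd t ''k'' 0 m" s] by (simp add: run_sum_load upd_apply upd_other)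
    then show ?case using 2(2)
      by (simp add: upd_apply run_frame writes_sum_load less_Suc_eq)
  next
    case (3 t)
    then show ?case by (simp add: upd_apply)
  qed
  then show "k < s ''n'' 0 \<Longrightarrow> run port_loads s ''pw'' k = ?f k" by simp
qed

definition select_last :: prog where
  "select_last =
     PSeq (PWrite ''b'' (Const 0) (Const 0))
       (PFor ''q'' (scalar ''n'')
         (PCond (Conj (Less (scalar ''q'') (scalar ''r''))
                  (Less (Mul (Read ''w'' (Read ''ord'' (scalar ''q''))) (Read ''pw'' (Read ''ord'' (scalar ''b''))))
                        (Mul (Read ''w'' (Read ''ord'' (scalar ''b''))) (Read ''pw'' (Read ''ord'' (scalar ''q''))))))
           (PWrite ''b'' (Const 0) (scalar ''q''))
           PSkip))"

lemma writes_select_last: "writes select_last = {''b'', ''q''}"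
  by (auto simp: select_last_def)

text \<open>
  Comparing ratios by cross multiplication is transitive along the scan even when loads or weights
  vanish, since a strict comparison forces the old weight and the new load to be positive.
\<close>

lemma cross_ratio_trans:
  fixes wb pb wk pk wc pc :: nat
  assumes "wb * pc \<le> wc * pb" "wk * pb < wb * pk"
  shows "wk * pc \<le> wc * pk"
proof -
  have wb: "0 < wb" using assms(2) by (cases wb) auto
  have "wb * (wk * pc) \<le> wk * (wc * pb)"
    using mult_left_mono[OF assms(1), of wk] by (simp add: mult_ac)
  also have "\<dots> \<le> wc * (wb * pk)"
    using mult_left_mono[OF less_imp_le[OF assms(2)], of wc] by (simp add: mult_ac)
  finally have "wb * (wk * pc) \<le> wb * (wc * pk)" by (simp add: mult_ac)
  then show ?thesis using wb by simp
qed

lemma run_select_last: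
  assumes r: "0 < s ''r'' 0" "s ''r'' 0 \<le> s ''n'' 0"
  defines "b \<equiv> run select_last s ''b'' 0"
  shows "b < s ''r'' 0"
    and "q < s ''r'' 0 \<Longrightarrow> s ''w'' (s ''ord'' b) * s ''pw'' (s ''ord'' q) \<le>
           s ''w'' (s ''ord'' q) * s ''pw'' (s ''ord'' b)"
proof -
  let ?W = "\<lambda>q. s ''w'' (s ''ord'' q)" and ?P = "\<lambda>q. s ''pw'' (s ''ord'' q)"
  let ?I = "\<lambda>m t. t ''b'' 0 < s ''r'' 0 \<and>
      (\<forall>q<m. q < s ''r'' 0 \<longrightarrow> ?W (t ''b'' 0) * ?P q \<le> ?W q * ?P (t ''b'' 0))"
  have "?I (s ''n'' 0) (run select_last s)"
    unfolding select_last_def run.simps(3) run.simps(2) aval.simps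
  proof (rule run_For_invariant[where I = ?I], goal_cases)
    case 1
    then show ?case using r by (simp add: upd_apply)
  next
    case (2 m t)
    then have e: "t ''w'' = s ''w''" "t ''ord'' = s ''ord''" "t ''pw'' = s ''pw''" "t ''r'' = s ''r''"
      by (simp_all add: upd_other)
    let ?b = "t ''b'' 0"
    show ?case
    proof (cases "m < s ''r'' 0 \<and> ?W m * ?P ?b < ?W ?b * ?P m")
      case True
      have "?W m * ?P q \<le> ?W q * ?P m" if "q < Suc m" "q < s ''r'' 0" for q
      proof (cases "q = m")
        case False
        with that have "q < m" by simp
        then have "?W ?b * ?P q \<le> ?W q * ?P ?b" using 2(2) that by blast
        then show ?thesis using True by (rule cross_ratio_trans[OF _ conjunct2])
      qed simp
      then show ?thesis using True e by (simp add: upd_apply)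
    next
      case False
      then have "?W ?b * ?P m \<le> ?W m * ?P ?b" if "m < s ''r'' 0" using that by simp
      then show ?thesis using False 2(2) e by (auto simp: upd_apply less_Suc_eq)
    qed
  next
    case (3 t)
    then show ?case by (simp add: upd_apply)
  qed
  then show "b < s ''r'' 0" "q < s ''r'' 0 \<Longrightarrow> ?W b * ?P q \<le> ?W q * ?P b"
    using r unfolding b_def by auto
qed

section \<open>Placing the last coflow and reducing the weights\<close>

definition swap_last :: prog where
  "swap_last =
     PSeq (PWrite ''kb'' (Const 0) (Read ''ord'' (scalar ''b'')))
     (PSeq (PWrite ''ord'' (scalar ''b'') (Read ''ord'' (Sub (scalar ''r'') (Const 1))))
           (PWrite ''ord'' (Sub (scalar ''r'') (Const 1)) (scalar ''kb'')))"

text \<open>The reduced weights are scaled by the load of the selected coflow in place of a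
  division; as the factor is common to all coflows, comparisons of ratios are unaffected.
  \<open>wb\<close> keeps the selected weight, which the loop overwrites. For remaining coflows
  minimality of the ratio prevents truncation.\<close>

definition reweight :: prog where
  "reweight =
     PSeq (PWrite ''wb'' (Const 0) (Read ''w'' (scalar ''kb'')))
       (PCond (Less (Const 0) (Read ''pw'' (scalar ''kb'')))
         (PFor ''k'' (scalar ''n'')
           (PWrite ''w'' (scalar ''k'')
             (Sub (Mul (Read ''w'' (scalar ''k'')) (Read ''pw'' (scalar ''kb'')))
                  (Mul (scalar ''wb'') (Read ''pw'' (scalar ''k''))))))
         PSkip)"

lemma writes_reweight: "writes reweight = {''wb'', ''k'', ''w''}"
  by (auto simp: reweight_def)

lemma run_reweight:
  assumes "k < s ''n'' 0"
  shows "run reweight s ''w'' k =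
    (if s ''pw'' (s ''kb'' 0) = 0 then s ''w'' k
     else s ''w'' k * s ''pw'' (s ''kb'' 0) - s ''w'' (s ''kb'' 0) * s ''pw'' k)"
proof (cases "s ''pw'' (s ''kb'' 0) = 0")
  case True
  then show ?thesis by (simp add: reweight_def upd_apply)
next
  case False
  let ?p = "s ''pw''" and ?kb = "s ''kb'' 0"
  let ?s = "upd s ''wb'' 0 (s ''w'' ?kb)"
  let ?f = "\<lambda>k. s ''w'' k * ?p ?kb - s ''w'' ?kb * ?p k"
  let ?loop = "PFor ''k'' (scalar ''n'')
           (PWrite ''w'' (scalar ''k'')
             (Sub (Mul (Read ''w'' (scalar ''k'')) (Read ''pw'' (scalar ''kb'')))
                  (Mul (scalar ''wb'') (Read ''pw'' (scalar ''k'')))))"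
  have "\<forall>k. run ?loop ?s ''w'' k = (if k < s ''n'' 0 then ?f k else s ''w'' k)"
  proof (rule run_For_invariant[where I = "\<lambda>m t. \<forall>k. t ''w'' k = (if k < m then ?f k else s ''w'' k)"],
      goal_cases)
    case 1
    then show ?case by (simp add: upd_apply)
  next
    case (2 m t)
    have "t ''wb'' = ?s ''wb''" by (rule 2(3)) simp
    moreover have "t ''pw'' = s ''pw''" "t ''kb'' = s ''kb''" using 2(3) by (simp_all add: upd_other)
    ultimately show ?case using 2(2) by (auto simp: upd_apply less_Suc_eq)
  next
    case (3 t)
    then show ?case by (simp add: upd_apply)
  qed
  moreover have "run reweight s = run ?loop ?s"
    using False by (simp add: reweight_def upd_apply del: run.simps(5))
  ultimately show ?thesis using assms False by simp
qed

lemma good_order_cong: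
  assumes "\<And>q. q < r \<Longrightarrow> W (\<sigma> q) = W' (\<sigma> q)"
  shows "good_order M m n P \<sigma> r W \<longleftrightarrow> good_order M m n P \<sigma> r W'"
  using assms by (simp add: good_order_def)

definition order_step :: prog where
  "order_step =
     PSeq (PWrite ''r'' (Const 0) (Sub (scalar ''n'') (scalar ''a'')))
     (PSeq bottleneck (PSeq port_loads (PSeq select_last (PSeq swap_last reweight))))"

lemma writes_order_step:
  "writes order_step = {''r'', ''best'', ''bmu'', ''mu'', ''ld'', ''q'', ''k'', ''t'', ''j'', ''pw'', ''b'',
     ''kb'', ''ord'', ''wb'', ''w''}"
  by (auto simp: order_step_def writes_bottleneck writes_port_loads writes_select_last writes_reweight
      swap_last_def)

text \<open>Both prefixes have as image the complement of the image of the common suffix. Hence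
  every order extending the placed suffix has the same set of remaining coflows.\<close>

lemma bij_betw_image_prefix:
  assumes "bij_betw \<sigma> {..<n} {..<n}" "bij_betw \<tau> {..<n} {..<n}" "r \<le> (n::nat)"
    and "\<And>q. r \<le> q \<Longrightarrow> q < n \<Longrightarrow> \<sigma> q = \<tau> q"
  shows "\<sigma> ` {..<r} = \<tau> ` {..<r}"
proof -
  have *: "f ` {..<r} = {..<n} - f ` {r..<n}" if "bij_betw f {..<n} {..<n}" for f
  proof -
    have "f ` ({..<n} - {r..<n}) = f ` {..<n} - f ` {r..<n}"
      using that by (intro inj_on_image_set_diff[of f "{..<n}"]) (auto simp: bij_betw_def)
    moreover have "{..<n} - {r..<n} = {..<r}" using assms(3) by auto
    ultimately show ?thesis using that by (simp add: bij_betw_def)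
  qed
  have "\<sigma> ` {r..<n} = \<tau> ` {r..<n}" using assms(4) by (intro image_cong) auto
  then show ?thesis using *[OF assms(1)] *[OF assms(2)] by simp
qed

text \<open>The last claim runs backwards and concerns any \<open>\<sigma>\<close> that agrees with
  the new order from position \<open>r\<close> on, because later rounds still permute the positions
  below \<open>r\<close>. This is harmless: the bottleneck and the minimal ratio depend only on the
  set of coflows at positions up to \<open>r\<close>.\<close>

lemma run_order_step:
  assumes N: "0 < s ''N'' 0" and n: "s ''n'' 0 = n" and a: "s ''a'' 0 < n"
    and bij: "bij_betw (s ''ord'') {..<n} {..<n}"
  defines "s' \<equiv> run order_step s" and "r \<equiv> n - s ''a'' 0 - 1"
  shows "bij_betw (s' ''ord'') {..<n} {..<n}"
    and "r < q \<Longrightarrow> s' ''ord'' q = s ''ord'' q"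
    and "bij_betw \<sigma> {..<n} {..<n} \<Longrightarrow> (\<And>q. r \<le> q \<Longrightarrow> q < n \<Longrightarrow> \<sigma> q = s' ''ord'' q) \<Longrightarrow>
      good_order (2 * s ''N'' 0) m n (state_load s) \<sigma> r (s' ''w'') \<Longrightarrow>
      good_order (2 * s ''N'' 0) m n (state_load s) \<sigma> (Suc r) (s ''w'')"
proof -
  define s1 where "s1 = upd s ''r'' 0 (n - s ''a'' 0)"
  define s2 where "s2 = run bottleneck s1"
  define s3 where "s3 = run port_loads s2"
  define s4 where "s4 = run select_last s3"
  define s5 where "s5 = run swap_last s4"
  have s': "s' = run reweight s5"
    by (simp add: s'_def order_step_def s1_def s2_def s3_def s4_def s5_def n)
  \<comment> \<open>The program variable \<open>r\<close> counts the remaining coflows and so equals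
    \<open>Suc r\<close> here; position \<open>r\<close> is the one being filled.\<close>
  have r: "n - s ''a'' 0 = Suc r" "r < n" using a by (auto simp: r_def)
  have fr2: "s2 y = s1 y" if "y \<notin> writes bottleneck" for y
    using that unfolding s2_def by (rule run_frame)
  have fr3: "s3 y = s2 y" if "y \<notin> writes port_loads" for y
    using that unfolding s3_def by (rule run_frame)
  have fr4: "s4 y = s3 y" if "y \<notin> writes select_last" for y
    using that unfolding s4_def by (rule run_frame)
  have fr5: "s5 y = s4 y" if "y \<notin> {''kb'', ''ord''}" for y
    unfolding s5_def by (rule run_frame) (use that in \<open>simp add: swap_last_def\<close>)
  have fr6: "s' y = s5 y" if "y \<notin> writes reweight" for y
    using that unfolding s' by (rule run_frame)
  have e1: "s1 ''N'' = s ''N''" "s1 ''n'' = s ''n''" "s1 ''ord'' = s ''ord''" "s1 ''d'' = s ''d''"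
    "s1 ''w'' = s ''w''" "s1 ''r'' 0 = Suc r"
    by (simp_all add: s1_def upd_other upd_same r)
  have e2: "s2 ''N'' = s ''N''" "s2 ''n'' = s ''n''" "s2 ''ord'' = s ''ord''" "s2 ''d'' = s ''d''"
    "s2 ''w'' = s ''w''" "s2 ''r'' 0 = Suc r"
    using e1 by (simp_all add: fr2 writes_bottleneck)
  have e3: "s3 ''n'' = s ''n''" "s3 ''ord'' = s ''ord''" "s3 ''w'' = s ''w''" "s3 ''r'' 0 = Suc r"
    using e2 by (simp_all add: fr3 writes_port_loads)
  have e4: "s4 ''n'' = s ''n''" "s4 ''ord'' = s ''ord''" "s4 ''w'' = s ''w''" "s4 ''r'' 0 = Suc r"
    "s4 ''pw'' = s3 ''pw''"
    using e3 by (simp_all add: fr4 writes_select_last)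
  define \<mu> where "\<mu> = s2 ''bmu'' 0"
  define b where "b = s4 ''b'' 0"
  let ?P = "state_load s"
  have ld: "state_load s1 = ?P" "state_load s2 = ?P"
    using e1 e2 by (auto intro: state_load_cong)
  have \<mu>: "\<mu> < 2 * s ''N'' 0"
    and max: "\<And>\<nu>. \<nu> < 2 * s ''N'' 0 \<Longrightarrow> (\<Sum>q<Suc r. ?P \<nu> (s ''ord'' q)) \<le> (\<Sum>q<Suc r. ?P \<mu> (s ''ord'' q))"
    using run_bottleneck[of s1] N n r(2) e1 ld unfolding \<mu>_def s2_def by simp_all
  have pw: "s3 ''pw'' k = ?P \<mu> k" if "k < n" for k
    using run_port_loads[of k s2] that e2 n ld unfolding s3_def \<mu>_def by simp
  have ordn: "s ''ord'' q < n" if "q < n" for q using bij that by (auto simp: bij_betw_def)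
  have b: "b < Suc r"
    and bmin: "\<And>q. q < Suc r \<Longrightarrow> s ''w'' (s ''ord'' b) * ?P \<mu> (s ''ord'' q) \<le>
        s ''w'' (s ''ord'' q) * ?P \<mu> (s ''ord'' b)"
  proof -
    have *: "0 < s3 ''r'' 0" "s3 ''r'' 0 \<le> s3 ''n'' 0" using e3 n r(2) by auto
    show b: "b < Suc r" using run_select_last(1)[where s = s3, OF *] e3 unfolding b_def s4_def by simp
    show "s ''w'' (s ''ord'' b) * ?P \<mu> (s ''ord'' q) \<le> s ''w'' (s ''ord'' q) * ?P \<mu> (s ''ord'' b)"
      if "q < Suc r" for q
      using run_select_last(2)[where s = s3, OF *, of q] that b r(2) e3 pw[OF ordn] unfolding b_def s4_def by simp
  qed
  have ord5: "s5 ''ord'' q = (if q = r then s ''ord'' b else if q = b then s ''ord'' r else s ''ord'' q)" for q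
    by (simp add: s5_def swap_last_def upd_apply e4 b_def)
  have kb5: "s5 ''kb'' 0 = s ''ord'' b"
    by (simp add: s5_def swap_last_def upd_apply e4 b_def)
  have ord': "s' ''ord'' = s5 ''ord''" by (simp add: fr6 writes_reweight)
  have swap: "s' ''ord'' = s ''ord'' \<circ> Transposition.transpose b r"
    by (auto simp: fun_eq_iff ord' ord5 Transposition.transpose_def)
  have "bij_betw (Transposition.transpose b r) {..<n} {..<n}"
    using b r(2) by (intro bij_betwI[where g = "Transposition.transpose b r"])
      (auto simp: Transposition.transpose_def)
  then show bij': "bij_betw (s' ''ord'') {..<n} {..<n}"
    unfolding swap using bij by (rule bij_betw_trans)
  show tail: "s' ''ord'' q = s ''ord'' q" if "r < q" for q
    using that b by (simp add: ord' ord5)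
  show "good_order (2 * s ''N'' 0) m n ?P \<sigma> (Suc r) (s ''w'')"
    if \<sigma>: "bij_betw \<sigma> {..<n} {..<n}" "\<And>q. r \<le> q \<Longrightarrow> q < n \<Longrightarrow> \<sigma> q = s' ''ord'' q"
      and good: "good_order (2 * s ''N'' 0) m n ?P \<sigma> r (s' ''w'')"
  proof -
    have \<sigma>r: "\<sigma> r = s ''ord'' b" using \<sigma>(2)[of r] r(2) by (simp add: ord' ord5)
    have \<sigma>n: "\<sigma> q < n" if "q < n" for q using \<sigma>(1) that by (auto simp: bij_betw_def)
    have "\<sigma> ` {..<Suc r} = s ''ord'' ` {..<Suc r}"
      using r(2) \<sigma>(2) tail by (intro bij_betw_image_prefix[OF \<sigma>(1) bij]) auto
    then have img: "\<sigma> ` {..r} = s ''ord'' ` {..r}" by (simp add: lessThan_Suc_atMost)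
    have inj: "inj_on \<sigma> {..r}" "inj_on (s ''ord'') {..r}"
      using \<sigma>(1) bij r(2) by (auto simp: bij_betw_def intro: inj_on_subset)
    have sums: "(\<Sum>p\<le>r. ?P \<nu> (\<sigma> p)) = (\<Sum>p\<le>r. ?P \<nu> (s ''ord'' p))" for \<nu>
      using sum.reindex[OF inj(1), of "?P \<nu>"] sum.reindex[OF inj(2), of "?P \<nu>"] img by simp
    let ?W = "if ?P \<mu> (\<sigma> r) = 0 then s ''w'' else (\<lambda>k. s ''w'' k * ?P \<mu> (\<sigma> r) - s ''w'' (\<sigma> r) * ?P \<mu> k)"
    have "s' ''w'' k = ?W k" if "k < n" for k
      using run_reweight[of k s5] that pw[OF that] pw[OF ordn, of b] b r(2)
      by (simp add: s' fr5 e4 n kb5 \<sigma>r)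
    then have W': "good_order (2 * s ''N'' 0) m n ?P \<sigma> r ?W"
      using good \<sigma>n r(2) good_order_cong[of r "s' ''w''" \<sigma> ?W] by auto
    show ?thesis
    proof (rule good_order_step[OF _ r(2) \<sigma>(1) \<mu> _ _ refl W'])
      show "0 < 2 * s ''N'' 0" using N by simp
      show "(\<Sum>p\<le>r. ?P \<nu> (\<sigma> p)) \<le> (\<Sum>p\<le>r. ?P \<mu> (\<sigma> p))" if "\<nu> < 2 * s ''N'' 0" for \<nu>
        using max[OF that] by (simp add: sums lessThan_Suc_atMost)
      fix q assume "q \<le> r"
      then have "\<sigma> q \<in> s ''ord'' ` {..r}" unfolding img[symmetric] by simp
      then obtain p where p: "p \<le> r" "\<sigma> q = s ''ord'' p" by auto
      show "s ''w'' (\<sigma> r) * ?P \<mu> (\<sigma> q) \<le> s ''w'' (\<sigma> q) * ?P \<mu> (\<sigma> r)"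
        using bmin[of p] p by (simp add: \<sigma>r)
    qed
  qed
qed

definition order_phase :: prog where
  "order_phase =
     PSeq (PFor ''q'' (scalar ''n'') (PWrite ''ord'' (scalar ''q'') (scalar ''q'')))
          (PFor ''a'' (scalar ''n'') order_step)"

lemma writes_order_phase: "writes order_phase = insert ''a'' (writes order_step)"
  by (auto simp: order_phase_def writes_order_step)

lemma run_order_phase:
  assumes N: "0 < s ''N'' 0" and n: "s ''n'' 0 = n"
  defines "s' \<equiv> run order_phase s"
  shows "bij_betw (s' ''ord'') {..<n} {..<n}"
    and "good_order (2 * s ''N'' 0) m n (state_load s) (s' ''ord'') n (s ''w'')"
proof -
  let ?init = "PFor ''q'' (scalar ''n'') (PWrite ''ord'' (scalar ''q'') (scalar ''q''))"
  define s1 where "s1 = run ?init s"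
  have ord: "\<forall>q<n. s1 ''ord'' q = q"
    unfolding s1_def
  proof (rule run_For_invariant[where I = "\<lambda>m t. \<forall>q<m. t ''ord'' q = q"])
  qed (auto simp: upd_apply n less_Suc_eq)
  have fr1: "s1 y = s y" if "y \<notin> {''q'', ''ord''}" for y
    unfolding s1_def by (rule run_frame) (use that in auto)
  let ?P = "state_load s"
  let ?good = "good_order (2 * s ''N'' 0) m n ?P"
  \<comment> \<open>The implication leads from the current weights on the unplaced prefix to the
    initial weights on all positions. At the start it is trivial, and after \<open>n\<close> rounds
    its premise concerns the empty prefix and holds trivially.\<close>
  let ?I = "\<lambda>a t. bij_betw (t ''ord'') {..<n} {..<n} \<and>
    (\<forall>\<sigma>. bij_betw \<sigma> {..<n} {..<n} \<longrightarrow> (\<forall>q. n - a \<le> q \<longrightarrow> q < n \<longrightarrow> \<sigma> q = t ''ord'' q) \<longrightarrow>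
       ?good \<sigma> (n - a) (t ''w'') \<longrightarrow> ?good \<sigma> n (s ''w''))"
  have "?I n (run (PFor ''a'' (scalar ''n'') order_step) s1)"
  proof (rule run_For_invariant[where I = ?I])
    have "bij_betw (s1 ''ord'') {..<n} {..<n} = bij_betw (\<lambda>q. q) {..<n} {..<n}"
      using ord by (intro bij_betw_cong) auto
    then show "?I 0 s1" using fr1[of "''w''"] by (simp add: bij_betw_def)
    show "?I n (upd t ''a'' 0 (aval (scalar ''n'') s1))" if "?I (aval (scalar ''n'') s1) t" for t
      using that n fr1[of "''n''"] by (simp add: upd_other)
    fix a t
    assume a: "a < aval (scalar ''n'') s1" and I: "?I a t"
      and fr: "\<And>y. y \<notin> writes (PFor ''a'' (scalar ''n'') order_step) \<Longrightarrow> t y = s1 y"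
    let ?t = "upd t ''a'' 0 a"
    have an: "a < n" using a n fr1[of "''n''"] by simp
    have e: "?t ''N'' = s ''N''" "?t ''n'' = s ''n''" "?t ''d'' = s ''d''" "?t ''ord'' = t ''ord''"
      "?t ''w'' = t ''w''" "?t ''a'' 0 = a"
      using fr by (simp_all add: upd_other upd_same writes_order_step fr1)
    have P: "state_load ?t = ?P" using e by (intro state_load_cong)
    have bij: "bij_betw (t ''ord'') {..<n} {..<n}" using I by blast
    let ?t' = "run order_step ?t" and ?r = "n - a - 1"
    note step = run_order_step[of ?t n, unfolded e P, OF N n an bij]
    have r: "n - Suc a = ?r" "n - a = Suc ?r" using an by auto
    have "?good \<sigma> n (s ''w'')"
      if \<sigma>: "bij_betw \<sigma> {..<n} {..<n}" "\<forall>q. n - Suc a \<le> q \<longrightarrow> q < n \<longrightarrow> \<sigma> q = ?t' ''ord'' q"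
        "?good \<sigma> (n - Suc a) (?t' ''w'')" for \<sigma>
    proof -
      have "?good \<sigma> (Suc ?r) (t ''w'')"
        using \<sigma> unfolding r(1) by (intro step(3)) auto
      then have g: "?good \<sigma> (n - a) (t ''w'')" by (subst r(2))
      have "\<sigma> q = t ''ord'' q" if q: "n - a \<le> q" "q < n" for q
      proof -
        have "?r < q" using q(1) an by linarith
        from step(2)[OF this] show ?thesis using \<sigma>(2)[rule_format, of q] q by simp
      qed
      then show ?thesis by (rule I[THEN conjunct2, rule_format, OF \<sigma>(1) _ g])
    qed
    then show "?I (Suc a) ?t'" by (intro conjI allI impI step(1))
  qed
  moreover have "s' = run (PFor ''a'' (scalar ''n'') order_step) s1"
    unfolding s'_def order_phase_def s1_def by (simp only: run.simps(3))
  ultimately have I: "?I n s'" by simp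
  from I show bij: "bij_betw (s' ''ord'') {..<n} {..<n}" by (rule conjunct1)
  have "?good (s' ''ord'') (n - n) (s' ''w'')" by (simp add: good_order_def)
  then show "?good (s' ''ord'') n (s ''w'')"
    by (rule I[THEN conjunct2, rule_format, OF bij refl])
qed

text \<open>Multiplies every weight by the product of all denominators, cancelling its own. The
  language compares only by \<open>Less\<close>, so equality of \<open>l\<close> and
  \<open>k\<close> is tested by two negations.\<close>

definition weight_phase :: prog where
  "weight_phase =
     PFor ''k'' (scalar ''n'')
       (PSeq (PWrite ''w'' (scalar ''k'') (Read ''wnum'' (scalar ''k'')))
         (PFor ''l'' (scalar ''n'')
           (PCond (Conj (Neg (Less (scalar ''l'') (scalar ''k''))) (Neg (Less (scalar ''k'') (scalar ''l''))))
              PSkip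
              (PWrite ''w'' (scalar ''k'')
                 (Mul (Read ''w'' (scalar ''k'')) (Read ''wden'' (scalar ''l'')))))))"

lemma writes_weight_phase: "writes weight_phase = {''k'', ''w'', ''l''}"
  by (auto simp: weight_phase_def)

lemma run_weight_phase:
  assumes n: "s ''n'' 0 = n" and k: "k < n"
  shows "run weight_phase s ''w'' k = s ''wnum'' k * (\<Prod>l\<in>{..<n} - {k}. s ''wden'' l)"
proof -
  let ?f = "\<lambda>k m. s ''wnum'' k * (\<Prod>l\<in>{..<m} - {k}. s ''wden'' l)"
  have "\<forall>k<n. run weight_phase s ''w'' k = ?f k n"
    unfolding weight_phase_def
  proof (rule run_For_invariant[where I = "\<lambda>m t. \<forall>k<m. t ''w'' k = ?f k n"], goal_cases)
    case 1
    then show ?case by simp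
  next
    case (2 k t)
    from 2(3) have e: "t ''n'' = s ''n''" "t ''wnum'' = s ''wnum''" "t ''wden'' = s ''wden''"
      by simp_all
    let ?t = "upd (upd t ''k'' 0 k) ''w'' k (s ''wnum'' k)"
    let ?loop = "PFor ''l'' (scalar ''n'')
           (PCond (Conj (Neg (Less (scalar ''l'') (scalar ''k''))) (Neg (Less (scalar ''k'') (scalar ''l''))))
              PSkip
              (PWrite ''w'' (scalar ''k'')
                 (Mul (Read ''w'' (scalar ''k'')) (Read ''wden'' (scalar ''l'')))))"
    have "\<forall>k'. run ?loop ?t ''w'' k' = (if k' = k then ?f k n else t ''w'' k')"
    proof (rule run_For_invariant[where I = "\<lambda>m t'. \<forall>k'. t' ''w'' k' = (if k' = k then ?f k m else t ''w'' k')"],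
        goal_cases)
      case 1
      then show ?case by (simp add: upd_apply)
    next
      case (2 m t')
      have "t' ''k'' = ?t ''k''" by (rule 2(3)) simp
      moreover have "t' ''wden'' = s ''wden''" using 2(3) e by (simp add: upd_other)
      moreover have "{..<Suc m} - {k} = (if m = k then {..<m} - {k} else insert m ({..<m} - {k}))"
        by auto
      ultimately show ?case using 2(2) by (auto simp: upd_apply)
    next
      case (3 t')
      then show ?case using e n by (simp add: upd_apply)
    qed
    moreover have "run (PSeq (PWrite ''w'' (scalar ''k'') (Read ''wnum'' (scalar ''k''))) ?loop) (upd t ''k'' 0 k)
        = run ?loop ?t"
      using e by (simp add: upd_apply del: run.simps(5))
    ultimately show ?case using 2(2) by (simp add: less_Suc_eq del: run.simps)
  next
    case (3 t)
    then show ?case using n by (simp add: upd_apply)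
  qed
  then show ?thesis using k by blast
qed

section \<open>The approximation guarantee\<close>

lemma load_cong:
  assumes "\<And>i j. i < N \<Longrightarrow> j < N \<Longrightarrow> f i j k = g i j k" "\<mu> < 2 * N"
  shows "load N f \<mu> k = load N g \<mu> k"
  using assms by (auto simp: load_def)

text \<open>Loads read from the memory match those of the instance only for actual ports and
  coflows, so the transfer uses that the order stays among the coflows.\<close>

lemma good_order_load_cong:
  assumes P: "\<And>\<mu> k. \<mu> < M \<Longrightarrow> k < n \<Longrightarrow> P \<mu> k = P' \<mu> k"
    and \<sigma>: "\<And>q. q < n \<Longrightarrow> \<sigma> q < n" and good: "good_order M m n P \<sigma> n W"
  shows "good_order M m n P' \<sigma> n W"
  unfolding good_order_def
proof (intro allI impI)
  fix C assume C: "parallel_ineqs M m n P' C"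
  have sums: "(\<Sum>k\<in>U. real (P' \<mu> k)) = (\<Sum>k\<in>U. real (P \<mu> k))"
    "(\<Sum>k\<in>U. real (P' \<mu> k) * C k) = (\<Sum>k\<in>U. real (P \<mu> k) * C k)"
    if "\<mu> < M" "U \<subseteq> {..<n}" for \<mu> U
    using that by (auto intro!: sum.cong simp: P subset_eq)
  have "parallel_ineqs M m n P C"
    using C sums unfolding parallel_ineqs_def by simp
  moreover have "max_prefix_load M P \<sigma> q = max_prefix_load M P' \<sigma> q" if "q < n" for q
  proof -
    have "(\<lambda>\<mu>. \<Sum>p\<le>q. P \<mu> (\<sigma> p)) ` {..<M} = (\<lambda>\<mu>. \<Sum>p\<le>q. P' \<mu> (\<sigma> p)) ` {..<M}"
      using that \<sigma> by (intro image_cong refl sum.cong) (auto simp: P)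
    then show ?thesis by (simp add: max_prefix_load_def)
  qed
  ultimately show "(\<Sum>q<n. real (W (\<sigma> q)) * real (max_prefix_load M P' \<sigma> q)) \<le>
      2 * real m * (\<Sum>q<n. real (W (\<sigma> q)) * C (\<sigma> q))"
    using good by (auto simp: good_order_def)
qed

lemma input_demand:
  assumes "i < num_ports I" "j < num_ports I" "k < num_coflows I"
  shows "input_state I ''d'' (cell (num_ports I) i j k) = demand I i j k"
proof -
  let ?N = "num_ports I" and ?c = "cell (num_ports I) i j k"
  have d: "?c div ?N = k * ?N + i" "?c mod ?N = j" using assms by (simp_all add: cell_def)
  then have "?c div ?N mod ?N = i" "?c div ?N div ?N = k" using assms by simp_all
  then have e: "?c div ?N mod ?N = i" "?c div (?N * ?N) = k" by (simp_all add: div_mult2_eq)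
  have "?c < (k * ?N + i + 1) * ?N" using assms by (simp add: cell_def)
  also have "\<dots> \<le> (num_coflows I * ?N) * ?N"
  proof (rule mult_right_mono)
    have "k * ?N + i + 1 \<le> (k + 1) * ?N" using assms by simp
    also have "\<dots> \<le> num_coflows I * ?N" using assms by (intro mult_right_mono) auto
    finally show "k * ?N + i + 1 \<le> num_coflows I * ?N" .
  qed simp
  finally show ?thesis using d e by (simp add: input_state_def Let_def)
qed

definition coflow_program :: prog where
  "coflow_program = PSeq weight_phase (PSeq order_phase greedy_phase)"

lemmas program_defs =
  coflow_program_def weight_phase_def order_phase_def greedy_phase_def order_step_def bottleneck_def
  port_total_def port_loads_def sum_load_def select_last_def swap_last_def reweight_def
  greedy_round_def select_flow_def transmit_flow_def cell_exp_def

lemma well_formed_coflow_program: "well_formed coflow_program"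
  by (simp add: program_defs)

text \<open>Only entries of \<open>w\<close> are ever stored as products, with loads or denominators
  as the other factors, and \<open>wb\<close> is a copy of one of them. Loads, times and demands
  arise by addition and subtraction.\<close>

lemma tame_coflow_program: "tame {''w'', ''wb''} (compile coflow_program)"
  by (simp add: program_defs)

lemma coflow_program_correct:
  assumes wf: "wf_instance I"
  defines "S \<equiv> output_schedule (run coflow_program (input_state I))"
  shows "feasible I S" and "objective I S \<le> 4 * real (num_cores I) * optimum I"
proof -
  let ?N = "num_ports I" and ?n = "num_coflows I" and ?m = "num_cores I"
  define s0 where "s0 = input_state I"
  define s1 where "s1 = run weight_phase s0"
  define s2 where "s2 = run order_phase s1"
  define s3 where "s3 = run greedy_phase s2"
  have S: "S = output_schedule s3"
    by (simp add: S_def coflow_program_def s0_def s1_def s2_def s3_def)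
  have fr1: "s1 y = s0 y" if "y \<notin> writes weight_phase" for y
    using that unfolding s1_def by (rule run_frame)
  have fr2: "s2 y = s1 y" if "y \<notin> writes order_phase" for y
    using that unfolding s2_def by (rule run_frame)
  have fr3: "s3 y = s2 y" if "y \<notin> writes greedy_phase" for y
    using that unfolding s3_def by (rule run_frame)
  have e1: "s1 ''N'' 0 = ?N" "s1 ''n'' 0 = ?n" "s1 ''d'' = s0 ''d''" "s1 ''T'' 0 = 0" "s1 ''len'' 0 = 0"
    "s1 ''core'' = (\<lambda>_. 0)"
    by (simp_all add: fr1 writes_weight_phase s0_def input_state_def Let_def)
  have e2: "s2 ''N'' 0 = ?N" "s2 ''n'' 0 = ?n" "s2 ''d'' = s0 ''d''" "s2 ''T'' 0 = 0" "s2 ''len'' 0 = 0"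
    "s2 ''core'' = (\<lambda>_. 0)"
    using e1 by (simp_all add: fr2 writes_order_phase writes_order_step)
  \<comment> \<open>The array \<open>core\<close> is never written; its initial value 0 is what
    assigns every coflow to core 0.\<close>
  have core: "s3 ''core'' = (\<lambda>_. 0)"
    using e2 by (simp add: fr3 greedy_phase_def greedy_round_def select_flow_def transmit_flow_def)
  have N: "0 < ?N" using wf by (simp add: wf_instance_def)
  let ?\<sigma> = "s2 ''ord''" and ?P = "load ?N (demand I)"
  have bij: "bij_betw ?\<sigma> {..<?n} {..<?n}"
    unfolding s2_def by (rule run_order_phase) (use N e1 in auto)
  then have \<sigma>n: "?\<sigma> q < ?n" if "q < ?n" for q using that by (auto simp: bij_betw_def)
  have good: "good_order (2 * ?N) ?m ?n ?P ?\<sigma> ?n (s1 ''w'')"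
  proof (rule good_order_load_cong)
    show "good_order (2 * ?N) ?m ?n (state_load s1) ?\<sigma> ?n (s1 ''w'')"
      using run_order_phase(2)[of s1 ?n ?m] N e1 unfolding s2_def by simp
    show "state_load s1 \<mu> k = ?P \<mu> k" if "\<mu> < 2 * ?N" "k < ?n" for \<mu> k
      unfolding state_load_def e1 using that by (intro load_cong) (auto simp: s0_def input_demand)
  qed (rule \<sigma>n)
  obtain rem T where inv: "greedy_inv ?N ?n ?\<sigma> (demand I) T rem (active s3)"
    and rem: "\<forall>i<?N. \<forall>j<?N. \<forall>k<?n. rem i j k = 0"
    using run_greedy_phase[of s2 ?N ?n "demand I"] e2 bij input_demand
    unfolding s3_def s0_def by auto
  have S': "core_of S k = 0" "rate S i j k t = (if active s3 i j k t then 1 else 0)" for i j k t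
    by (simp_all add: S output_schedule_def active_def core)
  show feas: "feasible I S"
    by (rule greedy_schedule(1)[OF wf inv bij]) (use rem S' in auto)
  let ?D = "\<lambda>q. real (max_prefix_load (2 * ?N) ?P ?\<sigma> q)"
  have compl: "coflow_completion I S (?\<sigma> q) \<le> 2 * ?D q" if "q < ?n" for q
    by (rule greedy_schedule(2)[OF wf inv bij]) (use rem S' that in auto)
  let ?w = "\<lambda>k. real_of_rat (weight I k)"
  define c where "c = (\<Prod>l<?n. real (nat (snd (quotient_of (weight I l)))))"
  have den: "0 < snd (quotient_of (weight I k))" for k
    by (rule quotient_of_denom_pos')
  have c: "0 < c" unfolding c_def using den by (intro prod_pos) auto
  \<comment> \<open>The integers of the program are the true weights times the common denominator
    \<open>c\<close>, a positive factor that cancels from the comparison of objectives.\<close>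
  have W: "real (s1 ''w'' k) = c * ?w k" if k: "k < ?n" for k
  proof -
    obtain x y where xy: "quotient_of (weight I k) = (x, y)" by fastforce
    have y: "0 < y" using den[of k] xy by simp
    have w: "weight I k = of_int x / of_int y" using quotient_of_div[OF xy] .
    have "0 < weight I k" using wf k by (simp add: wf_instance_def)
    then have x: "0 < x" using w y by (simp add: zero_less_divide_iff)
    have s0: "s0 ''wnum'' k = nat x" "\<And>l. l < ?n \<Longrightarrow> s0 ''wden'' l = nat (snd (quotient_of (weight I l)))"
      using k xy by (simp_all add: s0_def input_state_def Let_def)
    have "s1 ''w'' k = s0 ''wnum'' k * (\<Prod>l\<in>{..<?n} - {k}. s0 ''wden'' l)"
      unfolding s1_def by (rule run_weight_phase[OF _ k]) (simp add: s0_def input_state_def Let_def)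
    then have "real (s1 ''w'' k) = real_of_int x * (\<Prod>l\<in>{..<?n} - {k}. real (nat (snd (quotient_of (weight I l)))))"
      using x s0 by simp
    moreover have "c = real_of_int y * (\<Prod>l\<in>{..<?n} - {k}. real (nat (snd (quotient_of (weight I l)))))"
      unfolding c_def using k y xy by (subst prod.remove[of _ k]) auto
    moreover have "?w k = real_of_int x / real_of_int y" by (simp add: w of_rat_divide)
    ultimately show ?thesis using y by simp
  qed
  have w0: "0 \<le> ?w k" if "k < ?n" for k
    using wf that by (auto simp: wf_instance_def less_imp_le)
  have reindex: "(\<Sum>q<?n. f (?\<sigma> q)) = (\<Sum>k<?n. f k)" for f :: "nat \<Rightarrow> real"
    using sum.reindex_bij_betw[OF bij, of f] .
  have ratio: "objective I S \<le> 4 * real ?m * objective I S'" if S': "feasible I S'" for S'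
  proof -
    let ?C = "coflow_completion I S'"
    have "objective I S = (\<Sum>q<?n. ?w (?\<sigma> q) * coflow_completion I S (?\<sigma> q))"
      unfolding objective_def by (rule reindex[symmetric])
    also have "\<dots> \<le> (\<Sum>q<?n. ?w (?\<sigma> q) * (2 * ?D q))"
      using compl w0 \<sigma>n by (intro sum_mono mult_left_mono) auto
    finally have "c * objective I S \<le> c * (\<Sum>q<?n. ?w (?\<sigma> q) * (2 * ?D q))"
      using c by simp
    also have "\<dots> = 2 * (\<Sum>q<?n. real (s1 ''w'' (?\<sigma> q)) * ?D q)"
      using W \<sigma>n by (simp add: sum_distrib_left mult_ac)
    also have "\<dots> \<le> 2 * (2 * real ?m * (\<Sum>q<?n. real (s1 ''w'' (?\<sigma> q)) * ?C (?\<sigma> q)))"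
      by (intro mult_left_mono good[unfolded good_order_def, rule_format] feasible_parallel_ineqs[OF wf S'])
        simp
    also have "(\<Sum>q<?n. real (s1 ''w'' (?\<sigma> q)) * ?C (?\<sigma> q)) = (\<Sum>k<?n. real (s1 ''w'' k) * ?C k)"
      by (rule reindex)
    also have "\<dots> = c * objective I S'"
      unfolding objective_def using W by (simp add: sum_distrib_left mult_ac)
    finally have "c * objective I S \<le> c * (4 * real ?m * objective I S')" by (simp add: mult_ac)
    then show ?thesis using c by simp
  qed
  have m: "0 < 4 * real ?m" using wf by (simp add: wf_instance_def)
  \<comment> \<open>The optimum is an infimum, so the ratio was shown against every feasible
    schedule. The constructed schedule itself shows that the infimum ranges over a nonempty
    set.\<close>
  have "objective I S / (4 * real ?m) \<le> optimum I"
    unfolding optimum_def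
  proof (rule cINF_greatest)
    show "{S. feasible I S} \<noteq> {}" using feas by auto
    show "objective I S / (4 * real ?m) \<le> objective I S'" if "S' \<in> {S. feasible I S}" for S'
      using ratio[of S'] that m by (simp add: divide_le_eq mult_ac)
  qed
  then show "objective I S \<le> 4 * real ?m * optimum I"
    using m by (simp add: divide_le_eq mult_ac)
qed

theorem theorem4:
  "\<exists>c. polynomial_time c \<and> combinatorial c \<and>
       has_approximation_ratio c (\<lambda>I. 4 * real (num_cores I))"
proof (intro exI conjI)
  let ?c = "compile coflow_program"
  show "polynomial_time ?c"
    by (rule polynomial_time_compile[OF well_formed_coflow_program tame_coflow_program])
  show "combinatorial ?c"
    by (rule combinatorial_compile[OF well_formed_coflow_program])
  show "has_approximation_ratio ?c (\<lambda>I. 4 * real (num_cores I))"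
    unfolding has_approximation_ratio_def
  proof (intro allI impI)
    fix I assume wf: "wf_instance I"
    obtain u l where "exec ?c (input_state I) u l (run coflow_program (input_state I))"
      using exec_compile[OF well_formed_coflow_program,
          of "input_state I" "input_state I ''N'' 0 + input_state I ''n'' 0"]
      by auto
    with coflow_program_correct[OF wf]
    show "\<exists>u l s. exec ?c (input_state I) u l s \<and> feasible I (output_schedule s) \<and>
        objective I (output_schedule s) \<le> 4 * real (num_cores I) * optimum I"
      by blast
  qed
qed

end
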